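(* Let $n\ge5$ and let $B_1\subset\mathbb R^n$ be the open unit ball centered at the origin. For every real number $s\in[n-5,n]$ there exist a uniformly elliptic operator $F:\operatorname{Sym}(n)\to\mathbb R$ and a continuous viscosity solution $u$ of $F(D^2u)=0$ in $B_1$ such that $\dim_{\mathcal H}\operatorname{Sing}(u)=s$. Moreover, there exist a uniformly elliptic operator $F:\operatorname{Sym}(n)\to\mathbb R$ and a continuous viscosity solution $u$ of $F(D^2u)=0$ in $B_1$ such that $\operatorname{Sing}(u)$ has positive Lebesgue measure.
   Context: $\operatorname{Sym}(n)$ is the space of real symmetric $n\times n$ matrices. An operator $F:\operatorname{Sym}(n)\to\mathbb R$ is uniformly elliptic if there are constants $\Lambda\ge\lambda>0$ with $\lambda\operatorname{tr}N\le F(M+N)-F(M)\le\Lambda\operatorname{tr}N$ for every $M\in\operatorname{Sym}(n)$ and every $N\ge0$. A continuous $u$ is a viscosity solution of $F(D^2u)=0$ in $B_1$ if, whenever $\phi$ is $C^2$ near $x_0\in B_1$ and touches $u$ from above (resp. below) at $x_0$, i.e. $\phi(x_0)=u(x_0)$ and $\phi\ge u$ (resp. $\phi\le u$) near $x_0$, then $F(D^2\phi(x_0))\ge0$ (resp. $\le0$). $\operatorname{Sing}(u)$ is the set of $x\in B_1$ for which there is no neighborhood $U\subset B_1$ of $x$ with $u\in C^2(U)$. $\dim_{\mathcal H}$ denotes Hausdorff dimension. *)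

theory Defs
  imports "HOL-Analysis.Analysis"
begin

subsection \<open>Hausdorff measure and dimension\<close>

text \<open>
  \<open>diam(U)^s\<close> with the conventions \<open>diam({})^s = 0\<close> and \<open>diam(U)^0 = 1\<close> for nonempty \<open>U\<close>
  (the library has \<open>0 powr 0 = 0\<close>, so \<open>s = 0\<close> needs its own case).
\<close>

definition diam_pow :: "real \<Rightarrow> 'a::metric_space set \<Rightarrow> ennreal" where
  "diam_pow s U =
     (if U = {} then 0 else if s = 0 then 1 else ennreal (diameter U powr s))"

text \<open>
  Boundedness is required explicitly because \<^const>\<open>diameter\<close> is real valued and carries no
  information on unbounded sets.
\<close>

definition hausdorff_premeasure ::
    "real \<Rightarrow> real \<Rightarrow> 'a::metric_space set \<Rightarrow> ennreal" where
  "hausdorff_premeasure s \<delta> A =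
     Inf {(\<Sum>i. diam_pow s (U i)) | U :: nat \<Rightarrow> 'a set.
            A \<subseteq> (\<Union>i. U i) \<and> (\<forall>i. bounded (U i) \<and> diameter (U i) \<le> \<delta>)}"

definition hausdorff_measure :: "real \<Rightarrow> 'a::metric_space set \<Rightarrow> ennreal" where
  "hausdorff_measure s A = (SUP \<delta>\<in>{0<..}. hausdorff_premeasure s \<delta> A)"

text \<open>In particular the empty set has dimension 0.\<close>

definition hausdorff_dim :: "'a::metric_space set \<Rightarrow> ereal" where
  "hausdorff_dim A = Inf {ereal s | s. 0 \<le> s \<and> hausdorff_measure s A = 0}"


subsection \<open>Twice continuously differentiable functions\<close>

definition gradient :: "(real^'n::finite \<Rightarrow> real) \<Rightarrow> real^'n \<Rightarrow> real^'n" where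
  "gradient f x = (\<chi> i. frechet_derivative f (at x) (axis i 1))"

definition hessian :: "(real^'n::finite \<Rightarrow> real) \<Rightarrow> real^'n \<Rightarrow> real^'n^'n" where
  "hessian f x = matrix (frechet_derivative (gradient f) (at x))"

definition C2_on :: "(real^'n::finite) set \<Rightarrow> (real^'n \<Rightarrow> real) \<Rightarrow> bool" where
  "C2_on U f \<longleftrightarrow> open U \<and> f differentiable_on U \<and> gradient f differentiable_on U \<and>
     continuous_on U (hessian f)"


subsection \<open>Uniformly elliptic operators\<close>

definition symmetric_matrix :: "real^'n^'n \<Rightarrow> bool" where
  "symmetric_matrix M \<longleftrightarrow> transpose M = M"

definition nonneg_matrix :: "real^'n::finite^'n \<Rightarrow> bool" where
  "nonneg_matrix N \<longleftrightarrow> symmetric_matrix N \<and> (\<forall>x. 0 \<le> x \<bullet> (N *v x))"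

text \<open>
  An operator on the symmetric matrices is represented by a function on all square matrices,
  whose values at nonsymmetric matrices are arbitrary and never used.
\<close>

definition uniformly_elliptic :: "(real^'n::finite^'n \<Rightarrow> real) \<Rightarrow> bool" where
  "uniformly_elliptic F \<longleftrightarrow>
     (\<exists>l L. 0 < l \<and> l \<le> L \<and>
        (\<forall>M N. symmetric_matrix M \<longrightarrow> nonneg_matrix N \<longrightarrow>
           l * trace N \<le> F (M + N) - F M \<and> F (M + N) - F M \<le> L * trace N))"


subsection \<open>Viscosity solutions and their singular sets\<close>

text \<open>A function on the unit ball is represented by a total function; only its values on
  \<open>ball 0 1\<close> matter below.\<close>

definition C2_near :: "real^'n::finite \<Rightarrow> (real^'n \<Rightarrow> real) \<Rightarrow> bool" where
  "C2_near x \<phi> \<longleftrightarrow> (\<exists>U. x \<in> U \<and> C2_on U \<phi>)"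

definition touches_above ::
    "(real^'n::finite \<Rightarrow> real) \<Rightarrow> (real^'n \<Rightarrow> real) \<Rightarrow> real^'n \<Rightarrow> bool" where
  "touches_above \<phi> u x \<longleftrightarrow> \<phi> x = u x \<and> (\<forall>\<^sub>F y in nhds x. \<phi> y \<ge> u y)"

definition touches_below ::
    "(real^'n::finite \<Rightarrow> real) \<Rightarrow> (real^'n \<Rightarrow> real) \<Rightarrow> real^'n \<Rightarrow> bool" where
  "touches_below \<phi> u x \<longleftrightarrow> \<phi> x = u x \<and> (\<forall>\<^sub>F y in nhds x. \<phi> y \<le> u y)"

definition viscosity_solution ::
    "(real^'n::finite^'n \<Rightarrow> real) \<Rightarrow> (real^'n \<Rightarrow> real) \<Rightarrow> bool" where
  "viscosity_solution F u \<longleftrightarrow>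
     continuous_on (ball 0 1) u \<and>
     (\<forall>x\<in>ball 0 1. \<forall>\<phi>. C2_near x \<phi> \<longrightarrow>
        (touches_above \<phi> u x \<longrightarrow> F (hessian \<phi> x) \<ge> 0) \<and>
        (touches_below \<phi> u x \<longrightarrow> F (hessian \<phi> x) \<le> 0))"

definition Sing :: "(real^'n::finite \<Rightarrow> real) \<Rightarrow> (real^'n) set" where
  "Sing u = {x \<in> ball 0 1. \<not> (\<exists>U. x \<in> U \<and> U \<subseteq> ball 0 1 \<and> C2_on U u)}"

end

theory Submission
  imports Defs
begin

text \<open>
  Identify \<open>R\<^sup>5\<close> with the traceless symmetric \<open>3 \<times> 3\<close> matrices and let \<open>P(x) = tr x\<^sup>3\<close>, a harmonic cubic.
  The function \<open>P(x) / \<bar>x\<bar>\<close> is homogeneous of degree 2 and not \<open>C\<^sup>2\<close> at the origin, and all differences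
  of Hessians of \<open>P + c P / \<bar>x\<bar>\<close> are uniformly indefinite relative to their trace: writing
  \<open>p = P(x / \<bar>x\<bar>)\<close>, the Laplacian is \<open>- 8 c p\<close>, while along suitable rank-two directions built from
  eigenvectors of the two matrices \<open>x\<close> and \<open>y\<close> the Hessian difference is at most \<open>- c \<bar>p\<^sub>x - p\<^sub>y\<bar> / 2\<close>.

  Since \<open>P\<close> is cubic, \<open>P(x) - P(x - a)\<close> is quadratic, so up to a quadratic polynomial \<open>P\<close> looks the same
  around each point \<open>a\<close>. Hence one may add to \<open>P\<close> a small multiple of a cut-off copy of
  \<open>P(x - a) / \<bar>x - a\<bar>\<close> in each ball of an infinite disjoint family, and the uniform indefiniteness of
  Hessian differences survives: a pair of points not in the same half ball is controlled by the
  linear map \<open>x \<mapsto> D\<^sup>2P(x)\<close> alone. Any set of Hessians with this property lies in the zero set of a uniformly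
  elliptic operator, a supremum of extremal operators. The centres may accumulate on any closed set
  \<open>E\<close> with empty interior, where the sum has a second order Taylor expansion, and the singular
  set is then the closure of the centres. In dimension \<open>n\<close> the function is extended constantly in
  \<open>n - 5\<close> variables. A power of a Cantor set for \<open>E\<close> realizes every dimension below \<open>n\<close>, and a cylinder over a
  compact set of irrational numbers gives positive measure.
\<close>

subsection \<open>Diagonalization of symmetric 3 by 3 matrices\<close>

text \<open>The difficulty is quantitative. Mere indefiniteness of Hessian differences does not give
  fixed ellipticity constants: a difference with positive trace must be outweighed along a unit
  direction that carries a definite share of that trace. For two points of one cone this becomes an
  inequality between the spectra of two traceless matrices, and one constant must serve all
  distances to the apex. The ratio found there, 8 for the trace against 1/2 for the direction, is
  the origin of the weight 16 in the operators.

  The other constraint is scale. A cap of radius rho carries the factor rho^3, the scaling of the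
  cubic itself: its Hessian has size of order eps rho, while its Lipschitz constant away from the
  apex is of order eps whatever rho is. The same factor makes the perturbation O(dist^3) at points
  of E, because no ball is larger than its distance from E.

  Touching is handled pointwise: every point, singular or not, has symmetric second differences (at
  an apex because the cap is odd about it), and these are ordered at a contact point.\<close>

lemma invariant_subspace_eigenvector:
  fixes A :: "real^'n^'n"
  assumes sym: "transpose A = A" and S: "subspace S" "S \<noteq> {0}"
    and inv: "\<And>v. v \<in> S \<Longrightarrow> A *v v \<in> S"
  obtains v m where "v \<in> S" "norm v = 1" "A *v v = m *\<^sub>R v"
    "\<And>u. u \<in> S \<Longrightarrow> m * (u \<bullet> u) \<le> u \<bullet> (A *v u)"
proof -
  have A_sym: "x \<bullet> (A *v y) = y \<bullet> (A *v x)" for x y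
    by (metis sym dot_lmul_matrix inner_commute transpose_matrix_vector)
  obtain w where w: "w \<in> S" "w \<noteq> 0" using S subspace_0 by fastforce
  have "compact (S \<inter> sphere 0 1)"
    by (simp add: S(1) closed_Int_compact closed_subspace)
  moreover have "w /\<^sub>R norm w \<in> S \<inter> sphere 0 1"
    using w S(1) by (simp add: subspace_scale)
  moreover have "continuous_on (S \<inter> sphere 0 1) (\<lambda>u. u \<bullet> (A *v u))"
    by (intro continuous_intros matrix_vector_mult_linear_continuous_on)
  ultimately obtain v where "v \<in> S \<inter> sphere 0 1"
    and vm: "\<forall>u\<in>S \<inter> sphere 0 1. v \<bullet> (A *v v) \<le> u \<bullet> (A *v u)"
    using continuous_attains_inf[of "S \<inter> sphere 0 1" "\<lambda>u. u \<bullet> (A *v u)"] by blast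
  then have v: "v \<in> S" "norm v = 1"
    and vmin: "\<And>u. u \<in> S \<Longrightarrow> norm u = 1 \<Longrightarrow> v \<bullet> (A *v v) \<le> u \<bullet> (A *v u)"
    by auto
  define m where "m = v \<bullet> (A *v v)"
  have ge: "m * (u \<bullet> u) \<le> u \<bullet> (A *v u)" if "u \<in> S" for u
  proof (cases "u = 0")
    case False
    have "m \<le> (u /\<^sub>R norm u) \<bullet> (A *v (u /\<^sub>R norm u))"
      unfolding m_def using that False S(1) by (intro vmin) (auto simp: subspace_scale)
    also have "\<dots> = (u \<bullet> (A *v u)) / (u \<bullet> u)"
      by (simp add: matrix_vector_mult_scaleR dot_square_norm power2_eq_square divide_simps)
    finally show ?thesis using False by (simp add: pos_le_divide_eq)
  qed simp
  \<comment> \<open>The residual of the eigenvalue equation lies in \<open>S\<close>, so moving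
    \<open>v\<close> a little along \<open>-e\<close> would lower the Rayleigh quotient unless
    \<open>e = 0\<close>.\<close>
  define e where "e = A *v v - m *\<^sub>R v"
  have eS: "e \<in> S" unfolding e_def using v inv S(1) by (simp add: subspace_diff subspace_scale)
  have vv: "v \<bullet> v = 1" using v(2) by (simp add: norm_eq_1)
  have "e \<bullet> e = 0"
  proof (rule ccontr)
    assume "e \<bullet> e \<noteq> 0"
    then have epos: "e \<bullet> e > 0" by (simp add: inner_gt_zero_iff)
    have q: "0 \<le> 2 * t * (e \<bullet> e) + t^2 * (e \<bullet> (A *v e) - m * (e \<bullet> e))" for t
    proof -
      have "v + t *\<^sub>R e \<in> S" using v eS S(1) by (simp add: subspace_add subspace_scale)
      from ge[OF this] have "0 \<le> (v + t *\<^sub>R e) \<bullet> (A *v (v + t *\<^sub>R e)) - m * ((v + t *\<^sub>R e) \<bullet> (v + t *\<^sub>R e))"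
        by simp
      also have "\<dots> = (v \<bullet> (A *v v) - m * (v \<bullet> v)) + 2 * t * (e \<bullet> (A *v v) - m * (e \<bullet> v))
          + t^2 * (e \<bullet> (A *v e) - m * (e \<bullet> e))"
        using A_sym[of v e]
        by (simp add: matrix_vector_right_distrib matrix_vector_mult_scaleR inner_left_distrib
            inner_right_distrib power2_eq_square algebra_simps inner_commute)
      also have "e \<bullet> (A *v v) - m * (e \<bullet> v) = e \<bullet> e"
        by (simp add: e_def inner_diff_right)
      also have "v \<bullet> (A *v v) - m * (v \<bullet> v) = 0" by (simp add: vv m_def)
      finally show ?thesis by simp
    qed
    define b where "b = e \<bullet> (A *v e) - m * (e \<bullet> e)"
    have b: "b \<ge> 0" using ge[OF eS] by (simp add: b_def)
    \<comment> \<open>This argument replaces the minimizer \<open>- (e \<bullet> e) / b\<close> of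
      the quadratic; the \<open>+ 1\<close> keeps the denominator positive when
      \<open>b = 0\<close>.\<close>
    have "0 \<le> 2 * (- (e \<bullet> e) / (b + 1)) * (e \<bullet> e) + (- (e \<bullet> e) / (b + 1))^2 * b"
      using q[of "- (e \<bullet> e) / (b + 1)"] by (simp add: b_def)
    also have "\<dots> = (e \<bullet> e)^2 * (- b - 2) / (b + 1)^2"
    proof -
      have "b + 1 \<noteq> 0" using b by simp
      then show ?thesis by (simp add: divide_simps power2_eq_square) (simp add: algebra_simps)
    qed
    also have "\<dots> < 0" using epos b by (intro divide_neg_pos mult_pos_neg) auto
    finally show False by simp
  qed
  then have "A *v v = m *\<^sub>R v" by (simp add: e_def)
  with v ge show ?thesis by (intro that)
qed

definition diag3 :: "real \<Rightarrow> real \<Rightarrow> real \<Rightarrow> real^3^3" where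
  "diag3 a b c = vector [vector [a,0,0], vector [0,b,0], vector [0,0,c]]"

text \<open>Eigenvectors are taken from the bottom up, each minimizing the quadratic form on the
  orthogonal complement of the previous ones; minimality is what orders the eigenvalues.\<close>

lemma symmetric_matrix_3_diagonalizable:
  fixes A :: "real^3^3"
  assumes sym: "transpose A = A"
  obtains Q a b c where "orthogonal_matrix Q" "A = Q ** diag3 a b c ** transpose Q" "a \<ge> b" "b \<ge> c"
proof -
  have A_sym: "x \<bullet> (A *v y) = y \<bullet> (A *v x)" for x y
    by (metis sym dot_lmul_matrix inner_commute transpose_matrix_vector)
  have ax: "axis 1 1 \<noteq> (0::real^3)" by simp
  obtain f3 c where f3: "norm f3 = 1" "A *v f3 = c *\<^sub>R f3" "\<And>u. c * (u \<bullet> u) \<le> u \<bullet> (A *v u)"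
    using invariant_subspace_eigenvector[OF sym, of UNIV] ax by (metis UNIV_I singletonD subspace_UNIV)
  define S2 where "S2 = {v. f3 \<bullet> v = 0}"
  have sub2: "subspace S2" unfolding S2_def by (rule subspace_hyperplane)
  have dim2: "dim S2 = 2" unfolding S2_def using f3(1) by (subst dim_hyperplane) auto
  have inv2: "A *v v \<in> S2" if "v \<in> S2" for v
    using that A_sym[of f3 v] f3(2) by (simp add: S2_def inner_commute)
  have "S2 \<noteq> {0}" using dim2 by auto
  then obtain f2 b where f2: "f2 \<in> S2" "norm f2 = 1" "A *v f2 = b *\<^sub>R f2"
      "\<And>u. u \<in> S2 \<Longrightarrow> b * (u \<bullet> u) \<le> u \<bullet> (A *v u)"
    using invariant_subspace_eigenvector[OF sym sub2 _ inv2] by metis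
  have f32: "f3 \<bullet> f2 = 0" using f2(1) by (simp add: S2_def)
  \<comment> \<open>The cross product witnesses that the last invariant subspace is nonzero.\<close>
  define f1 where "f1 = cross3 f2 f3"
  have f1o: "f1 \<bullet> f2 = 0" "f1 \<bullet> f3 = 0" unfolding f1_def by (simp_all add: dot_cross_self)
  have n1: "norm f1 = 1"
    using norm_cross_dot[of f2 f3] f32 f2(2) f3(1) norm_ge_zero[of f1]
    unfolding f1_def by (simp add: inner_commute power2_eq_1_iff) (smt (verit) norm_ge_zero)
  define S1 where "S1 = S2 \<inter> {v. f2 \<bullet> v = 0}"
  have f1S: "f1 \<in> S1" using f1o by (simp add: S1_def S2_def inner_commute)
  have sub1: "subspace S1" unfolding S1_def by (intro subspace_inter sub2 subspace_hyperplane) 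
  have inv1: "A *v v \<in> S1" if "v \<in> S1" for v
    using that inv2[of v] A_sym[of f2 v] f2(3) by (simp add: S1_def inner_commute)
  have "S1 \<noteq> {0}" using f1S n1 by auto
  then obtain g a where g: "g \<in> S1" "norm g = 1" "A *v g = a *\<^sub>R g"
    using invariant_subspace_eigenvector[OF sym sub1 _ inv1] by metis
  have go: "g \<bullet> f2 = 0" "g \<bullet> f3 = 0" "f2 \<bullet> f3 = 0" using g(1) f32 by (auto simp: S1_def S2_def inner_commute)
  have unit: "g \<bullet> g = 1" "f2 \<bullet> f2 = 1" "f3 \<bullet> f3 = 1"
    using g(2) f2(2) f3(1) by (simp_all add: norm_eq_1)
  have "c \<le> b" using f3(3)[of f2] f2(3) unit by simp
  have "b \<le> a" using f2(4)[of g] g(1,3) unit by (simp add: S1_def)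
  define Q :: "real^3^3" where "Q = transpose (vector [g, f2, f3])"
  have QQ: "transpose Q ** Q = mat 1"
    unfolding Q_def vec_eq_iff matrix_matrix_mult_def transpose_def mat_def
    using unit go
    by (simp add: forall_3 inner_vec_def inner_commute vector_3 sum_3 mult.commute)
  have orth: "orthogonal_matrix Q" using QQ by (simp add: orthogonal_matrix)
  have QQ': "Q ** transpose Q = mat 1" using orth by (simp add: orthogonal_matrix_def)
  have "(A ** Q) $ i $ j = (Q ** diag3 a b c) $ i $ j" for i j
  proof -
    have "(A ** Q) $ i $ j = (A *v (column j Q)) $ i"
      by (simp add: matrix_matrix_mult_def matrix_vector_mult_def column_def)
    moreover have "column 1 Q = g" "column 2 Q = f2" "column 3 Q = f3"
      by (auto simp: Q_def column_def transpose_def vec_eq_iff forall_3 vector_3)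
    moreover have "(Q ** diag3 a b c) $ i $ 1 = a * g $ i" "(Q ** diag3 a b c) $ i $ 2 = b * f2 $ i"
      "(Q ** diag3 a b c) $ i $ 3 = c * f3 $ i"
      by (simp_all add: Q_def diag3_def matrix_matrix_mult_def sum_3 vector_3 transpose_def)
    ultimately show ?thesis using g(3) f2(3) f3(2) exhaust_3[of j] by auto
  qed
  then have "A ** Q = Q ** diag3 a b c" by (simp add: vec_eq_iff)
  then have "A ** (Q ** transpose Q) = Q ** diag3 a b c ** transpose Q"
    by (simp add: matrix_mul_assoc)
  then have "A = Q ** diag3 a b c ** transpose Q" by (simp add: QQ')
  with orth \<open>c \<le> b\<close> \<open>b \<le> a\<close> show ?thesis using that by blast
qed

subsection \<open>Unit traceless spectra\<close>

definition unit_triple :: "real \<Rightarrow> real \<Rightarrow> real \<Rightarrow> bool" where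
  "unit_triple a b c \<longleftrightarrow> a \<ge> b \<and> b \<ge> c \<and> a + b + c = 0 \<and> a^2 + b^2 + c^2 = 1"

text \<open>Passing from a matrix to its negative exchanges top and bottom eigenvalues, so one-sided
  estimates transfer to the other side.\<close>

lemma unit_triple_uminus: "unit_triple a b c \<Longrightarrow> unit_triple (-c) (-b) (-a)"
  unfolding unit_triple_def by auto

text \<open>For an eigenvalue t, the product of its differences to the other two is
  \<open>3 t^2 - 1/2\<close>. It is nonnegative at the two ends and nonpositive in the
  middle.\<close>

lemma unit_triple_bounds:
  assumes "unit_triple a b c"
  shows "a > 0" "c < 0" "a^2 \<ge> 1/6" "c^2 \<ge> 1/6" "b^2 \<le> 1/6" 
proof -
  from assms have o: "a \<ge> b" "b \<ge> c" and s: "c = - a - b" and q: "a^2 + b^2 + c^2 = 1"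
    by (auto simp: unit_triple_def)
  have ab: "a^2 + a*b + b^2 = 1/2" using q unfolding s by (simp add: power2_eq_square algebra_simps)
  have "0 \<le> (a - b) * (a - c)" using o by (intro mult_nonneg_nonneg) auto
  then show a: "a^2 \<ge> 1/6" using ab unfolding s by (simp add: power2_eq_square algebra_simps)
  have "0 \<le> (a - c) * (b - c)" using o by (intro mult_nonneg_nonneg) auto
  moreover have c: "c^2 = a^2 + 2 * (a * b) + b^2" unfolding s by (simp add: power2_eq_square algebra_simps)
  ultimately show cc: "c^2 \<ge> 1/6" using ab unfolding s by (simp add: power2_eq_square algebra_simps)
  have "0 \<le> (a - b) * (b - c)" using o by (intro mult_nonneg_nonneg) auto
  then show "b^2 \<le> 1/6" using ab unfolding s by (simp add: power2_eq_square algebra_simps)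
  have "a \<ge> 0" "c \<le> 0" using o s by auto
  moreover have "a \<noteq> 0" "c \<noteq> 0" using a cc by auto
  ultimately show "a > 0" "c < 0" by auto
qed

text \<open>This is \<open>cone_hessian\<close> minus its conjectured least value
  \<open>-3a - 3abc\<close>, restricted to diagonal \<open>Z\<close>. In the two free parameters
  \<open>u\<close>, \<open>v\<close>, and after multiplication by \<open>k > 0\<close>, it is a sum
  of two squares; the coefficient \<open>24 k^2 - 1\<close> is nonnegative because
  \<open>a^2 \<ge> 1/6\<close>.\<close>

lemma diagonal_block_nonneg:
  assumes t: "unit_triple a b c" and z: "z1 + z2 + z3 = 0"
  shows "0 \<le> (6*a + 3*a) * z1^2 + (6*b + 3*a) * z2^2 + (6*c + 3*a) * z3^2
     - 6 * (a*z1 + b*z2 + c*z3) * (a^2*z1 + b^2*z2 + c^2*z3)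
     + 3 * (3*a*b*c) * (a*z1 + b*z2 + c*z3)^2" (is "0 \<le> ?F")
proof -
  define k l u v where "k = a/2" "l = (b - c)/2" "u = z1/2" "v = (z2 - z3)/2"
  have s: "a + b + c = 0" "a^2 + b^2 + c^2 = 1" using t by (auto simp: unit_triple_def)
  have e: "a = 2*k" "b = l - k" "c = -l-k" "z1 = 2*u" "z2 = v-u" "z3 = -v-u"
    using s(1) z by (auto simp: k_l_u_v_def field_simps)
  have kl: "6*k^2 + 2*l^2 = 1" using s(2) unfolding e by (simp add: power2_eq_square algebra_simps)
  have k: "k > 0" "k^2 \<ge> 1/24"
    using unit_triple_bounds[OF t] by (auto simp: k_l_u_v_def power_divide)
  have "k * ?F = 3 * ((1 + 24*k^2) * (2*k*l * v - (1 - 6*k^2)*u)^2 + u^2 * (24*k^2 - 1))"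
    unfolding e using kl by algebra
  also have "\<dots> \<ge> 0" using k by auto
  finally show ?thesis using k(1) by (simp add: zero_le_mult_iff)
qed

text \<open>The sign of the \<open>s^2\<close> term in \<open>middle_test_direction\<close>. It
  suffices to treat \<open>R = C\<close>, where the gap factors as
  \<open>2 l (1 + 6 k l (1 - 8 k^2))\<close>; then \<open>k^2 \<le> 1/6\<close> gives
  \<open>1 - 8 k^2 \<ge> -1/3\<close>, and \<open>2 k l \<le> k^2 + l^2 \<le> 1\<close>.\<close>

lemma middle_gap:
  assumes t: "unit_triple a b c" and R: "0 \<le> C" "C \<le> R"
  shows "C * c * (2 - 6*c^2 + 3*(3*a*b*c)*c) \<le> 2 * a * R"
proof -
  define k l where "k = -c/2" "l = (a - b)/2"
  have s: "a + b + c = 0" "a^2 + b^2 + c^2 = 1" "l \<ge> 0" using t by (auto simp: unit_triple_def k_l_def)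
  have e: "a = k+l" "b = k-l" "c = -2*k"
    using s(1) by (auto simp: k_l_def field_simps)
  have kl: "6*k^2 + 2*l^2 = 1" using s(2) unfolding e by (simp add: power2_eq_square algebra_simps)
  have k: "k > 0" using unit_triple_bounds[OF t] by (auto simp: k_l_def)
  have a: "a > 0" using unit_triple_bounds[OF t] by simp
  have "2 * a - c * (2 - 6*c^2 + 3*(3*a*b*c)*c) = 2 * l + 6*k - 48*k^3 + 72*k^3*(k^2-l^2)"
    unfolding e by (simp add: power2_eq_square power3_eq_cube algebra_simps)
  also have "\<dots> = 2 * l + 6 * k * (1 - 6*k^2) * (1 - 8*k^2)"
  proof -
    have kl': "k^2 - l^2 = 4*k^2 - 1/2" using kl by simp
    show ?thesis unfolding kl'
      by (simp add: power2_eq_square power3_eq_cube algebra_simps)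
  qed
  also have "1 - 6*k^2 = 2*l^2" using kl by simp
  also have "2 * l + 6 * k * (2*l^2) * (1 - 8*k^2) = 2 * l * (1 + 6*k*l*(1-8*k^2))"
    by (simp add: power2_eq_square algebra_simps)
  also have "\<dots> \<ge> 0"
  proof -
    have sq: "0 \<le> k^2" "0 \<le> l^2" by simp_all
    have "k^2 \<le> 1/6" using kl sq by linarith
    then have "k*l*(1-8*k^2) \<ge> k*l*(-1/3)" using k s(3) by (intro mult_left_mono) auto
    moreover have "2 * (k*l) \<le> k^2 + l^2" using sum_squares_bound[of k l] by simp
    moreover have "k^2 + l^2 \<le> 1" using kl sq by linarith
    ultimately have "1 + 6*(k*l*(1-8*k^2)) \<ge> 0" by linarith
    then have "1 + 6*k*l*(1-8*k^2) \<ge> 0" by (simp only: mult.assoc)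
    then show ?thesis using s(3) by simp
  qed
  finally have "C * (c * (2 - 6*c^2 + 3*(3*a*b*c)*c)) \<le> C * (2 * a)"
    using R by (intro mult_left_mono) auto
  also have "\<dots> \<le> R * (2 * a)" using R a by (intro mult_right_mono) auto
  finally show ?thesis by (simp add: algebra_simps)
qed

text \<open>Since \<open>a c = b^2 - 1/2\<close>, the cubic invariant depends on the middle
  eigenvalue alone.\<close>

lemma unit_triple_product:
  assumes "unit_triple a b c"
  shows "3*a*b*c = 3*b^3 - 3/2*b"
proof -
  have s: "a + b + c = 0" "a^2 + b^2 + c^2 = 1" using assms by (auto simp: unit_triple_def)
  have "2*(3*a*b*c) = 2*(3*b^3) - 3*b" using s by algebra
  then show ?thesis by simp
qed

text \<open>Both scales \<open>R\<close> and \<open>R'\<close> are free above \<open>C\<close>.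
  Assuming both inequalities fail, a positive combination eliminates \<open>R\<close>, and the rest
  is a one-variable estimate in \<open>T = -b\<close> after bounding \<open>d\<close> by its
  tangent-type majorant in \<open>T' - T\<close>.\<close>

lemma spectral_separation_nonpos:
  assumes t: "unit_triple a b c" "unit_triple a' b' c'" and bb: "b' \<le> b" "b \<le> 0"
    and R: "0 < C" "C \<le> R" "C \<le> R'" and pp: "3*a*b*c < 3*a'*b'*c'"
  shows "C/2 * (3*a'*b'*c' - 3*a*b*c) \<le> R * a - R' * a' \<or> C/2 * (3*a'*b'*c' - 3*a*b*c) \<le> R * b - R' * b'"
proof (rule ccontr)
  define d where "d = 3*a'*b'*c' - 3*a*b*c"
  define T T' s s' where "T = -b" "T' = -b'" "s = a - c" "s' = a' - c'"
  assume "\<not> ?thesis"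
  then have lt: "R * a - R' * a' < C/2*d" "R * b - R' * b' < C/2*d" by (auto simp: d_def)
  have sm: "a + b + c = 0" "a^2 + b^2 + c^2 = 1" "a' + b' + c' = 0" "a'^2 + b'^2 + c'^2 = 1"
    using t by (auto simp: unit_triple_def)
  have a: "2*a = T + s" "2*a' = T' + s'" using sm by (auto simp: T_T'_s_s'_def)
  have TT: "0 \<le> T" "T \<le> T'" using bb by (auto simp: T_T'_s_s'_def)
  have sq: "s^2 = 2 - 3*T^2" "s'^2 = 2 - 3*T'^2"
    unfolding T_T'_s_s'_def using sm by algebra+
  have spos: "s > 0" "s' > 0" using unit_triple_bounds[OF t(1)] unit_triple_bounds[OF t(2)]
    by (auto simp: T_T'_s_s'_def)
  have T6: "T^2 \<le> 1/6" using unit_triple_bounds[OF t(1)] by (auto simp: T_T'_s_s'_def)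
  have ss: "s' \<le> s"
  proof (rule power2_le_imp_le)
    show "s'^2 \<le> s^2" using sq TT by (simp add: power_mono)
  qed (use spos in auto)
  have "d = 3*(T' - T)*(1/2 - (T^2 + T*T' + T'^2))"
    unfolding d_def unit_triple_product[OF t(1)] unit_triple_product[OF t(2)] T_T'_s_s'_def by algebra
  also have "\<dots> \<le> 3*(T' - T)*(1/2 - 3*T^2)"
  proof -
    have "T*T \<le> T*T'" "T*T \<le> T'*T'" using TT by (auto intro: mult_mono)
    then show ?thesis using TT by (intro mult_left_mono) (auto simp: power2_eq_square)
  qed
  finally have d: "d \<le> 3*(T' - T)*(1/2 - 3*T^2)" .
  have "a > 0" using unit_triple_bounds[OF t(1)] by simp
  \<comment> \<open>The weights \<open>a\<close> and \<open>T = -b\<close> are chosen so that the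
    terms with \<open>R\<close> cancel in the sum.\<close>
  have "a * (R * b - R' * b') < a * (C/2*d)" using lt \<open>a > 0\<close> by simp
  moreover have "T * (R * a - R' * a') \<le> T * (C/2*d)" using lt TT by (intro mult_left_mono) auto
  ultimately have "R' * (a * T' - T * a') < (a + T) * (C/2*d)"
    by (simp add: T_T'_s_s'_def algebra_simps)
  moreover have "a * T' - T * a' \<ge> s * (T' - T) / 2"
  proof -
    have "a * T' - T * a' = (s * T' - T * s')/2" using a by algebra
    moreover have "T * s' \<le> T * s" using ss TT by (intro mult_left_mono) auto
    moreover have "s * (T' - T) / 2 = (s * T' - T * s) / 2" by (simp add: algebra_simps)
    ultimately show ?thesis by simp
  qed
  then have "C * (s * (T' - T) / 2) \<le> R' * (a * T' - T * a')"
    using R TT spos by (intro mult_mono) auto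
  ultimately have "C * (s * (T' - T) / 2) < (a + T) * (C/2*d)" by (rule le_less_trans[rotated])
  then have "2 * (C * (s * (T' - T) / 2)) < 2 * ((a + T) * (C/2*d))" by (simp only: mult_less_cancel_left_pos zero_less_numeral)
  also have "2 * (C * (s * (T' - T) / 2)) = C * (s * (T' - T))" by simp
  also have "2 * ((a + T) * (C/2*d)) = (2*a + 2*T) * (C/2*d)" by simp
  also have "\<dots> \<le> (2*a + 2*T) * (C/2* (3*(T' - T)*(1/2 - 3*T^2)))"
    using R TT d \<open>a > 0\<close> by (intro mult_left_mono) auto
  also have "\<dots> = C * (T' - T) * ((3*T + s) * (3/2 * (1/2 - 3*T^2)))" using a(1) by algebra
  also have "\<dots> \<le> C * (T' - T) * s"
  proof (rule mult_left_mono)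
    \<comment> \<open>\<open>s^2 = 2 - 3 T^2\<close> is at least \<open>3/2\<close>, slightly more
      than \<open>(6/5)^2\<close>.\<close>
    have "s \<ge> 6/5"
    proof (rule power2_le_imp_le)
      show "(6/5)^2 \<le> s^2" using sq T6 by (simp add: power2_eq_square)
    qed (use spos in auto)
    then have "T * (6/5) \<le> T * s" using TT by (intro mult_left_mono) auto
    then have "3*T + s \<le> s * (1 + 5/2*T)" by (simp add: algebra_simps)
    then have "(3*T + s) * (3/2 * (1/2 - 3*T^2)) \<le> s * (1 + 5/2*T) * (3/2 * (1/2 - 3*T^2))"
      using T6 by (intro mult_right_mono) auto
    also have "\<dots> = s * ((1 + 5/2*T) * (3/2 * (1/2 - 3*T^2)))" by simp
    also have "\<dots> \<le> s * 1"
    proof (rule mult_left_mono)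
      \<comment> \<open>The quadratic part is completed at its vertex \<open>5/24\<close>, and the
        remaining constant is positive.\<close>
      have "(1 + 5/2*T) * (3/2 * (1/2 - 3*T^2)) = 1 - (9/2*(T - 5/24)^2 + (1/4 - 9/2*(5/24)^2) + 45/4*(T^2*T))"
        by (simp add: power2_eq_square field_simps)
      also have "\<dots> \<le> 1"
      proof -
        have "(T - 5/24)^2 \<ge> 0" "T^2*T \<ge> 0" "9/2*(5/24)^2 \<le> (1/4::real)"
          using TT by (auto simp: power2_eq_square)
        then show ?thesis by linarith
      qed
      finally show "(1 + 5/2*T) * (3/2 * (1/2 - 3*T^2)) \<le> 1" .
    qed (use spos in auto)
    finally show "(3*T + s) * (3/2 * (1/2 - 3*T^2)) \<le> s" by simp
  qed (use R TT in auto)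
  finally show False by (simp add: algebra_simps)
qed

text \<open>The cubic invariant decreases in the middle eigenvalue, so \<open>b' < b\<close>. If
  both middle eigenvalues have one sign, the previous lemma applies, after negation when they are
  nonnegative; if \<open>b' \<le> 0 \<le> b\<close>, the middle eigenvalues already separate,
  because scaling up only increases \<open>R * b - R' * b'\<close>.\<close>

lemma spectral_separation:
  assumes t: "unit_triple a b c" "unit_triple a' b' c'"
    and R: "0 < C" "C \<le> R" "C \<le> R'" and pp: "3*a*b*c < 3*a'*b'*c'"
  shows "C/2 * (3*a'*b'*c' - 3*a*b*c) \<le> R * a - R' * a' \<or> C/2 * (3*a'*b'*c' - 3*a*b*c) \<le> R * b - R' * b'
     \<or> C/2 * (3*a'*b'*c' - 3*a*b*c) \<le> R * c - R' * c'"
proof -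
  have b6: "b^2 \<le> 1/6" "b'^2 \<le> 1/6" using unit_triple_bounds[OF t(1)] unit_triple_bounds[OF t(2)] by auto
  have d: "3*a'*b'*c' - 3*a*b*c = 3*(b - b')*(1/2 - (b^2 + b*b' + b'^2))"
    unfolding unit_triple_product[OF t(1)] unit_triple_product[OF t(2)] by algebra
  have bq: "2 * (b*b') \<le> b^2 + b'^2" using sum_squares_bound[of b b'] by simp
  have bb: "b' < b"
  proof (rule ccontr)
    assume "\<not> b' < b"
    have "b^2 + b*b' + b'^2 \<le> 1/2" using bq b6 by linarith
    then have "0 \<le> 1/2 - (b^2 + b*b' + b'^2)" by simp
    moreover have "3*(b - b') \<le> 0" using \<open>\<not> b' < b\<close> by simp
    ultimately have "3*(b - b')*(1/2 - (b^2 + b*b' + b'^2)) \<le> 0"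
      by (rule mult_nonpos_nonneg[rotated])
    with pp d show False by simp
  qed
  consider "b \<le> 0" | "b' \<ge> 0" | "b \<ge> 0" "b' \<le> 0" by linarith
  then show ?thesis
  proof cases
    case 1
    then show ?thesis using spectral_separation_nonpos[OF t less_imp_le[OF bb] _ R pp] by blast
  next
    case 2
    have "C/2 * (3*(-c)*(-b)*(-a) - 3*(-c')*(-b')*(-a')) \<le> R' * (-c') - R * (-c) \<or>
       C/2 * (3*(-c)*(-b)*(-a) - 3*(-c')*(-b')*(-a')) \<le> R' * (-b') - R * (-b)"
      using 2 R pp bb
      by (intro spectral_separation_nonpos[OF unit_triple_uminus[OF t(2)] unit_triple_uminus[OF t(1)]])
        (auto simp: mult_ac)
    then show ?thesis by (auto simp: algebra_simps)
  next
    case 3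
    have "b^2 + b*b' + b'^2 \<ge> 0"
    proof -
      have "b^2 + b*b' + b'^2 = (b + b'/2)^2 + 3/4*b'^2" by (simp add: power2_eq_square field_simps)
      then show ?thesis by simp
    qed
    then have "3*(b - b')*(1/2 - (b^2 + b*b' + b'^2)) \<le> 3*(b-b')*(1/2)"
      using bb by (intro mult_left_mono) auto
    then have "C/2 * (3*a'*b'*c' - 3*a*b*c) \<le> C/2 * (3*(b-b')*(1/2))"
      using R d by (intro mult_left_mono) auto
    also have "\<dots> \<le> C * (b - b')" using R bb by (simp add: field_simps)
    also have "\<dots> = C * b + C * (-b')" by (simp add: algebra_simps)
    also have "\<dots> \<le> R * b + R' * (-b')" using 3 R by (intro add_mono mult_right_mono) auto
    finally show ?thesis by simp
  qed
qed

subsection \<open>The Hessian of the singular cubic cone\<close>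

definition sym_traceless :: "real^3^3 \<Rightarrow> bool" where
  "sym_traceless A \<longleftrightarrow> transpose A = A \<and> trace A = 0"

text \<open>On a unit vector \<open>X\<close> this is the Hessian of \<open>trace X\<^sup>3 / \<bar>X\<bar>\<close> evaluated at \<open>(Z, Z)\<close>.\<close>

definition cone_hessian :: "real^3^3 \<Rightarrow> real^3^3 \<Rightarrow> real" where
  "cone_hessian X Z = 6 * trace (X ** Z ** Z) - 6 * trace (X ** Z) * trace (X ** X ** Z)
     - trace (X ** X ** X) * trace (Z ** Z) + 3 * trace (X ** X ** X) * (trace (X ** Z))^2"

section \<open>Invariance under orthogonal conjugation\<close>

lemma trace_conj_orthogonal:
  fixes A :: "real^'n^'n"
  assumes "orthogonal_matrix Q"
  shows "trace (Q ** A ** transpose Q) = trace A"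
proof -
  have "trace (Q ** A ** transpose Q) = trace (transpose Q ** (Q ** A))" by (rule trace_mul_sym)
  also have "transpose Q ** (Q ** A) = A"
    using assms by (simp add: matrix_mul_assoc orthogonal_matrix)
  finally show ?thesis .
qed

lemma conj_orthogonal_mult:
  fixes A B :: "real^'n^'n"
  assumes "orthogonal_matrix Q"
  shows "(Q ** A ** transpose Q) ** (Q ** B ** transpose Q) = Q ** (A ** B) ** transpose Q"
proof -
  have "(Q ** A ** transpose Q) ** (Q ** B ** transpose Q) = Q ** A ** (transpose Q ** Q) ** B ** transpose Q"
    by (simp only: matrix_mul_assoc)
  also have "transpose Q ** Q = mat 1" using assms by (simp add: orthogonal_matrix)
  finally show ?thesis by (simp add: matrix_mul_assoc)
qed

lemma conj_orthogonal_eq: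
  fixes A :: "real^'n^'n"
  assumes "orthogonal_matrix Q"
  shows "Q ** (transpose Q ** A ** Q) ** transpose Q = A"
proof -
  have "Q ** (transpose Q ** A ** Q) ** transpose Q = (Q ** transpose Q) ** A ** (Q ** transpose Q)"
    by (simp only: matrix_mul_assoc)
  then show ?thesis using assms by (simp add: orthogonal_matrix_def)
qed

lemma sym_traceless_conj:
  assumes "orthogonal_matrix Q" "sym_traceless A"
  shows "sym_traceless (Q ** A ** transpose Q)"
  using assms by (simp add: sym_traceless_def trace_conj_orthogonal matrix_transpose_mul matrix_mul_assoc)

lemma sym_traceless_conj':
  assumes "orthogonal_matrix Q" "sym_traceless A"
  shows "sym_traceless (transpose Q ** A ** Q)"
  using sym_traceless_conj[of "transpose Q" A] assms by (simp add: orthogonal_matrix_transpose)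

lemma cone_hessian_conj:
  assumes "orthogonal_matrix Q"
  shows "cone_hessian (Q ** X ** transpose Q) (Q ** Z ** transpose Q) = cone_hessian X Z"
  using assms by (simp add: cone_hessian_def conj_orthogonal_mult trace_conj_orthogonal)

lemma matrix_mult_uminus_left: "(- A) ** B = - (A ** B)" for A :: "real^'n^'m" and B :: "real^'k^'n"
  by (simp add: matrix_matrix_mult_def vec_eq_iff sum_negf)

lemma matrix_mult_uminus_right: "A ** (- B) = - (A ** B)" for A :: "real^'n^'m" and B :: "real^'k^'n"
  by (simp add: matrix_matrix_mult_def vec_eq_iff sum_negf)

lemma trace_uminus: "trace (- A) = - trace (A :: real^'n^'n)"
  by (simp add: trace_def sum_negf)

lemma cone_hessian_uminus: "cone_hessian (- X) Z = - cone_hessian X Z"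
  by (simp add: cone_hessian_def matrix_mult_uminus_left matrix_mult_uminus_right trace_uminus)

lemma trace_diag3_mult:
  "trace (diag3 a b c ** Z) = a * Z$1$1 + b * Z$2$2 + c * Z$3$3"
  by (simp add: trace_def diag3_def matrix_matrix_mult_def sum_3 vector_3)

lemma diag3_mult: "diag3 a b c ** diag3 a' b' c' = diag3 (a*a') (b*b') (c*c')"
  by (simp add: vec_eq_iff forall_3 diag3_def matrix_matrix_mult_def sum_3 vector_3)

lemma trace_diag3: "trace (diag3 a b c) = a + b + c"
  by (simp add: trace_def diag3_def sum_3 vector_3)

lemma sym_traceless_entries:
  assumes "sym_traceless Z"
  shows "Z$2$1 = Z$1$2" "Z$3$1 = Z$1$3" "Z$3$2 = Z$2$3" "Z$1$1 + Z$2$2 + Z$3$3 = 0"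
proof -
  have "transpose Z $ i $ j = Z $ i $ j" for i j using assms by (simp add: sym_traceless_def)
  then show "Z$2$1 = Z$1$2" "Z$3$1 = Z$1$3" "Z$3$2 = Z$2$3" by (simp_all add: transpose_def)
  show "Z$1$1 + Z$2$2 + Z$3$3 = 0" using assms by (simp add: sym_traceless_def trace_def sum_3)
qed

lemma square_diagonal_entries:
  fixes Z :: "real^3^3"
  assumes "sym_traceless Z"
  shows "(Z ** Z)$1$1 = (Z$1$1)^2 + (Z$1$2)^2 + (Z$1$3)^2"
    "(Z ** Z)$2$2 = (Z$1$2)^2 + (Z$2$2)^2 + (Z$2$3)^2"
    "(Z ** Z)$3$3 = (Z$1$3)^2 + (Z$2$3)^2 + (Z$3$3)^2"
  by (simp_all add: matrix_matrix_mult_def sum_3 sym_traceless_entries[OF assms] power2_eq_square)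

lemma trace_square:
  fixes Z :: "real^3^3"
  assumes "sym_traceless Z"
  shows "trace (Z ** Z) = (Z$1$1)^2 + (Z$2$2)^2 + (Z$3$3)^2 + 2*(Z$1$2)^2 + 2*(Z$1$3)^2 + 2*(Z$2$3)^2"
  using square_diagonal_entries[OF assms] by (simp add: trace_def sum_3)

section \<open>Extreme values of the cone Hessian\<close>

lemma cone_hessian_diag3:
  assumes Z: "sym_traceless Z" and t: "unit_triple a b c"
  shows "cone_hessian (diag3 a b c) Z =
     6 * (a * ((Z$1$1)^2 + (Z$1$2)^2 + (Z$1$3)^2) + b * ((Z$1$2)^2 + (Z$2$2)^2 + (Z$2$3)^2)
        + c * ((Z$1$3)^2 + (Z$2$3)^2 + (Z$3$3)^2))
     - 6 * (a * Z$1$1 + b * Z$2$2 + c * Z$3$3) * (a^2 * Z$1$1 + b^2 * Z$2$2 + c^2 * Z$3$3)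
     - 3*a*b*c * trace (Z ** Z) + 3 * (3*a*b*c) * (a * Z$1$1 + b * Z$2$2 + c * Z$3$3)^2"
proof -
  have "a + b + c = 0" using t by (simp add: unit_triple_def)
  then have p: "a*a*a + b*b*b + c*c*c = 3*a*b*c" by algebra
  show ?thesis
    unfolding cone_hessian_def matrix_mul_assoc[symmetric, of _ Z Z]
    by (simp add: trace_diag3_mult diag3_mult trace_diag3 square_diagonal_entries[OF Z] p power2_eq_square)
qed

text \<open>Diagonal and off-diagonal entries decouple. The off-diagonal coefficients are
  \<open>2a + b\<close>, \<open>2a + c\<close> and \<open>a + b + c = 0\<close>; the vanishing one
  shows that the bound is attained on the entry (2,3).\<close>

lemma cone_hessian_diag3_lower:
  assumes Z: "sym_traceless Z" and t: "unit_triple a b c"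
  shows "(-3*a - 3*a*b*c) * trace (Z ** Z) \<le> cone_hessian (diag3 a b c) Z"
proof -
  note z = sym_traceless_entries(4)[OF Z]
  have o: "a \<ge> b" "b \<ge> c" "a + b + c = 0" using t by (auto simp: unit_triple_def)
  have "cone_hessian (diag3 a b c) Z - (-3*a - 3*a*b*c) * trace (Z ** Z)
    = ((6*a + 3*a) * (Z$1$1)^2 + (6*b + 3*a) * (Z$2$2)^2 + (6*c + 3*a) * (Z$3$3)^2
     - 6 * (a*Z$1$1 + b*Z$2$2 + c*Z$3$3) * (a^2*Z$1$1 + b^2*Z$2$2 + c^2*Z$3$3)
     + 3 * (3*a*b*c) * (a*Z$1$1 + b*Z$2$2 + c*Z$3$3)^2)
     + 6 * ((2*a+b) * (Z$1$2)^2 + (2*a+c) * (Z$1$3)^2 + (a+b+c) * (Z$2$3)^2)"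
    unfolding cone_hessian_diag3[OF Z t] trace_square[OF Z] by (simp add: algebra_simps)
  also have "\<dots> \<ge> 0"
  proof (rule add_nonneg_nonneg[OF diagonal_block_nonneg[OF t z]])
    have "0 \<le> 2*a+b" "0 \<le> 2*a+c" "0 \<le> a+b+c" using o by auto
    then have "0 \<le> (2*a+b) * (Z$1$2)^2" "0 \<le> (2*a+c) * (Z$1$3)^2" "0 \<le> (a+b+c) * (Z$2$3)^2"
      by simp_all
    then show "0 \<le> 6 * ((2*a+b) * (Z$1$2)^2 + (2*a+c) * (Z$1$3)^2 + (a+b+c) * (Z$2$3)^2)"
      by - (rule mult_nonneg_nonneg[OF zero_le_numeral add_nonneg_nonneg[OF add_nonneg_nonneg]])
  qed
  finally show ?thesis by simp
qed

text \<open>The lower bound for the negated triple, with the indices 1 and 3 exchanged.\<close>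

lemma cone_hessian_diag3_upper:
  assumes Z: "sym_traceless Z" and t: "unit_triple a b c"
  shows "cone_hessian (diag3 a b c) Z \<le> (-3*c - 3*a*b*c) * trace (Z ** Z)"
proof -
  have z: "Z$3$3 + Z$2$2 + Z$1$1 = 0" using sym_traceless_entries(4)[OF Z] by simp
  have o: "a \<ge> b" "b \<ge> c" "a + b + c = 0" using t by (auto simp: unit_triple_def)
  have "(-3*c - 3*a*b*c) * trace (Z ** Z) - cone_hessian (diag3 a b c) Z
    = ((6*(-c) + 3*(-c)) * (Z$3$3)^2 + (6*(-b) + 3*(-c)) * (Z$2$2)^2 + (6*(-a) + 3*(-c)) * (Z$1$1)^2
     - 6 * ((-c)*Z$3$3 + (-b)*Z$2$2 + (-a)*Z$1$1) * ((-c)^2*Z$3$3 + (-b)^2*Z$2$2 + (-a)^2*Z$1$1)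
     + 3 * (3*(-c)*(-b)*(-a)) * ((-c)*Z$3$3 + (-b)*Z$2$2 + (-a)*Z$1$1)^2)
     + 6 * ((-2*c-b) * (Z$2$3)^2 + (-2*c-a) * (Z$1$3)^2 + (-a-b-c) * (Z$1$2)^2)"
    unfolding cone_hessian_diag3[OF Z t] trace_square[OF Z] by (simp add: algebra_simps power2_eq_square)
  also have "\<dots> \<ge> 0"
  proof (rule add_nonneg_nonneg[OF diagonal_block_nonneg[OF unit_triple_uminus[OF t] z]])
    have "0 \<le> -2*c-b" "0 \<le> -2*c-a" "0 \<le> -a-b-c" using o by auto
    then have "0 \<le> (-2*c-b) * (Z$2$3)^2" "0 \<le> (-2*c-a) * (Z$1$3)^2" "0 \<le> (-a-b-c) * (Z$1$2)^2"
      by (auto intro: mult_nonneg_nonneg)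
    then show "0 \<le> 6 * ((-2*c-b) * (Z$2$3)^2 + (-2*c-a) * (Z$1$3)^2 + (-a-b-c) * (Z$1$2)^2)"
      by - (rule mult_nonneg_nonneg[OF zero_le_numeral add_nonneg_nonneg[OF add_nonneg_nonneg]])
  qed
  finally show ?thesis by simp
qed

lemma unit_diagonalization:
  assumes X: "sym_traceless X" and u: "trace (X ** X) = 1"
  obtains Q a b c where "orthogonal_matrix Q" "X = Q ** diag3 a b c ** transpose Q" "unit_triple a b c"
    "trace (X ** X ** X) = 3*a*b*c"
proof -
  obtain Q a b c where Q: "orthogonal_matrix Q" "X = Q ** diag3 a b c ** transpose Q" "a \<ge> b" "b \<ge> c"
    using symmetric_matrix_3_diagonalizable[of X] X unfolding sym_traceless_def by blast
  have s: "a + b + c = 0"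
    using X Q by (simp add: sym_traceless_def trace_conj_orthogonal trace_diag3)
  moreover have "a^2 + b^2 + c^2 = 1"
    using u Q(1) by (simp add: Q(2) conj_orthogonal_mult trace_conj_orthogonal diag3_mult trace_diag3 power2_eq_square)
  ultimately have t: "unit_triple a b c" using Q by (simp add: unit_triple_def)
  have "trace (X ** X ** X) = a*a*a + b*b*b + c*c*c"
    using Q(1) by (simp add: Q(2) conj_orthogonal_mult trace_conj_orthogonal diag3_mult trace_diag3)
  also have "\<dots> = 3*a*b*c" using s by algebra
  finally show ?thesis using that Q t by blast
qed

lemma cone_hessian_bounds:
  assumes Q: "orthogonal_matrix Q" "X = Q ** diag3 a b c ** transpose Q" and t: "unit_triple a b c"
    and Z: "sym_traceless Z"
  shows "(-3*a - 3*a*b*c) * trace (Z ** Z) \<le> cone_hessian X Z"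
    "cone_hessian X Z \<le> (-3*c - 3*a*b*c) * trace (Z ** Z)"
proof -
  define Y where "Y = transpose Q ** Z ** Q"
  have Y: "sym_traceless Y" unfolding Y_def by (rule sym_traceless_conj'[OF Q(1) Z])
  have ZY: "Z = Q ** Y ** transpose Q" unfolding Y_def by (rule conj_orthogonal_eq[OF Q(1), symmetric])
  have "trace (Z ** Z) = trace (Y ** Y)"
    unfolding ZY by (simp add: conj_orthogonal_mult[OF Q(1)] trace_conj_orthogonal[OF Q(1)])
  moreover have "cone_hessian X Z = cone_hessian (diag3 a b c) Y"
    unfolding ZY Q(2) by (rule cone_hessian_conj[OF Q(1)])
  ultimately show "(-3*a - 3*a*b*c) * trace (Z ** Z) \<le> cone_hessian X Z"
    "cone_hessian X Z \<le> (-3*c - 3*a*b*c) * trace (Z ** Z)"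
    using cone_hessian_diag3_lower[OF Y t] cone_hessian_diag3_upper[OF Y t] by auto
qed

section \<open>Test directions separating two spectra\<close>

lemma orthogonal_matrix_column_norm:
  fixes Q :: "real^3^3"
  assumes "orthogonal_matrix Q"
  shows "(Q$1$j)^2 + (Q$2$j)^2 + (Q$3$j)^2 = 1"
proof -
  have "(transpose Q ** Q) $ j $ j = 1" using assms by (simp add: orthogonal_matrix mat_def)
  then show ?thesis by (simp add: matrix_matrix_mult_def transpose_def sum_3 power2_eq_square)
qed

text \<open>The matrix on which the lower bound for the cone Hessian is attained. Its square is the
  projection onto the last two coordinates.\<close>

definition offdiag23 :: "real^3^3" where
  "offdiag23 = vector [vector [0,0,0], vector [0,0,1], vector [0,1,0]]"

lemma offdiag23: "sym_traceless offdiag23" "trace (offdiag23 ** offdiag23) = 2"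
  "trace (A ** offdiag23 ** offdiag23) = A$2$2 + A$3$3"
  by (simp_all add: sym_traceless_def offdiag23_def transpose_def vec_eq_iff forall_3 trace_def
      matrix_matrix_mult_def sum_3 vector_3)

text \<open>The rotated \<open>offdiag23\<close> satisfies \<open>Z ** Z = 1 - f f^T\<close> with
  \<open>f\<close> the top eigenvector of \<open>X\<close>. Hence for traceless \<open>W\<close> the
  trace of \<open>W ** Z ** Z\<close> is minus the value of the form \<open>W\<close> at
  \<open>f\<close>, which is at least the bottom eigenvalue \<open>c'\<close>.\<close>

lemma extreme_test_direction:
  assumes Q: "orthogonal_matrix Q" "X = Q ** diag3 a b c ** transpose Q" and t: "unit_triple a b c"
  obtains Z where "sym_traceless Z" "trace (Z ** Z) = 2"
    "trace (X ** Z ** Z) = - a" "cone_hessian X Z = (-3*a - 3*a*b*c) * 2"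
    "\<And>W Q' a' b' c'. orthogonal_matrix Q' \<Longrightarrow> W = Q' ** diag3 a' b' c' ** transpose Q' \<Longrightarrow>
        unit_triple a' b' c' \<Longrightarrow> sym_traceless W \<Longrightarrow> trace (W ** Z ** Z) \<le> - c'"
proof
  define Z where "Z = Q ** offdiag23 ** transpose Q"
  show "sym_traceless Z" unfolding Z_def by (rule sym_traceless_conj[OF Q(1) offdiag23(1)])
  show "trace (Z ** Z) = 2"
    using Q(1) by (simp add: Z_def conj_orthogonal_mult trace_conj_orthogonal offdiag23)
  have s: "a + b + c = 0" using t by (simp add: unit_triple_def)
  have d: "diag3 a b c $ 2 $ 2 = b" "diag3 a b c $ 3 $ 3 = c" by (simp_all add: diag3_def vector_3)
  show "trace (X ** Z ** Z) = - a"
    using Q(1) s d by (simp add: Q(2) Z_def conj_orthogonal_mult trace_conj_orthogonal offdiag23)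
  have e: "offdiag23$1$1 = 0" "offdiag23$2$2 = 0" "offdiag23$3$3 = 0" "offdiag23$1$2 = 0" "offdiag23$1$3 = 0"
    "offdiag23$2$3 = 1" by (simp_all add: offdiag23_def vector_3)
  have "6 * (b + c) = - 6 * a" using s by simp
  then show "cone_hessian X Z = (-3*a - 3*a*b*c) * 2"
    unfolding Q(2) Z_def cone_hessian_conj[OF Q(1)] cone_hessian_diag3[OF offdiag23(1) t] e
    by (simp add: offdiag23(2))
  fix W Q' a' b' c'
  assume Q': "orthogonal_matrix Q'" "W = Q' ** diag3 a' b' c' ** transpose Q'"
     and t': "unit_triple a' b' c'" and W: "sym_traceless W"
  define V where "V = transpose Q ** W ** Q"
  have V: "sym_traceless V" unfolding V_def by (rule sym_traceless_conj'[OF Q(1) W])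
  have WV: "W = Q ** V ** transpose Q" unfolding V_def by (rule conj_orthogonal_eq[OF Q(1), symmetric])
  have "trace (W ** Z ** Z) = V$2$2 + V$3$3"
    unfolding WV Z_def by (simp add: conj_orthogonal_mult[OF Q(1)] trace_conj_orthogonal[OF Q(1)] offdiag23)
  also have "\<dots> = - V$1$1" using sym_traceless_entries(4)[OF V] by simp
  finally have tr: "trace (W ** Z ** Z) = - V$1$1" .
  define O' where "O' = transpose Q' ** Q"
  have O': "orthogonal_matrix O'" unfolding O'_def
    using Q(1) Q'(1) by (simp add: orthogonal_matrix_mul orthogonal_matrix_transpose)
  have "V = transpose O' ** diag3 a' b' c' ** O'"
    by (simp add: V_def Q'(2) O'_def matrix_transpose_mul matrix_mul_assoc)
  then have "V$1$1 = a' * (O'$1$1)^2 + b' * (O'$2$1)^2 + c' * (O'$3$1)^2"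
    by (simp add: matrix_matrix_mult_def transpose_def sum_3 diag3_def vector_3 power2_eq_square)
  also have "\<dots> \<ge> c' * (O'$1$1)^2 + c' * (O'$2$1)^2 + c' * (O'$3$1)^2"
    using t' by (intro add_mono mult_right_mono) (auto simp: unit_triple_def)
  also have "c' * (O'$1$1)^2 + c' * (O'$2$1)^2 + c' * (O'$3$1)^2 = c'"
    using orthogonal_matrix_column_norm[OF O', of 1] by (metis distrib_left mult.right_neutral)
  finally show "trace (W ** Z ** Z) \<le> - c'" using tr by simp
qed


text \<open>Traceless part of \<open>f g^T + g f^T\<close>.\<close>

definition sym_outer :: "real^3 \<Rightarrow> real^3 \<Rightarrow> real^3^3" where
  "sym_outer f g = (\<chi> i j. f$i * g$j + g$i * f$j - (if i = j then 2/3 * (f \<bullet> g) else 0))"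

lemma sym_traceless_sym_outer: "sym_traceless (sym_outer f g)"
  by (simp add: sym_traceless_def sym_outer_def transpose_def vec_eq_iff trace_def sum_3 inner_vec_def algebra_simps)

lemma sym_outer_commute: "sym_outer f g = sym_outer g f"
  by (simp add: sym_outer_def inner_commute vec_eq_iff algebra_simps)

lemma sym_outer_mult_vec: "sym_outer f g *v x = (g \<bullet> x) *\<^sub>R f + (f \<bullet> x) *\<^sub>R g - (2/3 * (f \<bullet> g)) *\<^sub>R x"
  by (simp add: sym_outer_def matrix_vector_mult_def vec_eq_iff forall_3 sum_3 inner_vec_def algebra_simps)

lemma sym_outer_conj:
  assumes "orthogonal_matrix Q"
  shows "transpose Q ** sym_outer f g ** Q = sym_outer (transpose Q *v f) (transpose Q *v g)"
proof -
  have a: "u \<bullet> (Q *v x) = (transpose Q *v u) \<bullet> x" for u x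
    by (metis dot_lmul_matrix transpose_matrix_vector)
  have b: "transpose Q *v (Q *v x) = x" for x
    using assms by (simp add: matrix_vector_mul_assoc orthogonal_matrix)
  have c: "(transpose Q *v f) \<bullet> (transpose Q *v g) = f \<bullet> g"
    using assms by (metis a matrix_vector_mul_assoc matrix_vector_mul_lid orthogonal_matrix_def)
  show ?thesis
    unfolding matrix_eq
    by (simp add: matrix_vector_mul_assoc[symmetric] sym_outer_mult_vec matrix_vector_right_distrib
        matrix_vector_mult_diff_distrib matrix_vector_mult_scaleR a b c del: transpose_matrix_vector)
qed

lemma norm_orthogonal_matrix_mult_vec:
  fixes Q :: "real^'n^'n"
  assumes "orthogonal_matrix Q"
  shows "norm (Q *v x) = norm x"
  using assms orthogonal_transformation_matrix orthogonal_transformation_norm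
  by (metis matrix_of_matrix_vector_mul matrix_vector_mul_linear)

text \<open>A direction adapted to two matrices at once: \<open>f\<close> is the bottom eigenvector
  of \<open>X\<close>, while \<open>g\<close> is an arbitrary unit vector, later the bottom
  eigenvector of the other matrix, and \<open>sym_outer\<close> is symmetric in both. The defect in
  the inequality is a multiple of \<open>(a - b) (w $ 2)^2\<close> plus \<open>s^2\<close> times the
  quantity of \<open>middle_gap\<close>.\<close>

lemma middle_test_direction:
  assumes Q: "orthogonal_matrix Q" "X = Q ** diag3 a b c ** transpose Q" and t: "unit_triple a b c"
    and g: "norm g = 1" and f: "f = Q *v axis 3 1" and r: "0 \<le> C" "0 \<le> r"
  shows "6 * r * trace (X ** sym_outer f g ** sym_outer f g) + C * cone_hessian X (sym_outer f g)
     \<le> (-3*b*(r + C) - C*(3*a*b*c)) * trace (sym_outer f g ** sym_outer f g)" (is ?le)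
   "2 \<le> trace (sym_outer f g ** sym_outer f g)"
proof -
  define w where "w = transpose Q *v g"
  define Y where "Y = sym_outer (axis 3 1) w"
  have "transpose Q *v f = axis 3 1"
    unfolding f using Q(1) by (simp add: matrix_vector_mul_assoc orthogonal_matrix)
  then have "transpose Q ** sym_outer f g ** Q = Y"
    by (simp add: sym_outer_conj[OF Q(1)] Y_def w_def)
  then have ZY: "sym_outer f g = Q ** Y ** transpose Q"
    using conj_orthogonal_eq[OF Q(1)] by metis
  have "norm w = 1" unfolding w_def
    using norm_orthogonal_matrix_mult_vec[of "transpose Q" g] g Q(1)
    by (simp add: orthogonal_matrix_transpose del: transpose_matrix_vector)
  then have w: "(w$1)^2 + (w$2)^2 + (w$3)^2 = 1"
    by (simp add: norm_eq_1 inner_vec_def sum_3 power2_eq_square)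
  have Y: "sym_traceless Y" unfolding Y_def by (rule sym_traceless_sym_outer)
  have e: "Y$1$1 = -2/3 * w$3" "Y$2$2 = -2/3 * w$3" "Y$3$3 = 4/3 * w$3" "Y$1$2 = 0" "Y$1$3 = w$1" "Y$2$3 = w$2"
    by (simp_all add: Y_def sym_outer_def axis_def inner_vec_def sum_3)
  define s where "s = w$3"
  have tYY: "trace (Y ** Y) = 2 + 2/3 * s^2"
    unfolding trace_square[OF Y] e s_def using w by (simp add: power2_eq_square algebra_simps)
  have tr: "trace (sym_outer f g ** sym_outer f g) = trace (Y ** Y)"
    unfolding ZY by (simp add: conj_orthogonal_mult[OF Q(1)] trace_conj_orthogonal[OF Q(1)])
  then show "2 \<le> trace (sym_outer f g ** sym_outer f g)" using tYY by simp
  have sm: "a + b + c = 0" "a^2 + b^2 + c^2 = 1" "b \<le> a" using t by (auto simp: unit_triple_def)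
  define T where "T = a * ((Y$1$1)^2 + (Y$1$2)^2 + (Y$1$3)^2) + b * ((Y$1$2)^2 + (Y$2$2)^2 + (Y$2$3)^2)
        + c * ((Y$1$3)^2 + (Y$2$3)^2 + (Y$3$3)^2)"
  have T: "T = 4/3*c* s^2 - b*(1 - s^2) - (a-b)*(w$2)^2"
  proof -
    have w1: "(w$1)^2 = 1 - s^2 - (w$2)^2" using w by (simp add: s_def)
    have c: "c = -a-b" using sm(1) by simp
    show ?thesis unfolding T_def e s_def[symmetric] power_mult_distrib w1 c
      by (simp add: power2_eq_square field_simps)
  qed
  have l1: "a * Y$1$1 + b * Y$2$2 + c * Y$3$3 = 2*c* s"
  proof -
    have "a * Y$1$1 + b * Y$2$2 + c * Y$3$3 = -2/3*(a+b+c)* s + 2*c* s"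
      unfolding e s_def[symmetric] by (simp add: field_simps)
    then show ?thesis unfolding sm(1) by simp
  qed
  have l2: "a^2 * Y$1$1 + b^2 * Y$2$2 + c^2 * Y$3$3 = 2* s*(c^2 - 1/3)"
  proof -
    have "a^2 * Y$1$1 + b^2 * Y$2$2 + c^2 * Y$3$3 = -2/3*(a^2+b^2+c^2)* s + 2*c^2* s"
      unfolding e s_def[symmetric] by (simp add: field_simps)
    then show ?thesis unfolding sm(2) by (simp add: field_simps)
  qed
  have trX: "trace (X ** sym_outer f g ** sym_outer f g) = T"
  proof -
    have "trace (X ** sym_outer f g ** sym_outer f g) = trace (diag3 a b c ** (Y ** Y))"
      unfolding ZY Q(2) conj_orthogonal_mult[OF Q(1)] trace_conj_orthogonal[OF Q(1)]
      by (simp add: matrix_mul_assoc)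
    then show ?thesis by (simp add: trace_diag3_mult square_diagonal_entries[OF Y] T_def)
  qed
  have CH: "cone_hessian X (sym_outer f g)
     = 6 * T - 6 * (2*c* s) * (2* s*(c^2 - 1/3)) - 3*a*b*c*(2 + 2/3* s^2) + 3*(3*a*b*c)*(2*c* s)^2"
    unfolding ZY Q(2) cone_hessian_conj[OF Q(1)] cone_hessian_diag3[OF Y t] T_def[symmetric] l1 l2 tYY ..
  have b: "b = - a - c" using sm(1) by simp
  have "(-3*b*(r + C) - C*(3*a*b*c)) * (2 + 2/3* s^2)
      - (6 * r * T + C * (6 * T - 6 * (2*c* s) * (2* s*(c^2 - 1/3)) - 3*a*b*c*(2 + 2/3* s^2) + 3*(3*a*b*c)*(2*c* s)^2))
    = 6*(r+C)*((a-b)*(w$2)^2) + 4* s^2*(2*a*(r+C) - C*c*(2 - 6*c^2 + 3*(3*a*b*c)*c)) + 8*(r+C)* s^2*(-(a+b+c))"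
    unfolding T by (simp add: power2_eq_square algebra_simps)
  also have "8*(r+C)* s^2*(-(a+b+c)) = 0" using sm(1) by simp
  also have "6*(r+C)*((a-b)*(w$2)^2) + 4* s^2*(2*a*(r+C) - C*c*(2 - 6*c^2 + 3*(3*a*b*c)*c)) + 0 \<ge> 0"
  proof -
    have "0 \<le> 2*a*(r+C) - C*c*(2 - 6*c^2 + 3*(3*a*b*c)*c)"
      using middle_gap[OF t, of C "r+C"] r by simp
    then have "0 \<le> 4* s^2*(2*a*(r+C) - C*c*(2 - 6*c^2 + 3*(3*a*b*c)*c))" by (intro mult_nonneg_nonneg) auto
    moreover have "0 \<le> 6*(r+C)*((a-b)*(w$2)^2)" using r sm(3) by (intro mult_nonneg_nonneg) auto
    ultimately show ?thesis by simp
  qed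
  finally show ?le unfolding trX CH tr tYY by simp
qed

text \<open>To be applied with \<open>W\<close> the direction of \<open>-y\<close>: by oddness the
  sum of the two Hessians is then the difference of the Hessians at \<open>x\<close> and
  \<open>y\<close>, and the hypothesis says that the cubic is smaller at \<open>x\<close>.\<close>

lemma cone_pair_test_direction:
  assumes X: "sym_traceless X" "trace (X ** X) = 1" and W: "sym_traceless W" "trace (W ** W) = 1"
    and r: "0 < C" "0 \<le> r" "0 \<le> r'" and neg: "trace (X ** X ** X) + trace (W ** W ** W) < 0"
  obtains Z where "sym_traceless Z" "trace (Z ** Z) > 0"
    "6 * r * trace (X ** Z ** Z) + C * cone_hessian X Z + 6 * r' * trace (W ** Z ** Z) + C * cone_hessian W Z
      \<le> C/2 * (trace (X ** X ** X) + trace (W ** W ** W)) * trace (Z ** Z)"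
proof -
  obtain Q a b c where Q: "orthogonal_matrix Q" "X = Q ** diag3 a b c ** transpose Q" "unit_triple a b c"
    "trace (X ** X ** X) = 3*a*b*c" using unit_diagonalization[OF X] .
  obtain Q' a' b' c' where Q': "orthogonal_matrix Q'" "W = Q' ** diag3 a' b' c' ** transpose Q'" "unit_triple a' b' c'"
    "trace (W ** W ** W) = 3*a'*b'*c'" using unit_diagonalization[OF W] .
  define e where "e = 3*a*b*c + 3*a'*b'*c'"
  \<comment> \<open>Separation of \<open>X\<close> from \<open>-W\<close>. The scales are
    \<open>r + C\<close> and \<open>r' + C\<close> because in the test directions the cubic and the
    cone contribute multiples of the same eigenvalue, with weights \<open>r\<close> and
    \<open>C\<close>. Each alternative selects one direction: top of \<open>X\<close>, the middle
    one, top of \<open>W\<close>.\<close>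
  have "C/2 * (3*(-c')*(-b')*(-a') - 3*a*b*c) \<le> (r+C) * a - (r'+C) * (-c') \<or>
    C/2 * (3*(-c')*(-b')*(-a') - 3*a*b*c) \<le> (r+C) * b - (r'+C) * (-b') \<or>
    C/2 * (3*(-c')*(-b')*(-a') - 3*a*b*c) \<le> (r+C) * c - (r'+C) * (-a')"
    using neg r unfolding Q(4) Q'(4)
    by (intro spectral_separation Q(3) unit_triple_uminus[OF Q'(3)]) (auto simp: mult_ac)
  then consider "- (C/2*e) \<le> (r+C) * a + (r'+C) * c'" | "- (C/2*e) \<le> (r+C) * b + (r'+C) * b'"
    | "- (C/2*e) \<le> (r'+C) * a' + (r+C) * c"
    by (auto simp: e_def algebra_simps)
  then show ?thesis
  proof cases
    case 1
    obtain Z where Z: "sym_traceless Z" "trace (Z ** Z) = 2"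
      "trace (X ** Z ** Z) = - a" "cone_hessian X Z = (-3*a - 3*a*b*c) * 2" "trace (W ** Z ** Z) \<le> - c'"
      using extreme_test_direction[OF Q(1-3)] Q'(1-3) W(1) by metis
    have "cone_hessian W Z \<le> (-3*c' - 3*a'*b'*c') * 2"
      using cone_hessian_bounds(2)[OF Q'(1-3) Z(1)] Z(2) by simp
    then have "C * cone_hessian W Z \<le> C * ((-3*c' - 3*a'*b'*c') * 2)" using r by simp
    moreover have "6 * r' * trace (W ** Z ** Z) \<le> 6 * r' * (- c')" using Z(5) r by (intro mult_left_mono) auto
    ultimately have "6 * r * trace (X ** Z ** Z) + C * cone_hessian X Z + 6 * r' * trace (W ** Z ** Z) + C * cone_hessian W Z
      \<le> 6 * r * (-a) + C * ((-3*a - 3*a*b*c) * 2) + 6 * r' * (- c') + C * ((-3*c' - 3*a'*b'*c') * 2)"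
      unfolding Z(3,4) by linarith
    also have "\<dots> = 6 * - ((r+C) * a + (r'+C) * c') - 2 * (C * e)"
      by (simp add: e_def algebra_simps)
    also have "\<dots> \<le> 6 * (C/2*e) - 2 * (C * e)" using 1 by (intro diff_right_mono mult_left_mono) auto
    also have "\<dots> = C/2 * (trace (X ** X ** X) + trace (W ** W ** W)) * trace (Z ** Z)"
      unfolding Z(2) Q(4) Q'(4) e_def[symmetric] by simp
    finally show ?thesis using that Z(1,2) by simp
  next
    case 3
    obtain Z where Z: "sym_traceless Z" "trace (Z ** Z) = 2"
      "trace (W ** Z ** Z) = - a'" "cone_hessian W Z = (-3*a' - 3*a'*b'*c') * 2" "trace (X ** Z ** Z) \<le> - c"
      using extreme_test_direction[OF Q'(1-3)] Q(1-3) X(1) by metis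
    have "cone_hessian X Z \<le> (-3*c - 3*a*b*c) * 2"
      using cone_hessian_bounds(2)[OF Q(1-3) Z(1)] Z(2) by simp
    then have "C * cone_hessian X Z \<le> C * ((-3*c - 3*a*b*c) * 2)" using r by simp
    moreover have "6 * r * trace (X ** Z ** Z) \<le> 6 * r * (- c)" using Z(5) r by (intro mult_left_mono) auto
    ultimately have "6 * r * trace (X ** Z ** Z) + C * cone_hessian X Z + 6 * r' * trace (W ** Z ** Z) + C * cone_hessian W Z
      \<le> 6 * r * (-c) + C * ((-3*c - 3*a*b*c) * 2) + 6 * r' * (- a') + C * ((-3*a' - 3*a'*b'*c') * 2)"
      unfolding Z(3,4) by linarith
    also have "\<dots> = 6 * - ((r'+C) * a' + (r+C) * c) - 2 * (C * e)"
      by (simp add: e_def algebra_simps)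
    also have "\<dots> \<le> 6 * (C/2*e) - 2 * (C * e)" using 3 by (intro diff_right_mono mult_left_mono) auto
    also have "\<dots> = C/2 * (trace (X ** X ** X) + trace (W ** W ** W)) * trace (Z ** Z)"
      unfolding Z(2) Q(4) Q'(4) e_def[symmetric] by simp
    finally show ?thesis using that Z(1,2) by simp
  next
    case 2
    define f g where "f = Q *v axis 3 1" "g = Q' *v axis 3 1"
    have n: "norm f = 1" "norm g = 1"
      unfolding f_g_def using Q(1) Q'(1) by (simp_all add: norm_orthogonal_matrix_mult_vec)
    define Z where "Z = sym_outer f g"
    note mX = middle_test_direction[OF Q(1-3) n(2) f_g_def(1) less_imp_le[OF r(1)] r(2), folded Z_def]
    note mW = middle_test_direction[OF Q'(1-3) n(1) f_g_def(2) less_imp_le[OF r(1)] r(3),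
        unfolded sym_outer_commute[of g f], folded Z_def]
    define q where "q = trace (Z ** Z)"
    have "6 * r * trace (X ** Z ** Z) + C * cone_hessian X Z + 6 * r' * trace (W ** Z ** Z) + C * cone_hessian W Z
       \<le> (-3*b*(r + C) - C*(3*a*b*c)) * q + (-3*b'*(r' + C) - C*(3*a'*b'*c')) * q"
      using mX(1) mW(1) unfolding q_def by linarith
    also have "\<dots> = (3 * - ((r+C) * b + (r'+C) * b') - C * e) * q" by (simp add: e_def algebra_simps)
    also have "\<dots> \<le> (3 * (C/2*e) - C * e) * q"
      using 2 mX(2) by (intro mult_right_mono) (auto simp: q_def)
    also have "\<dots> = C/2 * (trace (X ** X ** X) + trace (W ** W ** W)) * trace (Z ** Z)"
      unfolding Q(4) Q'(4) e_def[symmetric] q_def by simp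
    finally show ?thesis using that[of Z] mX(2) sym_traceless_sym_outer Z_def by force
  qed
qed

subsection \<open>The Cartan cubic on five-space\<close>

lemma exhaust_5: "x = 1 \<or> x = 2 \<or> x = 3 \<or> x = 4 \<or> x = 5" for x :: 5
proof (induct x)
  case (of_int z)
  then have "0 \<le> z" and "z < 5" by simp_all
  then have "z = 0 \<or> z = 1 \<or> z = 2 \<or> z = 3 \<or> z = 4" by arith
  then show ?case by auto
qed

lemma UNIV_5: "UNIV = {1::5, 2, 3, 4, 5}"
  using exhaust_5 by auto

lemma sum_5: "sum f (UNIV :: 5 set) = f 1 + f 2 + f 3 + f 4 + f 5"
  unfolding UNIV_5 by (simp add: ac_simps)

text \<open>A linear isometry from \<open>real^5\<close> onto the traceless symmetric \<open>3 \<times> 3\<close> matrices with the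
  trace inner product.\<close>

definition sym3 :: "real^5 \<Rightarrow> real^3^3" where
  "sym3 x = vector
    [vector [x$1 / sqrt 2 + x$2 / sqrt 6, x$3 / sqrt 2, x$4 / sqrt 2],
     vector [x$3 / sqrt 2, - x$1 / sqrt 2 + x$2 / sqrt 6, x$5 / sqrt 2],
     vector [x$4 / sqrt 2, x$5 / sqrt 2, - 2 * x$2 / sqrt 6]]"

text \<open>The adjoint of \<open>sym3\<close> for the trace inner product, hence its inverse on
  traceless symmetric matrices.\<close>

definition desym :: "real^3^3 \<Rightarrow> real^5" where
  "desym A = (\<chi> j. trace (A ** sym3 (axis j 1)))"

lemma sym3_nth:
  "sym3 x $ 1 $ 1 = x$1 / sqrt 2 + x$2 / sqrt 6" "sym3 x $ 1 $ 2 = x$3 / sqrt 2" "sym3 x $ 1 $ 3 = x$4 / sqrt 2"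
  "sym3 x $ 2 $ 1 = x$3 / sqrt 2" "sym3 x $ 2 $ 2 = - x$1 / sqrt 2 + x$2 / sqrt 6" "sym3 x $ 2 $ 3 = x$5 / sqrt 2"
  "sym3 x $ 3 $ 1 = x$4 / sqrt 2" "sym3 x $ 3 $ 2 = x$5 / sqrt 2" "sym3 x $ 3 $ 3 = - 2 * x$2 / sqrt 6"
  by (simp_all add: sym3_def vector_3)

lemma linear_sym3: "linear sym3"
  by (intro linearI) (simp_all add: vec_eq_iff forall_3 sym3_nth add_divide_distrib diff_divide_distrib distrib_left right_diff_distrib)

lemma sym_traceless_sym3: "sym_traceless (sym3 x)"
  by (simp add: sym_traceless_def transpose_def vec_eq_iff forall_3 trace_def sum_3 sym3_nth field_simps)

lemma trace_mult_sym3: "trace (sym3 x ** sym3 y) = x \<bullet> y"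
proof -
  have s: "sqrt 2 * sqrt 2 = (2::real)" "sqrt 6 * sqrt 6 = (6::real)" by simp_all
  have "trace (sym3 x ** sym3 y) = 
     2 * (x$1*y$1 + x$3*y$3 + x$4*y$4 + x$5*y$5) / (sqrt 2 * sqrt 2) + 6 * (x$2*y$2) / (sqrt 6 * sqrt 6)"
    unfolding trace_def matrix_matrix_mult_def sum_3
    by (simp only: sym3_nth vec_lambda_beta) (simp add: field_simps)
  then show ?thesis unfolding s by (simp add: inner_vec_def sum_5)
qed

lemma matrix_mult_add_left: "(A + B) ** C = A ** C + B ** C" for A B :: "real^'n^'m" and C :: "real^'k^'n"
  by (simp add: matrix_matrix_mult_def vec_eq_iff sum.distrib distrib_right)

lemma trace_mult_add_right: "trace (A ** (B + C)) = trace (A ** B) + trace (A ** C)" for A B C :: "real^'n^'n"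
  by (simp add: matrix_add_ldistrib trace_add)

lemma trace_mult_scaleR_right: "trace (A ** (c *\<^sub>R B)) = c * trace (A ** B)" for A B :: "real^'n^'n"
  by (simp add: trace_def matrix_matrix_mult_def sum_distrib_left algebra_simps)

lemma desym_inner: "desym A \<bullet> z = trace (A ** sym3 z)"
proof -
  have "linear (\<lambda>z. trace (A ** sym3 z))"
    by (intro linearI) (simp_all add: linear_add[OF linear_sym3] linear_scale[OF linear_sym3]
        trace_mult_add_right trace_mult_scaleR_right)
  then have "trace (A ** sym3 z) = (\<Sum>j\<in>UNIV. z$j * trace (A ** sym3 (axis j 1)))"
    using linear_sum[of "\<lambda>z. trace (A ** sym3 z)" "\<lambda>j. z$j *\<^sub>R axis j 1" UNIV]
      basis_expansion[of z]
    by (simp add: linear_scale[OF linear_sym3] trace_mult_scaleR_right scalar_mult_eq_scaleR)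
  then show ?thesis by (simp add: desym_def inner_vec_def mult.commute)
qed

lemma sym3_desym:
  assumes "sym_traceless A"
  shows "sym3 (desym A) = A"
proof -
  note e = sym_traceless_entries[OF assms]
  have s: "sqrt 2 * sqrt 2 = (2::real)" "sqrt 6 * sqrt 6 = (6::real)" by simp_all
  have s': "x / sqrt 2 / sqrt 2 = x / 2" "x / sqrt 6 / sqrt 6 = x / 6" for x :: real by simp_all
  have A33: "A$3$3 = - A$1$1 - A$2$2" using e(4) by simp
  have d: "desym A $ 1 = (A$1$1 - A$2$2) / sqrt 2" "desym A $ 2 = 3 * (A$1$1 + A$2$2) / sqrt 6"
    "desym A $ 3 = 2 * A$1$2 / sqrt 2" "desym A $ 4 = 2 * A$1$3 / sqrt 2" "desym A $ 5 = 2 * A$2$3 / sqrt 2"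
    unfolding desym_def trace_def matrix_matrix_mult_def
    by (simp_all add: sum_3 sym3_nth axis_def e(1-3) A33 field_simps)
  show ?thesis
    unfolding vec_eq_iff forall_3 sym3_nth d
    by (simp add: e(1-3) A33 s' diff_divide_distrib add_divide_distrib)
qed

text \<open>The symmetrized matrix product with its trace part removed, since \<open>desym\<close>
  annihilates the identity. Up to the factor 6, \<open>jordan x\<close> is the Hessian of
  \<open>cubic\<close> at \<open>x\<close>.\<close>

definition jordan :: "real^5 \<Rightarrow> real^5 \<Rightarrow> real^5" where
  "jordan x y = desym ((1/2) *\<^sub>R (sym3 x ** sym3 y + sym3 y ** sym3 x))"

lemma jordan_commute: "jordan x y = jordan y x"
  by (simp add: jordan_def add.commute)

lemma trace_mult_add_left: "trace ((A + B) ** C) = trace (A ** C) + trace (B ** C)" for A B C :: "real^'n^'n"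
  by (metis trace_mul_sym trace_mult_add_right)

lemma trace_mult_scaleR_left: "trace ((c *\<^sub>R A) ** B) = c * trace (A ** B)" for A B :: "real^'n^'n"
  by (metis trace_mul_sym trace_mult_scaleR_right)

lemma jordan_inner:
  "jordan x y \<bullet> z = (trace (sym3 x ** sym3 y ** sym3 z) + trace (sym3 y ** sym3 x ** sym3 z)) / 2"
  unfolding jordan_def desym_inner trace_mult_scaleR_left trace_mult_add_left by simp

lemma trace_rotate3: "trace (A ** B ** C) = trace (B ** C ** A)" for A B C :: "real^'n^'n"
  by (metis matrix_mul_assoc trace_mul_sym)

text \<open>With commutativity this gives full symmetry of the trilinear form
  \<open>jordan x y \<bullet> z\<close>; it comes from cyclicity of the trace.\<close>

lemma jordan_inner_swap: "jordan x y \<bullet> z = jordan x z \<bullet> y"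
  unfolding jordan_inner
  using trace_rotate3[of "sym3 x" "sym3 y" "sym3 z"] trace_rotate3[of "sym3 y" "sym3 x" "sym3 z"]
   trace_rotate3[of "sym3 x" "sym3 z" "sym3 y"] trace_rotate3[of "sym3 z" "sym3 x" "sym3 y"] by simp

lemma jordan_inner_diag: "jordan x z \<bullet> z = trace (sym3 x ** sym3 z ** sym3 z)" "jordan x x \<bullet> z = trace (sym3 x ** sym3 x ** sym3 z)"
  unfolding jordan_inner using trace_rotate3[of "sym3 x" "sym3 z" "sym3 z"] trace_rotate3[of "sym3 z" "sym3 x" "sym3 z"]
  by simp_all

lemma bounded_bilinear_jordan: "bounded_bilinear jordan"
proof -
  have r: "linear (\<lambda>y. jordan x y)" for x
  proof (rule linearI)
    have "jordan x (y + y') \<bullet> z = (jordan x y + jordan x y') \<bullet> z" for y y' z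
      by (simp add: jordan_inner linear_add[OF linear_sym3] matrix_add_ldistrib matrix_mult_add_left
          trace_add inner_left_distrib add_divide_distrib)
    then show "jordan x (y + y') = jordan x y + jordan x y'" for y y' by (metis vector_eq_rdot)
    have "jordan x (c *\<^sub>R y) \<bullet> z = (c *\<^sub>R jordan x y) \<bullet> z" for c y z
      by (metis inner_scaleR_left inner_scaleR_right jordan_inner_swap)
    then show "jordan x (c *\<^sub>R y) = c *\<^sub>R jordan x y" for c y by (metis vector_eq_rdot)
  qed
  moreover have "linear (\<lambda>x. jordan x y)" for y
    using r[of y] by (simp add: jordan_commute)
  ultimately have "bilinear jordan" by (simp add: bilinear_def)
  then show ?thesis by (simp add: bilinear_conv_bounded_bilinear)
qed

interpretation jordan: bounded_bilinear jordan by (rule bounded_bilinear_jordan)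

definition cubic :: "real^5 \<Rightarrow> real" where "cubic x = jordan x x \<bullet> x"

lemma cubic_eq_trace: "cubic x = trace (sym3 x ** sym3 x ** sym3 x)"
  by (simp add: cubic_def jordan_inner_diag)

text \<open>Harmonicity of \<open>cubic\<close>: the squares of an orthonormal basis add up to 5/3
  times the identity, which pairs to zero with a traceless matrix.\<close>

lemma sum_axis_jordan: "(\<Sum>j\<in>UNIV. jordan x (axis j 1) \<bullet> axis j 1) = 0"
proof -
  have s: "a / sqrt 2 / sqrt 2 = a / 2" "a / sqrt 6 / sqrt 6 = a / 6" 
     "a * (b / sqrt 2) / sqrt 2 = a * b / 2"  "a * (b / sqrt 6) / sqrt 6 = a * b / 6" for a b :: real by simp_all
  have "(\<Sum>j\<in>UNIV. jordan x (axis j 1) \<bullet> axis j 1) = trace (sym3 x ** (\<Sum>j\<in>UNIV. sym3 (axis j 1) ** sym3 (axis j 1)))"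
    unfolding jordan_inner_diag sum_5
    by (simp add: matrix_add_ldistrib trace_add matrix_mul_assoc)
  also have "(\<Sum>j\<in>UNIV. sym3 (axis j 1) ** sym3 (axis j 1)) = mat (5/3)"
    unfolding sum_5 vec_eq_iff forall_3 matrix_matrix_mult_def mat_def
    by (simp add: sum_3 sym3_nth axis_def s)
  also have "trace (sym3 x ** mat (5/3)) = 5/3 * trace (sym3 x)"
    by (simp add: trace_def matrix_matrix_mult_def mat_def sum_3 sum.delta algebra_simps)
  finally show ?thesis using sym_traceless_sym3[of x] by (simp add: sym_traceless_def)
qed

lemma cone_hessian_sym3:
  "cone_hessian (sym3 y) (sym3 z) = 6 * (jordan y z \<bullet> z) - 6 * (y \<bullet> z) * (jordan y y \<bullet> z) - cubic y * (z \<bullet> z)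
    + 3 * cubic y * (y \<bullet> z)^2"
  by (simp add: cone_hessian_def jordan_inner_diag trace_mult_sym3 cubic_eq_trace)

lemma cubic_uminus: "cubic (- x) = - cubic x"
  by (simp add: cubic_def jordan.minus_left jordan.minus_right)

lemma cubic_scaleR: "cubic (c *\<^sub>R x) = c^3 * cubic x"
  by (simp add: cubic_def jordan.scaleR_left jordan.scaleR_right power3_eq_cube)

text \<open>The quadratic form on \<open>z\<close> given by the Hessian of \<open>cubic x + c cubic x / \<bar>x\<bar>\<close>,
  extended by \<open>0\<close> to \<open>x = 0\<close>.\<close>

definition model_hessian :: "real \<Rightarrow> real^5 \<Rightarrow> real^5 \<Rightarrow> real" where
  "model_hessian c x z = 6 * (jordan x z \<bullet> z) + c * cone_hessian (sym3 (sgn x)) (sym3 z)"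

lemma model_hessian_uminus: "model_hessian c (- x) z = - model_hessian c x z"
  by (simp add: model_hessian_def jordan.minus_left sgn_minus linear_neg[OF linear_sym3] cone_hessian_uminus)

lemma model_hessian_scaleR: "model_hessian c x (k *\<^sub>R z) = k^2 * model_hessian c x z"
  by (simp add: model_hessian_def jordan.scaleR_right cone_hessian_sym3 power2_eq_square algebra_simps)

text \<open>The term \<open>8 * c * (...)\<close> is the trace of the difference of the two model
  Hessians. A unit direction on which the difference is at most \<open>- c/2\<close> times the same
  gap compensates it exactly when weighted by 16.\<close>

lemma model_hessian_pair_nonzero:
  assumes c: "0 < c" and nz: "x \<noteq> 0" "y \<noteq> 0" and lt: "cubic (sgn x) < cubic (sgn y)"
  shows "\<exists>z. norm z \<le> 1 \<and> 8 * c * (cubic (sgn y) - cubic (sgn x)) + 16 * (model_hessian c x z - model_hessian c y z) \<le> 0"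
proof -
  have u: "trace (sym3 (sgn x) ** sym3 (sgn x)) = 1" "trace (sym3 (sgn (-y)) ** sym3 (sgn (-y))) = 1"
    using nz by (simp_all add: trace_mult_sym3 dot_square_norm norm_sgn)
  have neg: "cubic (sgn x) + cubic (sgn (-y)) < 0" using lt by (simp add: sgn_minus cubic_uminus)
  define e where "e = cubic (sgn x) + cubic (sgn (-y))"
  obtain Z where Z: "sym_traceless Z" "trace (Z ** Z) > 0"
    and le: "6 * norm x * trace (sym3 (sgn x) ** Z ** Z) + c * cone_hessian (sym3 (sgn x)) Z
      + 6 * norm y * trace (sym3 (sgn (-y)) ** Z ** Z) + c * cone_hessian (sym3 (sgn (-y))) Z
      \<le> c/2 * e * trace (Z ** Z)"
    unfolding e_def cubic_eq_trace
    using cone_pair_test_direction[OF sym_traceless_sym3 u(1) sym_traceless_sym3 u(2) c norm_ge_zero norm_ge_zero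
        neg[unfolded cubic_eq_trace]] by metis
  define z where "z = desym Z"
  have zZ: "sym3 z = Z" unfolding z_def by (rule sym3_desym[OF Z(1)])
  have zz: "z \<bullet> z = trace (Z ** Z)" using zZ trace_mult_sym3[of z z] by simp
  have m: "model_hessian c x z = 6 * norm x * trace (sym3 (sgn x) ** Z ** Z) + c * cone_hessian (sym3 (sgn x)) Z" for x
  proof -
    have "jordan x z \<bullet> z = norm x * (jordan (sgn x) z \<bullet> z)"
      by (cases "x = 0") (simp_all add: sgn_div_norm jordan.scaleR_left jordan.zero_left)
    then show ?thesis by (simp add: model_hessian_def jordan_inner_diag[symmetric] zZ[symmetric])
  qed
  have le': "model_hessian c x z - model_hessian c y z \<le> c/2 * e * (z \<bullet> z)"
    using le m[of x] m[of "-y"] by (simp add: model_hessian_uminus zz)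
  define w where "w = sgn z"
  have znz: "z \<noteq> 0" using Z(2) zz by auto
  have ms: "model_hessian c x w = model_hessian c x z / (z \<bullet> z)" for x
    by (simp add: w_def sgn_div_norm model_hessian_scaleR power_divide dot_square_norm power_inverse divide_inverse mult.commute)
  have "model_hessian c x w - model_hessian c y w \<le> c/2 * e"
    unfolding ms using le' znz by (simp add: field_simps)
  moreover have "norm w \<le> 1" by (simp add: w_def norm_sgn)
  moreover have "e = - (cubic (sgn y) - cubic (sgn x))" by (simp add: e_def sgn_minus cubic_uminus)
  moreover have "8 * c * (cubic (sgn y) - cubic (sgn x)) = - 16 * (c/2 * e)"
    by (simp add: e_def sgn_minus cubic_uminus algebra_simps)
  ultimately have "8 * c * (cubic (sgn y) - cubic (sgn x)) + 16 * (model_hessian c x w - model_hessian c y w) \<le> 0"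
    by (simp only:) simp
  then show ?thesis using \<open>norm w \<le> 1\<close> by blast
qed

lemma model_hessian_pair:
  assumes c: "0 < c"
  shows "\<exists>z. norm z \<le> 1 \<and> 8 * c * (cubic (sgn y) - cubic (sgn x)) + 16 * (model_hessian c x z - model_hessian c y z) \<le> 0"
proof (cases "cubic (sgn x) < cubic (sgn y)")
  case False
  \<comment> \<open>The trace of the difference is nonpositive, so the zero direction will
    do.\<close>
  then have "8 * c * (cubic (sgn y) - cubic (sgn x)) \<le> 0" using c by (simp add: mult_le_0_iff)
  moreover have "model_hessian c x 0 = 0" for x using model_hessian_scaleR[of c x 0 0] by simp
  ultimately show ?thesis by (intro exI[of _ 0]) simp
next
  case True
  have m0: "model_hessian c 0 z = 0" for z using model_hessian_uminus[of c 0 z] by simp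
  have c0: "cubic 0 = 0" by (simp add: cubic_def)
  consider "x \<noteq> 0" "y \<noteq> 0" | "x = 0" "y \<noteq> 0" | "x \<noteq> 0" "y = 0" using True by fastforce
  then show ?thesis
  proof cases
    case 1
    then show ?thesis using model_hessian_pair_nonzero[OF c 1 True] by blast
  next
    case 2
    \<comment> \<open>Oddness replaces the apex by \<open>-y\<close>: both the gap and the Hessian
      difference are exactly doubled, so the inequality for the pair \<open>-y\<close>,
      \<open>y\<close> halves to the one required.\<close>
    then have "cubic (sgn (-y)) < cubic (sgn y)" using True c0 by (simp add: sgn_minus cubic_uminus)
    from model_hessian_pair_nonzero[OF c _ _ this] 2 obtain z where z: "norm z \<le> 1"
      "8 * c * (cubic (sgn y) - cubic (sgn (-y))) + 16 * (model_hessian c (-y) z - model_hessian c y z) \<le> 0" by auto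
    have "8 * c * (cubic (sgn y) - cubic (sgn x)) + 16 * (model_hessian c x z - model_hessian c y z) \<le> 0"
      using z(2) 2 c0 m0 by (simp add: sgn_minus cubic_uminus model_hessian_uminus)
    then show ?thesis using z(1) by blast
  next
    case 3
    then have "cubic (sgn x) < cubic (sgn (-x))" using True c0 by (simp add: sgn_minus cubic_uminus)
    from model_hessian_pair_nonzero[OF c _ _ this] 3 obtain z where z: "norm z \<le> 1"
      "8 * c * (cubic (sgn (-x)) - cubic (sgn x)) + 16 * (model_hessian c x z - model_hessian c (-x) z) \<le> 0" by auto
    have "8 * c * (cubic (sgn y) - cubic (sgn x)) + 16 * (model_hessian c x z - model_hessian c y z) \<le> 0"
      using z(2) 3 c0 m0 by (simp add: sgn_minus cubic_uminus model_hessian_uminus)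
    then show ?thesis using z(1) by blast
  qed
qed

text \<open>The Laplacian of \<open>cubic y / \<bar>y\<bar>\<close> on the unit sphere. The first
  term drops out by harmonicity and the other three give -6, -5 (the dimension) and 3.\<close>

lemma sum_axis_cone_hessian:
  assumes "norm y = 1"
  shows "(\<Sum>j\<in>UNIV. cone_hessian (sym3 y) (sym3 (axis j 1))) = - 8 * cubic y"
proof -
  have e: "v \<bullet> axis j 1 = v $ j" for v :: "real^5" and j by (simp add: inner_axis)
  have s: "(\<Sum>j\<in>UNIV. (v $ j) * (w $ j)) = v \<bullet> w" for v w :: "real^5" by (simp add: inner_vec_def)
  have "(\<Sum>j\<in>UNIV. cone_hessian (sym3 y) (sym3 (axis j 1)))
     = 6 * (\<Sum>j\<in>UNIV. jordan y (axis j 1) \<bullet> axis j 1) - 6 * (\<Sum>j\<in>UNIV. (y $ j) * (jordan y y $ j))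
       - cubic y * (\<Sum>j\<in>(UNIV::5 set). 1) + 3 * cubic y * (\<Sum>j\<in>UNIV. y $ j * y $ j)"
    unfolding cone_hessian_sym3 e by (simp add: sum.distrib sum_subtractf sum_distrib_left power2_eq_square algebra_simps)
  also have "\<dots> = - 6 * cubic y - 5 * cubic y + 3 * cubic y"
    unfolding sum_axis_jordan s using assms
    by (simp add: cubic_def inner_commute[of y "jordan y y"] norm_eq_1)
  finally show ?thesis by simp
qed

subsection \<open>A twice differentiable cut-off\<close>

text \<open>A cubic spline step, equal to 1 below \<open>1/4\<close> and to 0 above 1: the rescaled third difference of
  \<open>t \<mapsto> (max 0 t)\<^sup>3\<close>; \<open>bump1\<close> and \<open>bump2\<close> are its derivatives.\<close>

definition bump :: "real \<Rightarrow> real" where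
  "bump t = 32/3 * (max 0 (1-t)^3 - 3 * max 0 (3/4-t)^3 + 3 * max 0 (1/2-t)^3 - max 0 (1/4-t)^3)"
definition bump1 :: "real \<Rightarrow> real" where
  "bump1 t = - 32 * (max 0 (1-t)^2 - 3 * max 0 (3/4-t)^2 + 3 * max 0 (1/2-t)^2 - max 0 (1/4-t)^2)"
definition bump2 :: "real \<Rightarrow> real" where
  "bump2 t = 64 * (max 0 (1-t) - 3 * max 0 (3/4-t) + 3 * max 0 (1/2-t) - max 0 (1/4-t))"

lemma DERIV_max0_power2: "((\<lambda>t. max 0 t ^ 2) has_real_derivative 2 * max 0 t) (at (t::real))"
proof -
  \<comment> \<open>This form leaves only \<open>t * \<bar>t\<bar>\<close> to be differentiated by
    hand, and only at 0 by the definition of the derivative.\<close>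
  have e: "max 0 t ^ 2 = (t^2 + t * \<bar>t\<bar>) / 2" for t :: real
    by (cases "t \<ge> 0") (auto simp: power2_eq_square)
  have d: "((\<lambda>t. t * \<bar>t\<bar>) has_real_derivative 2 * \<bar>t\<bar>) (at t)" for t :: real
  proof (cases "t = 0")
    case True
    have "((\<lambda>h::real. \<bar>h\<bar>) \<longlongrightarrow> 0) (at 0)" by (rule tendsto_rabs_zero[OF tendsto_ident_at])
    then have "((\<lambda>h::real. (h * \<bar>h\<bar>) / h) \<longlongrightarrow> 0) (at 0)"
      by (rule Lim_transform_eventually) (auto simp: eventually_at_filter)
    then show ?thesis using True by (simp add: DERIV_def)
  next
    case False
    show ?thesis
    proof (cases "t > 0")
      case True
      have "((\<lambda>t. t * t) has_real_derivative 2 * \<bar>t\<bar>) (at t)"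
        using True by (auto intro!: derivative_eq_intros)
      then show ?thesis
        by (rule has_field_derivative_transform_within_open[of _ _ _ "{0<..}"]) (use True in auto)
    next
      case neg: False
      have "((\<lambda>t. - (t * t)) has_real_derivative 2 * \<bar>t\<bar>) (at t)"
        using neg by (auto intro!: derivative_eq_intros)
      then show ?thesis
        by (rule has_field_derivative_transform_within_open[of _ _ _ "{..<0}"]) (use neg False in auto)
    qed
  qed
  have "((\<lambda>t. (t^2 + t * \<bar>t\<bar>) / 2) has_real_derivative (2 * t + 2 * \<bar>t\<bar>) / 2) (at t)"
    by (intro DERIV_cdivide DERIV_add d) (auto intro!: derivative_eq_intros)
  then show ?thesis unfolding e by (simp add: max_def abs_if split: if_splits)
qed

lemma DERIV_max0_power3: "((\<lambda>t. max 0 t ^ 3) has_real_derivative 3 * max 0 t ^ 2) (at (t::real))"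
proof -
  have e: "max 0 t ^ 3 = t * max 0 t ^ 2" for t :: real
    by (cases "t \<ge> 0") (auto simp: power2_eq_square power3_eq_cube)
  show ?thesis unfolding e
    using DERIV_mult'[OF DERIV_ident DERIV_max0_power2, of t]
    by (rule DERIV_cong) (auto simp: max_def power2_eq_square)
qed

lemma DERIV_max0_power2_diff: "((\<lambda>t. max 0 (b - t) ^ 2) has_real_derivative - (2 * max 0 (b - t))) (at (t::real))"
proof -
  have "((\<lambda>t. b - t) has_real_derivative -1) (at t)" by (auto intro!: derivative_eq_intros)
  from DERIV_chain2[OF DERIV_max0_power2 this] show ?thesis by simp
qed

lemma DERIV_max0_power3_diff: "((\<lambda>t. max 0 (b - t) ^ 3) has_real_derivative - (3 * max 0 (b - t)^2)) (at (t::real))"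
proof -
  have "((\<lambda>t. b - t) has_real_derivative -1) (at t)" by (auto intro!: derivative_eq_intros)
  from DERIV_chain2[OF DERIV_max0_power3 this] show ?thesis by simp
qed

lemma DERIV_bump: "(bump has_real_derivative bump1 t) (at t)"
  unfolding bump_def[abs_def] bump1_def
  by (rule DERIV_cong, (rule DERIV_cmult DERIV_diff DERIV_add DERIV_max0_power3_diff)+) simp

lemma DERIV_bump1: "(bump1 has_real_derivative bump2 t) (at t)"
  unfolding bump1_def[abs_def] bump2_def
  by (rule DERIV_cong, (rule DERIV_cmult DERIV_diff DERIV_add DERIV_max0_power2_diff)+) simp

lemma continuous_bump2: "isCont bump2 t"
  unfolding bump2_def[abs_def] by (intro continuous_intros)

lemma bump_le:
  assumes "t \<le> 1/4"
  shows "bump t = 1" "bump1 t = 0" "bump2 t = 0"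
proof -
  have m: "max 0 (1-t) = 1-t" "max 0 (3/4-t) = 3/4-t" "max 0 (1/2-t) = 1/2-t" "max 0 (1/4-t) = 1/4-t"
    using assms by auto
  show "bump t = 1" unfolding bump_def m by (simp add: power3_eq_cube field_simps)
  show "bump1 t = 0" unfolding bump1_def m by (simp add: power2_eq_square field_simps)
  show "bump2 t = 0" unfolding bump2_def m by (simp add: field_simps)
qed

lemma bump_ge: "t \<ge> 1 \<Longrightarrow> bump t = 0" "t \<ge> 1 \<Longrightarrow> bump1 t = 0" "t \<ge> 1 \<Longrightarrow> bump2 t = 0"
  by (auto simp: bump_def bump1_def bump2_def max_def)

text \<open>Radial factors are functions of \<open>t = y \<bullet> y\<close>, which keeps the norm
  out of the chain rule. The thresholds 1/4 and 1 of the cut-off correspond to the radii 1/2 and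
  1.\<close>

definition rad0 :: "real \<Rightarrow> real" where "rad0 t = bump t / sqrt t"
definition rad1 :: "real \<Rightarrow> real" where "rad1 t = bump1 t / sqrt t - bump t / (2 * t * sqrt t)"
definition rad2 :: "real \<Rightarrow> real" where
  "rad2 t = bump2 t / sqrt t - bump1 t / (t * sqrt t) + 3 * bump t / (4 * t^2 * sqrt t)"

lemma DERIV_inverse_sqrt: "t > 0 \<Longrightarrow> ((\<lambda>t. 1 / sqrt t) has_real_derivative - (1 / (2 * t * sqrt t))) (at t)"
  by (rule derivative_eq_intros refl | simp)+ (simp add: field_simps)

lemma DERIV_inverse_mult_sqrt: "t > 0 \<Longrightarrow> ((\<lambda>t. 1 / (t * sqrt t)) has_real_derivative - (3 / (2 * t^2 * sqrt t))) (at t)"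
proof -
  assume t: "t > 0"
  have "((\<lambda>t. 1 / t * (1 / sqrt t)) has_real_derivative 1 / t * - (1 / (2 * t * sqrt t)) + - (1 / t^2) * (1 / sqrt t)) (at t)"
    by (rule DERIV_mult'[OF _ DERIV_inverse_sqrt[OF t]])
      (use t in \<open>auto intro!: derivative_eq_intros simp: power2_eq_square\<close>)
  moreover have "1 / t * - (1 / (2 * t * sqrt t)) + - (1 / t^2) * (1 / sqrt t) = - (3 / (2 * t^2 * sqrt t))"
    using t by (simp add: divide_simps power2_eq_square)
  ultimately show ?thesis by simp
qed

lemma DERIV_rad0: "t > 0 \<Longrightarrow> (rad0 has_real_derivative rad1 t) (at t)"
proof -
  assume t: "t > 0"
  have "((\<lambda>t. bump t * (1 / sqrt t)) has_real_derivative bump t * - (1 / (2 * t * sqrt t)) + bump1 t * (1 / sqrt t)) (at t)"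
    by (rule DERIV_mult'[OF DERIV_bump DERIV_inverse_sqrt[OF t]])
  then show ?thesis by (simp add: rad0_def[abs_def] rad1_def)
qed

lemma DERIV_rad1: "t > 0 \<Longrightarrow> (rad1 has_real_derivative rad2 t) (at t)"
proof -
  assume t: "t > 0"
  have "((\<lambda>t. bump1 t * (1 / sqrt t) - 1/2 * (bump t * (1 / (t * sqrt t)))) has_real_derivative 
     (bump1 t * - (1 / (2 * t * sqrt t)) + bump2 t * (1 / sqrt t))
     - 1/2 * (bump t * - (3 / (2 * t^2 * sqrt t)) + bump1 t * (1 / (t * sqrt t)))) (at t)"
    by (intro DERIV_diff DERIV_cmult DERIV_mult' DERIV_bump DERIV_bump1 DERIV_inverse_sqrt[OF t] DERIV_inverse_mult_sqrt[OF t])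
  moreover have "(bump1 t * - (1 / (2 * t * sqrt t)) + bump2 t * (1 / sqrt t))
     - 1/2 * (bump t * - (3 / (2 * t^2 * sqrt t)) + bump1 t * (1 / (t * sqrt t))) = rad2 t"
  proof -
    define A B where "A = 1 / (t * sqrt t)" "B = 1 / (t^2 * sqrt t)"
    have 1: "1 / (2 * t * sqrt t) = A / 2" "3 / (2 * t^2 * sqrt t) = 3/2 * B" "1 / (t * sqrt t) = A"
      by (simp_all add: A_B_def)
    have 2: "rad2 t = bump2 t * (1 / sqrt t) - bump1 t * A + 3/4 * bump t * B"
      by (simp add: rad2_def A_B_def)
    show ?thesis unfolding 1 2 by (simp only: ring_distribs)
  qed
  moreover have "bump1 t * (1 / sqrt t) - 1/2 * (bump t * (1 / (t * sqrt t))) = rad1 t" for t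
    by (simp add: rad1_def)
  ultimately show ?thesis by simp
qed

lemma continuous_rad2: "t > 0 \<Longrightarrow> isCont rad2 t"
  unfolding rad2_def[abs_def]
  by (intro continuous_intros continuous_bump2 DERIV_isCont[OF DERIV_bump] DERIV_isCont[OF DERIV_bump1]) auto

subsection \<open>The singular cap\<close>

definition bounded_lipschitz :: "'a::real_normed_vector set \<Rightarrow> ('a \<Rightarrow> 'b::real_normed_vector) \<Rightarrow> bool" where
  "bounded_lipschitz S f \<longleftrightarrow> (\<exists>C\<ge>0. (\<forall>x\<in>S. norm (f x) \<le> C) \<and> (\<forall>x\<in>S. \<forall>y\<in>S. norm (f x - f y) \<le> C * norm (x - y)))"

lemma bounded_lipschitzI:
  assumes "\<And>x. x \<in> S \<Longrightarrow> norm (f x) \<le> B" "\<And>x y. x \<in> S \<Longrightarrow> y \<in> S \<Longrightarrow> norm (f x - f y) \<le> L * norm (x - y)"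
  shows "bounded_lipschitz S f"
  unfolding bounded_lipschitz_def
proof (intro exI[of _ "\<bar>B\<bar> + \<bar>L\<bar>"] conjI ballI)
  fix x y assume x: "x \<in> S" "y \<in> S"
  show "norm (f x) \<le> \<bar>B\<bar> + \<bar>L\<bar>" using assms(1)[OF x(1)] by linarith
  have "norm (f x - f y) \<le> L * norm (x - y)" by (rule assms(2)[OF x])
  also have "\<dots> \<le> (\<bar>B\<bar> + \<bar>L\<bar>) * norm (x - y)" by (rule mult_right_mono) auto
  finally show "norm (f x - f y) \<le> (\<bar>B\<bar> + \<bar>L\<bar>) * norm (x - y)" .
qed simp

lemma bounded_lipschitzE:
  assumes "bounded_lipschitz S f"
  obtains C where "C \<ge> 0" "\<And>x. x \<in> S \<Longrightarrow> norm (f x) \<le> C"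
    "\<And>x y. x \<in> S \<Longrightarrow> y \<in> S \<Longrightarrow> norm (f x - f y) \<le> C * norm (x - y)"
  using assms unfolding bounded_lipschitz_def by blast

lemma bounded_lipschitz_const: "bounded_lipschitz S (\<lambda>x. c)"
  by (rule bounded_lipschitzI[of _ _ "norm c" 0]) auto

lemma bounded_lipschitz_id: "bounded S \<Longrightarrow> bounded_lipschitz S (\<lambda>x. x)"
  unfolding bounded_iff by (auto intro: bounded_lipschitzI[of S "\<lambda>x. x" _ 1])

lemma bounded_lipschitz_compose:
  assumes f: "bounded_lipschitz S f" and g: "\<And>B. \<exists>C L. 0 \<le> C \<and> 0 \<le> L \<and> (\<forall>a b. norm a \<le> B \<longrightarrow> norm b \<le> B \<longrightarrow> a \<in> f ` S \<longrightarrow> b \<in> f ` S \<longrightarrow>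
      norm (g a) \<le> C \<and> norm (g a - g b) \<le> L * norm (a - b))"
  shows "bounded_lipschitz S (\<lambda>x. g (f x))"
proof -
  obtain C where C: "C \<ge> 0" "\<And>x. x \<in> S \<Longrightarrow> norm (f x) \<le> C"
    "\<And>x y. x \<in> S \<Longrightarrow> y \<in> S \<Longrightarrow> norm (f x - f y) \<le> C * norm (x - y)"
    using bounded_lipschitzE[OF f] by metis
  obtain D L where D: "D \<ge> 0" "L \<ge> 0" and gD: "\<And>a b. norm a \<le> C \<Longrightarrow> norm b \<le> C \<Longrightarrow> a \<in> f ` S \<Longrightarrow> b \<in> f ` S \<Longrightarrow>
      norm (g a) \<le> D \<and> norm (g a - g b) \<le> L * norm (a - b)" using g[of C] by metis
  show ?thesis
  proof (rule bounded_lipschitzI[of _ _ D "L * C"])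
    fix x y assume x: "x \<in> S" "y \<in> S"
    show "norm (g (f x)) \<le> D" using gD C(2) x by blast
    have "norm (g (f x) - g (f y)) \<le> L * norm (f x - f y)" using gD C(2) x by blast
    also have "\<dots> \<le> L * (C * norm (x - y))" using C(3)[OF x] D by (intro mult_left_mono) auto
    finally show "norm (g (f x) - g (f y)) \<le> L * C * norm (x - y)" by simp
  qed
qed

lemma bounded_lipschitz_linear:
  fixes f :: "'a::real_normed_vector \<Rightarrow> 'b::real_normed_vector" and g :: "'b \<Rightarrow> 'c::real_normed_vector"
  assumes "bounded_linear g" "bounded_lipschitz S f"
  shows "bounded_lipschitz S (\<lambda>x. g (f x))"
proof (rule bounded_lipschitz_compose[OF assms(2)])
  fix B
  interpret bounded_linear g by fact
  obtain K where K: "K > 0" "\<And>x. norm (g x) \<le> norm x * K" using pos_bounded by blast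
  show "\<exists>C L. 0 \<le> C \<and> 0 \<le> L \<and> (\<forall>(a::'b) (b::'b). norm a \<le> B \<longrightarrow> norm b \<le> B \<longrightarrow> a \<in> f ` S \<longrightarrow> b \<in> f ` S \<longrightarrow> 
      norm (g a) \<le> C \<and> norm (g a - g b) \<le> L * norm (a - b))"
  proof (rule exI[of _ "\<bar>B\<bar> * K"], rule exI[of _ K], intro conjI allI impI)
    fix a b :: 'b assume "norm a \<le> B"
    then have "norm a * K \<le> \<bar>B\<bar> * K" using K by (intro mult_right_mono) auto
    then show "norm (g a) \<le> \<bar>B\<bar> * K" using K(2)[of a] by linarith
    show "norm (g a - g b) \<le> K * norm (a - b)" using K(2)[of "a-b"] by (simp add: diff mult.commute)
  qed (use K in auto)
qed

lemma bounded_lipschitz_bilinear: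
  assumes "bounded_bilinear p" "bounded_lipschitz S f" "bounded_lipschitz S g"
  shows "bounded_lipschitz S (\<lambda>x. p (f x) (g x))"
proof -
  interpret bounded_bilinear p by fact
  obtain K where K: "K > 0" "\<And>x y. norm (p x y) \<le> norm x * norm y * K" using pos_bounded by blast
  obtain C where C: "C \<ge> 0" "\<And>x. x \<in> S \<Longrightarrow> norm (f x) \<le> C"
    "\<And>x y. x \<in> S \<Longrightarrow> y \<in> S \<Longrightarrow> norm (f x - f y) \<le> C * norm (x - y)"
    using bounded_lipschitzE[OF assms(2)] by metis
  obtain D where D: "D \<ge> 0" "\<And>x. x \<in> S \<Longrightarrow> norm (g x) \<le> D"
    "\<And>x y. x \<in> S \<Longrightarrow> y \<in> S \<Longrightarrow> norm (g x - g y) \<le> D * norm (x - y)"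
    using bounded_lipschitzE[OF assms(3)] by metis
  show ?thesis
  proof (rule bounded_lipschitzI[of _ _ "C * D * K" "2 * (C * D * K)"])
    fix x y assume x: "x \<in> S" "y \<in> S"
    have "norm (f x) * norm (g x) * K \<le> C * D * K"
      using C D K x by (intro mult_mono mult_nonneg_nonneg) auto
    then show "norm (p (f x) (g x)) \<le> C * D * K" using K(2)[of "f x" "g x"] by linarith
    have "p (f x) (g x) - p (f y) (g y) = p (f x - f y) (g x) + p (f y) (g x - g y)"
      by (simp add: diff_left diff_right)
    then have "norm (p (f x) (g x) - p (f y) (g y)) \<le> norm (p (f x - f y) (g x)) + norm (p (f y) (g x - g y))"
      by (simp add: norm_triangle_ineq)
    also have "\<dots> \<le> norm (f x - f y) * norm (g x) * K + norm (f y) * norm (g x - g y) * K"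
      by (intro add_mono K)
    also have "\<dots> \<le> (C * norm (x - y)) * D * K + C * (D * norm (x - y)) * K"
      using C D K x by (intro add_mono mult_mono mult_nonneg_nonneg) auto
    finally show "norm (p (f x) (g x) - p (f y) (g y)) \<le> 2 * (C * D * K) * norm (x - y)"
      by (simp add: algebra_simps)
  qed
qed

lemma bounded_lipschitz_add:
  assumes "bounded_lipschitz S f" "bounded_lipschitz S g"
  shows "bounded_lipschitz S (\<lambda>x. f x + g x)"
proof -
  obtain C where C: "C \<ge> 0" "\<And>x. x \<in> S \<Longrightarrow> norm (f x) \<le> C"
    "\<And>x y. x \<in> S \<Longrightarrow> y \<in> S \<Longrightarrow> norm (f x - f y) \<le> C * norm (x - y)"
    using bounded_lipschitzE[OF assms(1)] by metis
  obtain D where D: "D \<ge> 0" "\<And>x. x \<in> S \<Longrightarrow> norm (g x) \<le> D"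
    "\<And>x y. x \<in> S \<Longrightarrow> y \<in> S \<Longrightarrow> norm (g x - g y) \<le> D * norm (x - y)"
    using bounded_lipschitzE[OF assms(2)] by metis
  show ?thesis
  proof (rule bounded_lipschitzI[of _ _ "C + D" "C + D"])
    fix x y assume x: "x \<in> S" "y \<in> S"
    show "norm (f x + g x) \<le> C + D" using C(2)[OF x(1)] D(2)[OF x(1)] norm_triangle_ineq[of "f x" "g x"] by linarith
    have "norm (f x + g x - (f y + g y)) \<le> norm (f x - f y) + norm (g x - g y)"
      by (metis add_diff_add norm_triangle_ineq)
    then show "norm (f x + g x - (f y + g y)) \<le> (C + D) * norm (x - y)"
      using C(3)[OF x] D(3)[OF x] by (simp add: algebra_simps)
  qed
qed

lemma bounded_lipschitz_max0:
  fixes f :: "'a::real_normed_vector \<Rightarrow> real"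
  assumes "bounded_lipschitz S f"
  shows "bounded_lipschitz S (\<lambda>x. max 0 (f x))"
proof (rule bounded_lipschitz_compose[OF assms])
  fix B
  show "\<exists>C L. 0 \<le> C \<and> 0 \<le> L \<and> (\<forall>(a::real) (b::real). norm a \<le> B \<longrightarrow> norm b \<le> B \<longrightarrow> a \<in> f ` S \<longrightarrow> b \<in> f ` S \<longrightarrow> 
      norm (max 0 a) \<le> C \<and> norm (max 0 a - max 0 b) \<le> L * norm (a - b))"
    by (rule exI[of _ "\<bar>B\<bar>"], rule exI[of _ 1], intro conjI allI impI) (auto simp: max_def)
qed

lemma bounded_lipschitz_inverse:
  fixes f :: "'a::real_normed_vector \<Rightarrow> real"
  assumes "bounded_lipschitz S f" and c: "c > 0" "\<And>x. x \<in> S \<Longrightarrow> c \<le> f x"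
  shows "bounded_lipschitz S (\<lambda>x. inverse (f x))"
proof (rule bounded_lipschitz_compose[OF assms(1)])
  fix B
  show "\<exists>C L. 0 \<le> C \<and> 0 \<le> L \<and> (\<forall>(a::real) (b::real). norm a \<le> B \<longrightarrow> norm b \<le> B \<longrightarrow> a \<in> f ` S \<longrightarrow> b \<in> f ` S \<longrightarrow> 
      norm (inverse a) \<le> C \<and> norm (inverse a - inverse b) \<le> L * norm (a - b))"
  proof (rule exI[of _ "inverse c"], rule exI[of _ "inverse c * inverse c"], intro conjI allI impI)
    fix a b :: real assume "a \<in> f ` S" "b \<in> f ` S"
    then have ab: "c \<le> a" "c \<le> b" using c by auto
    then have i: "0 < inverse a" "0 < inverse b" "inverse a \<le> inverse c" "inverse b \<le> inverse c"
      using c by (auto intro: le_imp_inverse_le)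
    then show "norm (inverse a) \<le> inverse c" by simp
    have "inverse a - inverse b = (b - a) * (inverse a * inverse b)"
      using ab c by (simp add: field_simps)
    then have "norm (inverse a - inverse b) = norm (a - b) * (inverse a * inverse b)"
      using i by (simp add: abs_mult abs_minus_commute)
    also have "\<dots> \<le> norm (a - b) * (inverse c * inverse c)"
      using i c(1) by (intro mult_left_mono mult_mono) auto
    finally show "norm (inverse a - inverse b) \<le> inverse c * inverse c * norm (a - b)" by (simp add: mult.commute)
  qed (use c in auto)
qed

lemmas bounded_lipschitz_mult = bounded_lipschitz_bilinear[OF bounded_bilinear_mult]
lemmas bounded_lipschitz_scaleR = bounded_lipschitz_bilinear[OF bounded_bilinear_scaleR]
lemmas bounded_lipschitz_inner = bounded_lipschitz_bilinear[OF bounded_bilinear_inner]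

lemma bounded_lipschitz_diff:
  assumes "bounded_lipschitz S f" "bounded_lipschitz S g"
  shows "bounded_lipschitz S (\<lambda>x. f x - g x)"
  using bounded_lipschitz_add[OF assms(1) bounded_lipschitz_linear[OF bounded_linear_minus[OF bounded_linear_ident] assms(2)]]
  by simp

lemma bounded_lipschitz_power:
  fixes f :: "'a::real_normed_vector \<Rightarrow> real"
  shows "bounded_lipschitz S f \<Longrightarrow> bounded_lipschitz S (\<lambda>x. f x ^ n)"
  by (induction n) (auto intro: bounded_lipschitz_const bounded_lipschitz_mult)

text \<open>\<open>cap\<close> is the singular model \<open>cubic y / \<bar>y\<bar>\<close> cut off outside the unit ball; \<open>cap_grad\<close> and
  \<open>cap_hess\<close> are its derivatives away from the origin. At the origin \<open>x / 0 = 0\<close> makes them vanish.\<close>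

definition cap :: "real^5 \<Rightarrow> real" where "cap y = rad0 (y \<bullet> y) * cubic y"

definition cap_grad :: "real^5 \<Rightarrow> real^5" where
  "cap_grad y = (3 * rad0 (y \<bullet> y)) *\<^sub>R jordan y y + (2 * rad1 (y \<bullet> y) * cubic y) *\<^sub>R y"

definition cap_hess :: "real^5 \<Rightarrow> real^5 \<Rightarrow> real^5" where
  "cap_hess y h = (6 * rad0 (y \<bullet> y)) *\<^sub>R jordan y h + (6 * rad1 (y \<bullet> y) * (y \<bullet> h)) *\<^sub>R jordan y y
     + (6 * rad1 (y \<bullet> y) * (jordan y y \<bullet> h)) *\<^sub>R y + (2 * rad1 (y \<bullet> y) * cubic y) *\<^sub>R h
     + (4 * rad2 (y \<bullet> y) * cubic y * (y \<bullet> h)) *\<^sub>R y"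

lemma has_derivative_cubic: "(cubic has_derivative (\<lambda>h. (3 *\<^sub>R jordan y y) \<bullet> h)) (at y)"
proof -
  have "((\<lambda>y. jordan y y \<bullet> y) has_derivative (\<lambda>h. jordan y y \<bullet> h + (jordan y h + jordan h y) \<bullet> y)) (at y)"
    by (intro has_derivative_inner jordan.FDERIV has_derivative_ident)
  moreover have "(jordan y h + jordan h y) \<bullet> y = 2 * (jordan y y \<bullet> h)" for h
    by (simp only: jordan_commute[of h y] inner_left_distrib jordan_inner_swap[of y h y])
  ultimately show ?thesis by (simp add: cubic_def[abs_def])
qed

lemma has_derivative_radial:
  assumes "(g has_real_derivative d) (at (y \<bullet> y))"
  shows "((\<lambda>y::real^5. g (y \<bullet> y)) has_derivative (\<lambda>h. d * (2 * (y \<bullet> h)))) (at y)"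
proof -
  have "((\<lambda>y::real^5. y \<bullet> y) has_derivative (\<lambda>h. y \<bullet> h + h \<bullet> y)) (at y)"
    by (intro has_derivative_inner has_derivative_ident)
  from has_derivative_compose[OF this assms[unfolded has_field_derivative_def]]
  show ?thesis by (simp add: inner_commute)
qed

lemma has_derivative_cap:
  assumes "y \<noteq> 0"
  shows "(cap has_derivative (\<lambda>h. cap_grad y \<bullet> h)) (at y)"
proof -
  have t: "y \<bullet> y > 0" using assms by simp
  have "((\<lambda>y. rad0 (y \<bullet> y) * cubic y) has_derivative
     (\<lambda>h. rad0 (y \<bullet> y) * ((3 *\<^sub>R jordan y y) \<bullet> h) + rad1 (y \<bullet> y) * (2 * (y \<bullet> h)) * cubic y)) (at y)"
    by (intro has_derivative_mult has_derivative_radial DERIV_rad0 t has_derivative_cubic)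
  then show ?thesis
    by (simp add: cap_def[abs_def] cap_grad_def inner_left_distrib algebra_simps)
qed

lemma has_derivative_cap_grad:
  assumes "y \<noteq> 0"
  shows "(cap_grad has_derivative cap_hess y) (at y)"
proof -
  have t: "y \<bullet> y > 0" using assms by simp
  have "((\<lambda>y. (3 * rad0 (y \<bullet> y)) *\<^sub>R jordan y y + (2 * rad1 (y \<bullet> y) * cubic y) *\<^sub>R y) has_derivative
     (\<lambda>h. ((3 * rad0 (y \<bullet> y)) *\<^sub>R (jordan y h + jordan h y) + (3 * (rad1 (y \<bullet> y) * (2 * (y \<bullet> h)))) *\<^sub>R jordan y y)
        + ((2 * rad1 (y \<bullet> y) * cubic y) *\<^sub>R h
         + ((2 * rad1 (y \<bullet> y)) * ((3 *\<^sub>R jordan y y) \<bullet> h) + (2 * (rad2 (y \<bullet> y) * (2 * (y \<bullet> h)))) * cubic y) *\<^sub>R y))) (at y)"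
    by (intro has_derivative_add has_derivative_scaleR has_derivative_mult has_derivative_mult_right has_derivative_radial DERIV_rad0 DERIV_rad1 t
       has_derivative_cubic has_derivative_ident jordan.FDERIV)
  moreover have "((3 * rad0 (y \<bullet> y)) *\<^sub>R (jordan y h + jordan h y) + (3 * (rad1 (y \<bullet> y) * (2 * (y \<bullet> h)))) *\<^sub>R jordan y y)
        + ((2 * rad1 (y \<bullet> y) * cubic y) *\<^sub>R h
         + ((2 * rad1 (y \<bullet> y)) * ((3 *\<^sub>R jordan y y) \<bullet> h) + (2 * (rad2 (y \<bullet> y) * (2 * (y \<bullet> h)))) * cubic y) *\<^sub>R y) = cap_hess y h" for h
    unfolding cap_hess_def jordan_commute[of h y] by (simp add: algebra_simps scaleR_add_left scaleR_2[symmetric])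
  ultimately show ?thesis by (simp add: cap_grad_def[abs_def])
qed


lemma cap_hess_inner:
  "cap_hess y h \<bullet> h = 6 * rad0 (y \<bullet> y) * (jordan y h \<bullet> h) + 12 * rad1 (y \<bullet> y) * (y \<bullet> h) * (jordan y y \<bullet> h)
     + 2 * rad1 (y \<bullet> y) * cubic y * (h \<bullet> h) + 4 * rad2 (y \<bullet> y) * cubic y * (y \<bullet> h)^2"
  by (simp add: cap_hess_def inner_left_distrib power2_eq_square algebra_simps)

lemma linear_cap_hess: "linear (cap_hess y)"
  by (intro linearI) (simp_all add: cap_hess_def jordan.add_right jordan.scaleR_right inner_right_distrib
      scaleR_add_right scaleR_add_left algebra_simps)

lemma rad_small:
  assumes "t \<le> 1/4"
  shows "rad0 t = 1 / sqrt t" "rad1 t = - 1 / (2 * t * sqrt t)" "rad2 t = 3 / (4 * t^2 * sqrt t)"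
  using bump_le[OF assms] by (simp_all add: rad0_def rad1_def rad2_def)

text \<open>The cut-off equals 1 here and second derivatives of a function homogeneous of degree 2
  are homogeneous of degree 0, so only \<open>sgn y\<close> enters. At \<open>y = 0\<close> both
  sides vanish.\<close>

lemma cap_hess_small:
  assumes "norm y \<le> 1/2"
  shows "cap_hess y h \<bullet> h = cone_hessian (sym3 (sgn y)) (sym3 h)"
proof (cases "y = 0")
  case True
  then show ?thesis by (simp add: cap_hess_inner jordan.zero_left cubic_def cone_hessian_sym3)
next
  case False
  define n where "n = norm y"
  have n: "n > 0" "y \<bullet> y = n^2" "sqrt (n^2) = n" using False by (auto simp: n_def dot_square_norm)
  have "n^2 \<le> (1/2)^2" using assms by (intro power_mono) (auto simp: n_def)
  then have t: "y \<bullet> y \<le> 1/4" using n(2) by (simp add: power2_eq_square)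
  have s: "sgn y = (1/n) *\<^sub>R y" by (simp add: sgn_div_norm n_def inverse_eq_divide)
  show ?thesis
    unfolding cap_hess_inner rad_small[OF t] cone_hessian_sym3 s
    unfolding n(2,3) jordan.scaleR_left jordan.scaleR_right inner_scaleR_left inner_scaleR_right cubic_scaleR
    using n(1) by (simp add: divide_simps power2_eq_square power3_eq_cube)
qed

lemma cap_zero:
  assumes "norm y \<ge> 1"
  shows "cap y = 0" "cap_hess y h = 0" "cap_grad y = 0"
proof -
  have "1 \<le> (norm y)^2" using assms by simp
  then have "y \<bullet> y \<ge> 1" by (simp add: dot_square_norm)
  from bump_ge[OF this] show "cap y = 0" "cap_hess y h = 0" "cap_grad y = 0"
    by (simp_all add: cap_def cap_hess_def cap_grad_def rad0_def rad1_def rad2_def)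
qed

lemma bounded_lipschitz_cap_hess:
  "bounded_lipschitz {y. 1/4 \<le> norm y \<and> norm y \<le> 2} (\<lambda>y. cap_hess y h)" (is "bounded_lipschitz ?S _")
proof -
  have "bounded ?S" unfolding bounded_iff by auto
  note id = bounded_lipschitz_id[OF this]
  note const = bounded_lipschitz_const[of ?S]
  have t: "bounded_lipschitz ?S (\<lambda>y. y \<bullet> y)" by (intro bounded_lipschitz_inner id)
  have nrm: "bounded_lipschitz ?S norm"
    by (rule bounded_lipschitzI[of _ _ 2 1]) (auto simp: norm_triangle_ineq3)
  have i: "bounded_lipschitz ?S (\<lambda>y. inverse (norm y))"
    by (rule bounded_lipschitz_inverse[OF nrm, of "1/4"]) auto
  have b: "bounded_lipschitz ?S (\<lambda>y. bump (y \<bullet> y))" "bounded_lipschitz ?S (\<lambda>y. bump1 (y \<bullet> y))" "bounded_lipschitz ?S (\<lambda>y. bump2 (y \<bullet> y))"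
    unfolding bump_def bump1_def bump2_def
    by (intro bounded_lipschitz_mult bounded_lipschitz_diff bounded_lipschitz_add const bounded_lipschitz_power bounded_lipschitz_max0 t)+
  \<comment> \<open>Polynomials in the bumps and in \<open>inverse (norm y)\<close>, to which the
    closure properties apply.\<close>
  have e: "rad0 (y \<bullet> y) = bump (y \<bullet> y) * inverse (norm y)"
    "rad1 (y \<bullet> y) = bump1 (y \<bullet> y) * inverse (norm y) - 1/2 * bump (y \<bullet> y) * inverse (norm y) * inverse (norm y) * inverse (norm y)"
    "rad2 (y \<bullet> y) = bump2 (y \<bullet> y) * inverse (norm y) - bump1 (y \<bullet> y) * inverse (norm y) * inverse (norm y) * inverse (norm y)
       + 3/4 * bump (y \<bullet> y) * inverse (norm y) * inverse (norm y) * inverse (norm y) * inverse (norm y) * inverse (norm y)"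
    for y :: "real^5"
  proof -
    define n where "n = norm y"
    have n: "y \<bullet> y = n * n" "sqrt (n * n) = n" by (simp_all add: n_def dot_square_norm power2_eq_square)
    show "rad0 (y \<bullet> y) = bump (y \<bullet> y) * inverse (norm y)"
      unfolding rad0_def n_def[symmetric] n by (simp only: divide_inverse)
    show "rad1 (y \<bullet> y) = bump1 (y \<bullet> y) * inverse (norm y) - 1/2 * bump (y \<bullet> y) * inverse (norm y) * inverse (norm y) * inverse (norm y)"
      unfolding rad1_def n_def[symmetric] n by (simp only: divide_inverse inverse_mult_distrib mult_1 mult_ac)
    show "rad2 (y \<bullet> y) = bump2 (y \<bullet> y) * inverse (norm y) - bump1 (y \<bullet> y) * inverse (norm y) * inverse (norm y) * inverse (norm y)
       + 3/4 * bump (y \<bullet> y) * inverse (norm y) * inverse (norm y) * inverse (norm y) * inverse (norm y) * inverse (norm y)"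
      unfolding rad2_def n_def[symmetric] n power2_eq_square by (simp only: divide_inverse inverse_mult_distrib mult_1 mult_ac)
  qed
  have r: "bounded_lipschitz ?S (\<lambda>y. rad0 (y \<bullet> y))" "bounded_lipschitz ?S (\<lambda>y. rad1 (y \<bullet> y))" "bounded_lipschitz ?S (\<lambda>y. rad2 (y \<bullet> y))"
    unfolding e
    by (intro bounded_lipschitz_mult bounded_lipschitz_diff bounded_lipschitz_add const bounded_lipschitz_power i b)+
  have j: "bounded_lipschitz ?S (\<lambda>y. jordan y h)" "bounded_lipschitz ?S (\<lambda>y. jordan y y)"
    by (intro bounded_lipschitz_bilinear[OF bounded_bilinear_jordan] id const)+
  have c: "bounded_lipschitz ?S cubic"
    unfolding cubic_def[abs_def] by (intro bounded_lipschitz_inner j id)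
  show ?thesis
    unfolding cap_hess_def
    by (intro bounded_lipschitz_add bounded_lipschitz_scaleR bounded_lipschitz_mult bounded_lipschitz_inner const r j c id)
qed

text \<open>Upgrades estimates for each fixed direction to one estimate linear in
  \<open>norm h\<close>, by expansion in the standard basis.\<close>

lemma bounded_lipschitz_on_basis:
  fixes A :: "real^5 \<Rightarrow> real^5 \<Rightarrow> real^5"
  assumes "\<And>h. bounded_lipschitz S (\<lambda>y. A y h)" "\<And>y. linear (A y)"
  obtains C where "C \<ge> 0" "\<And>y h. y \<in> S \<Longrightarrow> norm (A y h) \<le> C * norm h"
    "\<And>y z h. y \<in> S \<Longrightarrow> z \<in> S \<Longrightarrow> norm (A y h - A z h) \<le> C * norm (y - z) * norm h"
proof -
  have "\<forall>j. \<exists>C\<ge>0. (\<forall>y\<in>S. norm (A y (axis j 1)) \<le> C) \<and> (\<forall>y\<in>S. \<forall>z\<in>S. norm (A y (axis j 1) - A z (axis j 1)) \<le> C * norm (y - z))"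
    using assms(1) unfolding bounded_lipschitz_def by blast
  then obtain C where C: "\<And>j. C j \<ge> 0" "\<And>y j. y \<in> S \<Longrightarrow> norm (A y (axis j 1)) \<le> C j"
    "\<And>j y z. y \<in> S \<Longrightarrow> z \<in> S \<Longrightarrow> norm (A y (axis j 1) - A z (axis j 1)) \<le> C j * norm (y - z)"
    by metis
  have ex: "A y h = (\<Sum>j\<in>UNIV. h$j *\<^sub>R A y (axis j 1))" for y h
    using linear_sum[OF assms(2)[of y], of "\<lambda>j. h$j *\<^sub>R axis j 1" UNIV] basis_expansion[of h]
    by (simp add: linear_scale[OF assms(2)] scalar_mult_eq_scaleR)
  show ?thesis
  proof (rule that[of "\<Sum>j\<in>UNIV. C j"])
    fix y h assume y: "y \<in> S"
    have "norm (A y h) \<le> (\<Sum>j\<in>UNIV. norm (h$j *\<^sub>R A y (axis j 1)))" unfolding ex[of y h] by (rule norm_sum)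
    also have "\<dots> \<le> (\<Sum>j\<in>UNIV. norm h * C j)"
      using C y by (intro sum_mono) (auto intro!: mult_mono simp: component_le_norm_cart)
    finally show "norm (A y h) \<le> sum C UNIV * norm h" by (simp add: sum_distrib_left sum_distrib_right mult.commute)
  next
    fix y z h assume y: "y \<in> S" "z \<in> S"
    have "A y h - A z h = (\<Sum>j\<in>UNIV. h$j *\<^sub>R (A y (axis j 1) - A z (axis j 1)))"
      unfolding ex[of y h] ex[of z h] by (simp add: sum_subtractf scaleR_diff_right)
    then have "norm (A y h - A z h) \<le> (\<Sum>j\<in>UNIV. norm (h$j *\<^sub>R (A y (axis j 1) - A z (axis j 1))))"
      by (simp only: norm_sum)
    also have "\<dots> \<le> (\<Sum>j\<in>UNIV. norm h * (C j * norm (y - z)))"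
      using C y by (intro sum_mono) (auto intro!: mult_mono simp: component_le_norm_cart)
    finally show "norm (A y h - A z h) \<le> sum C UNIV * norm (y - z) * norm h"
      by (simp add: sum_distrib_left sum_distrib_right mult_ac)
  qed (simp add: C sum_nonneg)
qed

lemma cone_hessian_bounded:
  obtains B where "B \<ge> 0" "\<And>y h. \<bar>cone_hessian (sym3 (sgn y)) (sym3 h)\<bar> \<le> B * (norm h)^2"
proof -
  obtain K where K: "K > 0" "\<And>x y. norm (jordan x y) \<le> norm x * norm y * K" using jordan.pos_bounded by blast
  have "\<bar>cone_hessian (sym3 y) (sym3 h)\<bar> \<le> 16 * K * (norm h)^2" if y: "norm y \<le> 1" for y h
  proof -
    have ip: "\<bar>a \<bullet> b\<bar> \<le> A * B" if "norm a \<le> A" "norm b \<le> B" for a b :: "real^5" and A B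
      using that Cauchy_Schwarz_ineq2[of a b] by (smt (verit) mult_mono norm_ge_zero)
    have 1: "norm (jordan y h) \<le> K * norm h" 
    proof -
      have "norm y * (norm h * K) \<le> 1 * (norm h * K)" using y K(1) by (intro mult_right_mono) auto
      then show ?thesis using K(2)[of y h] by (simp only: mult_ac mult_1)
    qed
    have 2: "norm (jordan y y) \<le> K"
    proof -
      have "norm y * norm y * K \<le> 1 * K"
        using K(1) mult_le_one[OF y norm_ge_zero y] by (intro mult_right_mono) auto
      then show ?thesis using K(2)[of y y] by simp
    qed
    have a: "\<bar>jordan y h \<bullet> h\<bar> \<le> K * (norm h)^2" using ip[OF 1 order_refl, of h] by (simp add: power2_eq_square)
    have b: "\<bar>y \<bullet> h\<bar> \<le> norm h" "\<bar>jordan y y \<bullet> h\<bar> \<le> K * norm h" "\<bar>cubic y\<bar> \<le> K"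
      using ip[OF y order_refl, of h] ip[OF 2 order_refl, of h] ip[OF 2 y] by (auto simp: cubic_def)
    have c: "\<bar>(y \<bullet> h) * (jordan y y \<bullet> h)\<bar> \<le> K * (norm h)^2"
      using mult_mono[OF b(1,2)] by (simp add: abs_mult power2_eq_square mult_ac)
    have d: "\<bar>cubic y * (h \<bullet> h)\<bar> \<le> K * (norm h)^2"
      using mult_right_mono[OF b(3), of "h \<bullet> h"] by (simp add: abs_mult dot_square_norm)
    have "(y \<bullet> h)^2 \<le> (norm h)^2" using b(1) by (metis abs_norm_cancel power2_le_iff_abs_le power2_abs norm_ge_zero abs_le_square_iff)
    then have e: "\<bar>cubic y * (y \<bullet> h)^2\<bar> \<le> K * (norm h)^2"
      using mult_mono[OF b(3), of "(y \<bullet> h)^2" "(norm h)^2"] K(1) by (simp add: abs_mult)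
    have "cone_hessian (sym3 y) (sym3 h) = 6 * (jordan y h \<bullet> h) - 6 * ((y \<bullet> h) * (jordan y y \<bullet> h)) - cubic y * (h \<bullet> h)
        + 3 * (cubic y * (y \<bullet> h)^2)" by (simp add: cone_hessian_sym3)
    then show ?thesis using a c d e by linarith
  qed
  then show ?thesis using that[of "16 * K"] K(1) by (simp add: norm_sgn)
qed

text \<open>Two points not both in the inner half ball: the Hessian of the cap is Lipschitz there although
  it is discontinuous at the origin.\<close>

lemma cap_hess_lipschitz:
  obtains C where "C \<ge> 0" "\<And>y z h. \<not> (norm y < 1/2 \<and> norm z < 1/2) \<Longrightarrow>
    \<bar>cap_hess y h \<bullet> h - cap_hess z h \<bullet> h\<bar> \<le> C * norm (y - z) * (norm h)^2"
proof -
  define S where "S = {y::real^5. 1/4 \<le> norm y \<and> norm y \<le> 2}"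
  obtain C where C: "C \<ge> 0" "\<And>y h. y \<in> S \<Longrightarrow> norm (cap_hess y h) \<le> C * norm h"
    "\<And>y z h. y \<in> S \<Longrightarrow> z \<in> S \<Longrightarrow> norm (cap_hess y h - cap_hess z h) \<le> C * norm (y - z) * norm h"
    using bounded_lipschitz_on_basis[of S cap_hess] bounded_lipschitz_cap_hess[folded S_def] linear_cap_hess by metis
  obtain B where B: "B \<ge> 0" "\<And>y h. \<bar>cone_hessian (sym3 (sgn y)) (sym3 h)\<bar> \<le> B * (norm h)^2"
    using cone_hessian_bounded by blast
  have bd: "\<bar>cap_hess y h \<bullet> h\<bar> \<le> (B + C) * (norm h)^2" for y h
  proof -
    consider "norm y \<le> 1/2" | "y \<in> S" | "norm y \<ge> 1" unfolding S_def by fastforce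
    then have "\<bar>cap_hess y h \<bullet> h\<bar> \<le> B * (norm h)^2 \<or> \<bar>cap_hess y h \<bullet> h\<bar> \<le> C * (norm h)^2"
    proof cases
      case 1 then show ?thesis using B by (simp add: cap_hess_small)
    next
      case 2
      have "\<bar>cap_hess y h \<bullet> h\<bar> \<le> norm (cap_hess y h) * norm h" by (rule Cauchy_Schwarz_ineq2)
      also have "\<dots> \<le> C * norm h * norm h" using C(2)[OF 2] by (intro mult_right_mono) auto
      finally show ?thesis by (simp add: power2_eq_square mult_ac)
    next
      case 3 then show ?thesis using C by (simp add: cap_zero)
    qed
    moreover have "B * (norm h)^2 \<le> (B + C) * (norm h)^2" "C * (norm h)^2 \<le> (B + C) * (norm h)^2"
      using B(1) C(1) by (auto intro: mult_right_mono)
    ultimately show ?thesis by linarith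
  qed
  \<comment> \<open>Distant points need only boundedness: the oscillation is at most
    \<open>2 (B + C)\<close>, and \<open>norm (y - z)\<close> is at least 1/4.\<close>
  have far: "\<bar>cap_hess y h \<bullet> h - cap_hess z h \<bullet> h\<bar> \<le> 8 * (B + C) * norm (y - z) * (norm h)^2"
    if "1/4 \<le> norm (y - z)" for y z h
  proof -
    have "\<bar>cap_hess y h \<bullet> h - cap_hess z h \<bullet> h\<bar> \<le> 2 * ((B + C) * (norm h)^2)" using bd[of y h] bd[of z h] by linarith
    also have "\<dots> = 8 * ((B + C) * (norm h)^2) * (1/4)" by simp
    also have "\<dots> \<le> 8 * ((B + C) * (norm h)^2) * norm (y - z)" using that B(1) C(1) by (intro mult_left_mono) auto
    finally show ?thesis by (simp add: algebra_simps)
  qed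
  have near: "\<bar>cap_hess y h \<bullet> h - cap_hess z h \<bullet> h\<bar> \<le> C * norm (y - z) * (norm h)^2" if "y \<in> S" "z \<in> S" for y z h
  proof -
    have "\<bar>cap_hess y h \<bullet> h - cap_hess z h \<bullet> h\<bar> \<le> norm (cap_hess y h - cap_hess z h) * norm h"
      unfolding inner_diff_left[symmetric] by (rule Cauchy_Schwarz_ineq2)
    also have "\<dots> \<le> C * norm (y - z) * norm h * norm h" using C(3)[OF that] by (intro mult_right_mono) auto
    finally show ?thesis by (simp add: power2_eq_square mult_ac)
  qed
  show ?thesis
  proof (rule that[of "8 * (B + C)"])
    fix y z :: "real^5" and h assume nb: "\<not> (norm y < 1/2 \<and> norm z < 1/2)"
    \<comment> \<open>If the points are closer than 1/4 and one has norm at least 1/2, both have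
      norm at least 1/4. Either both are in the annulus, or one has norm above 2 and then both lie
      where the cap vanishes.\<close>
    consider "1/4 \<le> norm (y - z)" | "norm y \<ge> 1" "norm z \<ge> 1" | "y \<in> S" "z \<in> S"
      using nb norm_triangle_ineq3[of y z] unfolding S_def by fastforce
    then show "\<bar>cap_hess y h \<bullet> h - cap_hess z h \<bullet> h\<bar> \<le> 8 * (B + C) * norm (y - z) * (norm h)^2"
    proof cases
      case 1 then show ?thesis by (rule far)
    next
      case 2 then show ?thesis using B(1) C(1) by (simp add: cap_zero)
    next
      case 3
      have "C * norm (y - z) * (norm h)^2 \<le> 8 * (B + C) * norm (y - z) * (norm h)^2"
        using B(1) C(1) by (intro mult_right_mono) auto
      then show ?thesis using near[OF 3, of h] by linarith
    qed
  qed (use B(1) C(1) in auto)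
qed

subsection \<open>Ellipticity of a family of caps\<close>

text \<open>The extreme test direction has squared norm 2 and value \<open>-a\<close>, and
  \<open>a \<ge> 2/5\<close> follows from \<open>a^2 \<ge> 1/6\<close>; normalizing leaves
  1/5.\<close>

lemma jordan_negative_direction:
  obtains z where "norm z = 1" "jordan x z \<bullet> z \<le> - norm x / 5"
proof (cases "x = 0")
  case True
  then show ?thesis using that[of "axis 1 1"] by (simp add: jordan.zero_left)
next
  case False
  define X where "X = sym3 (sgn x)"
  have u: "trace (X ** X) = 1" using False by (simp add: X_def trace_mult_sym3 dot_square_norm norm_sgn)
  obtain Q a b c where Q: "orthogonal_matrix Q" "X = Q ** diag3 a b c ** transpose Q" "unit_triple a b c"
    using unit_diagonalization[OF sym_traceless_sym3[of "sgn x", folded X_def] u] by metis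
  obtain Z where Z: "sym_traceless Z" "trace (Z ** Z) = 2" "trace (X ** Z ** Z) = - a"
    using extreme_test_direction[OF Q] by metis
  have "(2/5)^2 \<le> a^2" using unit_triple_bounds[OF Q(3)] by (simp add: power2_eq_square)
  then have a: "2/5 \<le> a" using unit_triple_bounds[OF Q(3)] by (intro power2_le_imp_le[of "2/5" a]) auto
  define z where "z = desym Z"
  have zZ: "sym3 z = Z" unfolding z_def by (rule sym3_desym[OF Z(1)])
  have zz: "z \<bullet> z = 2" using zZ trace_mult_sym3[of z z] Z(2) by simp
  have j: "jordan (sgn x) z \<bullet> z = - a" using Z(3) by (simp add: jordan_inner_diag zZ[symmetric] X_def)
  define w where "w = (1 / sqrt 2) *\<^sub>R z"
  have "norm w = 1" using zz by (simp add: w_def norm_eq_sqrt_inner)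
  moreover have "jordan x w \<bullet> w = norm x * (jordan (sgn x) z \<bullet> z) / 2"
    using False by (simp add: w_def sgn_div_norm jordan.scaleR_left jordan.scaleR_right)
  then have "jordan x w \<bullet> w \<le> - norm x / 5"
    using a mult_left_mono[OF a, of "norm x"] by (simp add: j)
  ultimately show ?thesis using that by blast
qed

lemma suminf_single:
  fixes f :: "nat \<Rightarrow> 'a::real_normed_vector"
  assumes "\<And>j. j \<noteq> k \<Longrightarrow> f j = 0"
  shows "suminf f = f k"
  using suminf_finite[of "{k}" f] assms by auto

locale cap_family =
  fixes eps :: real and ctr :: "nat \<Rightarrow> real^5" and rho :: "nat \<Rightarrow> real"
  assumes eps_pos: "0 < eps" and rho_pos: "0 < rho k"
    and disjoint: "j \<noteq> k \<Longrightarrow> rho j + rho k \<le> dist (ctr j) (ctr k)"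
begin

definition rescale :: "nat \<Rightarrow> real^5 \<Rightarrow> real^5" where "rescale k z = (z - ctr k) /\<^sub>R rho k"

text \<open>Two derivatives of \<open>eps * rho k ^ 3 * cap (rescale k z)\<close>: each one costs a
  factor \<open>rho k\<close>, so a single power remains.\<close>

definition cap_hess_at :: "nat \<Rightarrow> real^5 \<Rightarrow> real^5 \<Rightarrow> real^5" where
  "cap_hess_at k z h = (eps * rho k) *\<^sub>R cap_hess (rescale k z) h"

definition profile_hess :: "real^5 \<Rightarrow> real^5 \<Rightarrow> real^5" where
  "profile_hess z h = 6 *\<^sub>R jordan z h + (\<Sum>k. cap_hess_at k z h)"

lemma norm_rescale: "norm (rescale k z) = dist z (ctr k) / rho k"
  using rho_pos[of k] by (simp add: rescale_def dist_norm divide_inverse mult.commute)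

lemma norm_rescale_lt: "norm (rescale k z) < 1 \<longleftrightarrow> z \<in> ball (ctr k) (rho k)"
  using rho_pos[of k] by (simp add: norm_rescale dist_commute)

lemma in_ball_unique: "z \<in> ball (ctr j) (rho j) \<Longrightarrow> z \<in> ball (ctr k) (rho k) \<Longrightarrow> j = k"
  using disjoint[of j k] dist_triangle2[of "ctr j" "ctr k" z] by (fastforce simp: dist_commute)

lemma cap_hess_at_outside: "z \<notin> ball (ctr k) (rho k) \<Longrightarrow> cap_hess_at k z h = 0"
  using norm_rescale_lt[of k z] by (simp add: cap_hess_at_def cap_zero)

lemma suminf_cap_hess_at:
  "(\<And>j. j \<noteq> k \<Longrightarrow> z \<notin> ball (ctr j) (rho j)) \<Longrightarrow> (\<Sum>k. cap_hess_at k z h) = cap_hess_at k z h"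
  by (rule suminf_single) (simp add: cap_hess_at_outside)

text \<open>The index is arbitrary when \<open>z\<close> lies in no ball, so a sum over all caps can
  be treated as a single term in every case.\<close>

lemma ball_index:
  obtains k where "\<And>j. j \<noteq> k \<Longrightarrow> z \<notin> ball (ctr j) (rho j)"
  using in_ball_unique by metis

text \<open>The factor \<open>rho k\<close> cancels the \<open>1 / rho k\<close> of the rescaling,
  so one Lipschitz constant serves caps of all sizes.\<close>

lemma cap_hess_at_diff:
  assumes C: "0 \<le> C" "\<And>y z h. \<not> (norm y < 1/2 \<and> norm z < 1/2) \<Longrightarrow>
      \<bar>cap_hess y h \<bullet> h - cap_hess z h \<bullet> h\<bar> \<le> C * norm (y - z) * (norm h)^2"
    and "\<not> (norm (rescale k x) < 1/2 \<and> norm (rescale k y) < 1/2)"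
  shows "\<bar>cap_hess_at k x h \<bullet> h - cap_hess_at k y h \<bullet> h\<bar> \<le> eps * C * norm (x - y) * (norm h)^2"
proof -
  have "\<bar>cap_hess_at k x h \<bullet> h - cap_hess_at k y h \<bullet> h\<bar> = eps * rho k * \<bar>cap_hess (rescale k x) h \<bullet> h - cap_hess (rescale k y) h \<bullet> h\<bar>"
    using eps_pos rho_pos[of k] by (simp add: cap_hess_at_def abs_mult right_diff_distrib[symmetric])
  also have "\<dots> \<le> eps * rho k * (C * norm (rescale k x - rescale k y) * (norm h)^2)"
    using C(2)[OF assms(3)] eps_pos rho_pos[of k] by (intro mult_left_mono) auto
  also have "rescale k x - rescale k y = (x - y) /\<^sub>R rho k"
    by (simp add: rescale_def scaleR_diff_right[symmetric])
  also have "eps * rho k * (C * norm ((x - y) /\<^sub>R rho k) * (norm h)^2) = eps * C * norm (x - y) * (norm h)^2"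
    using rho_pos[of k] by simp
  finally show ?thesis .
qed

lemma profile_hess_inner_half_ball:
  assumes "norm (rescale k z) < 1/2"
  shows "profile_hess z h \<bullet> h = 6 * (jordan (ctr k) h \<bullet> h) + model_hessian (eps * rho k) (z - ctr k) h"
proof -
  have "z \<in> ball (ctr k) (rho k)" using assms norm_rescale_lt[of k z] by simp
  then have "(\<Sum>k. cap_hess_at k z h) = cap_hess_at k z h"
    using in_ball_unique by (intro suminf_cap_hess_at) blast
  moreover have "cap_hess (rescale k z) h \<bullet> h = cone_hessian (sym3 (sgn (z - ctr k))) (sym3 h)"
    using assms rho_pos[of k] by (subst cap_hess_small) (auto simp: rescale_def sgn_scaleR)
  moreover have "jordan z h = jordan (ctr k) h + jordan (z - ctr k) h"
    by (simp add: jordan.add_left[symmetric])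
  ultimately show ?thesis
    by (simp add: profile_hess_def inner_left_distrib cap_hess_at_def model_hessian_def algebra_simps)
qed

lemma sum_axis_model_hessian:
  "(\<Sum>j\<in>UNIV. model_hessian c x (axis j 1)) = - 8 * c * cubic (sgn x)"
proof (cases "x = 0")
  case True
  have "model_hessian c 0 z = 0" for z using model_hessian_uminus[of c 0 z] by simp
  then show ?thesis using True by (simp add: cubic_def)
next
  case False
  then show ?thesis
    using sum_axis_cone_hessian[of "sgn x"] sum_axis_jordan[of x]
    by (simp add: model_hessian_def sum.distrib sum_distrib_left[symmetric] norm_sgn)
qed

text \<open>Outside a common half ball the linear part coming from \<open>cubic\<close> dominates:
  it is traceless and at most \<open>- 6/5 * d\<close> in some unit direction. The caps perturb the
  form by at most \<open>1/2 * d\<close>, so 16 times \<open>- 7/10 * d\<close> outweighs the trace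
  error \<open>5/2 * d\<close>.\<close>

lemma profile_hess_pair:
  assumes C: "0 \<le> C" "\<And>y z h. \<not> (norm y < 1/2 \<and> norm z < 1/2) \<Longrightarrow>
      \<bar>cap_hess y h \<bullet> h - cap_hess z h \<bullet> h\<bar> \<le> C * norm (y - z) * (norm h)^2"
    and small: "eps * C \<le> 1/4"
  shows "\<exists>z. norm z \<le> 1 \<and> (\<Sum>j\<in>UNIV. profile_hess x (axis j 1) \<bullet> axis j 1 - profile_hess y (axis j 1) \<bullet> axis j 1)
     + 16 * (profile_hess x z \<bullet> z - profile_hess y z \<bullet> z) \<le> 0"
proof (cases "\<exists>k. norm (rescale k x) < 1/2 \<and> norm (rescale k y) < 1/2")
  case True
  then obtain k where k: "norm (rescale k x) < 1/2" "norm (rescale k y) < 1/2" by blast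
  define c where "c = eps * rho k"
  have c: "c > 0" using eps_pos rho_pos[of k] by (simp add: c_def)
  obtain z where z: "norm z \<le> 1" "8 * c * (cubic (sgn (y - ctr k)) - cubic (sgn (x - ctr k)))
      + 16 * (model_hessian c (x - ctr k) z - model_hessian c (y - ctr k) z) \<le> 0"
    using model_hessian_pair[OF c] by blast
  have "(\<Sum>j\<in>UNIV. profile_hess x (axis j 1) \<bullet> axis j 1 - profile_hess y (axis j 1) \<bullet> axis j 1)
    = (\<Sum>j\<in>UNIV. model_hessian c (x - ctr k) (axis j 1)) - (\<Sum>j\<in>UNIV. model_hessian c (y - ctr k) (axis j 1))"
    by (simp only: profile_hess_inner_half_ball[OF k(1)] profile_hess_inner_half_ball[OF k(2)] c_def[symmetric]
        add_diff_cancel_left sum_subtractf)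
  also have "\<dots> = 8 * c * (cubic (sgn (y - ctr k)) - cubic (sgn (x - ctr k)))"
    unfolding sum_axis_model_hessian by (simp add: algebra_simps)
  finally show ?thesis using z
    by (intro exI[of _ z]) (simp only: profile_hess_inner_half_ball[OF k(1)] profile_hess_inner_half_ball[OF k(2)] c_def[symmetric]
        add_diff_cancel_left)
next
  case False
  define d where "d = norm (x - y)"
  have bd: "\<bar>(profile_hess x h \<bullet> h - profile_hess y h \<bullet> h) - 6 * (jordan (x - y) h \<bullet> h)\<bar> \<le> 1/2 * d * (norm h)^2" for h
  proof -
    obtain k where k: "\<And>j. j \<noteq> k \<Longrightarrow> x \<notin> ball (ctr j) (rho j)" using ball_index by metis
    obtain l where l: "\<And>j. j \<noteq> l \<Longrightarrow> y \<notin> ball (ctr j) (rho j)" using ball_index by metis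
    have each: "\<bar>cap_hess_at j x h \<bullet> h - cap_hess_at j y h \<bullet> h\<bar> \<le> 1/4 * d * (norm h)^2" for j
    proof -
      have "\<bar>cap_hess_at j x h \<bullet> h - cap_hess_at j y h \<bullet> h\<bar> \<le> eps * C * norm (x - y) * (norm h)^2"
        using False by (intro cap_hess_at_diff[OF C]) auto
      also have "\<dots> \<le> 1/4 * d * (norm h)^2" unfolding d_def using small by (intro mult_right_mono) auto
      finally show ?thesis .
    qed
    have dec: "(profile_hess x h \<bullet> h - profile_hess y h \<bullet> h) - 6 * (jordan (x - y) h \<bullet> h)
       = cap_hess_at k x h \<bullet> h - cap_hess_at l y h \<bullet> h"
    proof -
      have "(\<Sum>k. cap_hess_at k x h) = cap_hess_at k x h" "(\<Sum>k. cap_hess_at k y h) = cap_hess_at l y h"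
        using k l by (auto intro!: suminf_cap_hess_at)
      then show ?thesis
        by (simp add: profile_hess_def jordan.diff_left inner_left_distrib inner_diff_left)
    qed
    show ?thesis
    proof (cases "k = l")
      case True
      have "0 \<le> 1/4 * d * (norm h)^2" unfolding d_def by simp
      then show ?thesis unfolding dec True using each[of l] by linarith
    next
      case False
      \<comment> \<open>The two active caps differ, and each vanishes at the other point; its value
        is therefore its own difference, bounded by \<open>1/4 * d\<close>.\<close>
      have "cap_hess_at k y h = 0" "cap_hess_at l x h = 0"
        using False k l by (auto intro: cap_hess_at_outside)
      then have "\<bar>cap_hess_at k x h \<bullet> h\<bar> \<le> 1/4 * d * (norm h)^2" "\<bar>cap_hess_at l y h \<bullet> h\<bar> \<le> 1/4 * d * (norm h)^2"
        using each[of l] each[of k] by simp_all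
      then show ?thesis unfolding dec by linarith
    qed
  qed
  obtain z where z: "norm z = 1" "jordan (x - y) z \<bullet> z \<le> - norm (x - y) / 5"
    using jordan_negative_direction by blast
  have "profile_hess x z \<bullet> z - profile_hess y z \<bullet> z \<le> - (6/5) * d + 1/2 * d"
  proof -
    have "\<bar>(profile_hess x z \<bullet> z - profile_hess y z \<bullet> z) - 6 * (jordan (x - y) z \<bullet> z)\<bar> \<le> 1/2 * d"
      using bd[of z] z(1) by simp
    then show ?thesis using z(2) unfolding d_def by linarith
  qed
  moreover have "(\<Sum>j\<in>UNIV. profile_hess x (axis j 1) \<bullet> axis j 1 - profile_hess y (axis j 1) \<bullet> axis j 1)
     \<le> (\<Sum>j\<in>(UNIV::5 set). 6 * (jordan (x - y) (axis j 1) \<bullet> axis j 1) + 1/2 * d)"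
  proof (intro sum_mono)
    fix j :: 5
    have "norm (axis j (1::real)) = 1" by simp
    then show "profile_hess x (axis j 1) \<bullet> axis j 1 - profile_hess y (axis j 1) \<bullet> axis j 1
      \<le> 6 * (jordan (x - y) (axis j 1) \<bullet> axis j 1) + 1/2 * d"
      using bd[of "axis j 1"] by (simp only: power_one mult_1_right)
  qed
  then have "(\<Sum>j\<in>UNIV. profile_hess x (axis j 1) \<bullet> axis j 1 - profile_hess y (axis j 1) \<bullet> axis j 1) \<le> 5/2 * d"
    by (simp add: sum.distrib sum_distrib_left[symmetric] sum_axis_jordan)
  moreover have "d \<ge> 0" by (simp add: d_def)
  ultimately show ?thesis using z(1) by (intro exI[of _ z]) simp
qed

end

subsection \<open>Second differences and enveloping operators\<close>

text \<open>The gradient is differentiable only at the point \<open>z\<close> itself, so the mean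
  value theorem is applied to \<open>p\<close>, the symmetric sum minus its expected quadratic part,
  and differentiability of \<open>g\<close> is used once, at the intermediate point.\<close>

lemma second_difference_tendsto:
  fixes f :: "'a::real_inner \<Rightarrow> real"
  assumes U: "open U" "z \<in> U" and f: "\<And>y. y \<in> U \<Longrightarrow> (f has_derivative (\<lambda>h. g y \<bullet> h)) (at y)"
    and g: "(g has_derivative G) (at z)"
  shows "((\<lambda>t. (f (z + t *\<^sub>R h) + f (z - t *\<^sub>R h) - 2 * f z) / t^2) \<longlongrightarrow> G h \<bullet> h) (at_right 0)"
proof (rule tendstoI)
  fix e :: real assume e: "e > 0"
  interpret G: bounded_linear G using g by (rule has_derivative_bounded_linear)
  define n where "n = norm h"
  \<comment> \<open>The constant absorbs two remainders, each paired with \<open>h\<close>; the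
    \<open>+ 1\<close> here and in \<open>d\<close> covers \<open>h = 0\<close>.\<close>
  define e' where "e' = e / (4 * (n^2 + 1))"
  have e': "e' > 0" using e by (auto simp: e'_def intro!: divide_pos_pos mult_pos_pos add_nonneg_pos)
  obtain d1 where d1: "d1 > 0" "\<And>y. norm (y - z) < d1 \<Longrightarrow> norm (g y - g z - G (y - z)) \<le> e' * norm (y - z)"
    using g e' unfolding has_derivative_at_alt by metis
  obtain d2 where d2: "d2 > 0" "\<And>y. norm (y - z) < d2 \<Longrightarrow> y \<in> U"
    using U unfolding open_dist by (metis dist_norm)
  define d where "d = min d1 d2 / (n + 1)"
  have n0: "n \<ge> 0" by (simp add: n_def)
  have d: "d > 0" using d1 d2 n0 by (simp add: d_def)
  have dn: "s * n < d1" "s * n < d2" if "0 \<le> s" "s < d" for s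
  proof -
    have "s * n \<le> s * (n + 1)" using that by (intro mult_left_mono) auto
    also have "\<dots> < min d1 d2" using that n0 by (simp add: d_def pos_less_divide_eq)
    finally show "s * n < d1" "s * n < d2" by auto
  qed
  have key: "\<bar>(f (z + t *\<^sub>R h) + f (z - t *\<^sub>R h) - 2 * f z) / t^2 - G h \<bullet> h\<bar> < e" if t: "0 < t" "t < d" for t
  proof -
    define p where "p = (\<lambda>s. f (z + s *\<^sub>R h) + f (z + (- s) *\<^sub>R h) - s^2 * (G h \<bullet> h))"
    have dp: "(p has_real_derivative (g (z + s *\<^sub>R h) \<bullet> h - g (z + (- s) *\<^sub>R h) \<bullet> h - 2 * s * (G h \<bullet> h))) (at s)"
      if s: "0 \<le> s" "s < d" for s
    proof -
      have in1: "z + s *\<^sub>R h \<in> U" "z + (- s) *\<^sub>R h \<in> U"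
        using d2(2) dn[OF s] s by (auto simp: n_def)
      have l1: "((\<lambda>s. z + s *\<^sub>R h) has_derivative (\<lambda>r. r *\<^sub>R h)) (at s)"
        by (auto intro!: derivative_eq_intros)
      have l2: "((\<lambda>s. z + (- s) *\<^sub>R h) has_derivative (\<lambda>r. (- r) *\<^sub>R h)) (at s)"
        by (auto intro!: derivative_eq_intros)
      have 1: "((\<lambda>s. f (z + s *\<^sub>R h)) has_real_derivative g (z + s *\<^sub>R h) \<bullet> h) (at s)"
        using has_derivative_compose[OF l1 f[OF in1(1)]]
        by (simp add: has_field_derivative_def mult.commute[of _ "_ \<bullet> _"])
      have 2: "((\<lambda>s. f (z + (- s) *\<^sub>R h)) has_real_derivative - (g (z + (- s) *\<^sub>R h) \<bullet> h)) (at s)"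
        unfolding has_field_derivative_def
        by (rule has_derivative_eq_rhs[OF has_derivative_compose[OF l2 f[OF in1(2)]]]) (simp add: fun_eq_iff)
      show ?thesis unfolding p_def
        by (rule DERIV_cong, rule DERIV_diff[OF DERIV_add[OF 1 2] DERIV_cmult_right[OF DERIV_power[OF DERIV_ident]]]) simp
    qed
    obtain s where s: "0 < s" "s < t" "p t - p 0 = (t - 0) * (g (z + s *\<^sub>R h) \<bullet> h - g (z + (- s) *\<^sub>R h) \<bullet> h - 2 * s * (G h \<bullet> h))"
      using MVT2[OF t(1), of p "\<lambda>s. g (z + s *\<^sub>R h) \<bullet> h - g (z + (- s) *\<^sub>R h) \<bullet> h - 2 * s * (G h \<bullet> h)"] dp t by auto
    have sd: "0 \<le> s" "s < d" using s t by auto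
    define r1 where "r1 = g (z + s *\<^sub>R h) - g z - G (s *\<^sub>R h)"
    define r2 where "r2 = g (z + (- s) *\<^sub>R h) - g z - G ((- s) *\<^sub>R h)"
    have r: "norm r1 \<le> e' * (s * n)" "norm r2 \<le> e' * (s * n)"
      using d1(2)[of "z + s *\<^sub>R h"] d1(2)[of "z + (- s) *\<^sub>R h"] dn[OF sd] sd
      by (auto simp: r1_def r2_def n_def)
    have "g (z + s *\<^sub>R h) \<bullet> h - g (z + (- s) *\<^sub>R h) \<bullet> h - 2 * s * (G h \<bullet> h) = (r1 - r2) \<bullet> h"
      unfolding r1_def r2_def G.scaleR by (simp add: inner_diff_left algebra_simps)
    then have "\<bar>p t - p 0\<bar> = t * \<bar>(r1 - r2) \<bullet> h\<bar>" using s t by (simp add: abs_mult)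
    also have "\<bar>(r1 - r2) \<bullet> h\<bar> \<le> norm (r1 - r2) * n" unfolding n_def by (rule Cauchy_Schwarz_ineq2)
    also have "norm (r1 - r2) \<le> 2 * (e' * (s * n))" using norm_triangle_ineq4[of r1 r2] r by linarith
    also have "2 * (e' * (s * n)) * n \<le> 2 * (e' * (t * n)) * n"
      using s n0 e' by (intro mult_right_mono mult_left_mono) auto
    finally have "\<bar>p t - p 0\<bar> \<le> t * (2 * (e' * (t * n)) * n)" using t n0 by (simp add: mult_left_mono mult_right_mono)
    also have "\<dots> = t^2 * (2 * e' * n^2)" by (simp add: power2_eq_square)
    also have "\<dots> < t^2 * e"
    proof (rule mult_strict_left_mono)
      have "2 * e' * n^2 \<le> 2 * e' * (n^2 + 1)" using e' by (intro mult_left_mono) auto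
      also have "2 * e' * (n^2 + 1) = e / 2"
      proof -
        have "n^2 + 1 \<noteq> 0" by (metis add_nonneg_eq_0_iff zero_le_power2 zero_le_one zero_neq_one)
        then show ?thesis by (simp add: e'_def field_simps)
      qed
      finally show "2 * e' * n^2 < e" using e by simp
    qed (use t in auto)
    finally have "\<bar>p t - p 0\<bar> < t^2 * e" .
    moreover have "p t - p 0 = t^2 * ((f (z + t *\<^sub>R h) + f (z - t *\<^sub>R h) - 2 * f z) / t^2 - G h \<bullet> h)"
    proof -
      have "t^2 * (q / t^2 - c) = q - t^2 * c" for q c :: real using t by (simp add: right_diff_distrib)
      then show ?thesis by (simp add: p_def)
    qed
    ultimately show ?thesis using t by (simp add: abs_mult)
  qed
  show "\<forall>\<^sub>F t in at_right 0. dist ((f (z + t *\<^sub>R h) + f (z - t *\<^sub>R h) - 2 * f z) / t^2) (G h \<bullet> h) < e"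
    unfolding eventually_at_right_field dist_real_def using key d by auto
qed

section \<open>Gradients, Hessians and touching\<close>

lemma gradient_inner:
  fixes f :: "real^'n::finite \<Rightarrow> real"
  assumes "f differentiable at x"
  shows "(f has_derivative (\<lambda>h. gradient f x \<bullet> h)) (at x)"
proof -
  have d: "(f has_derivative frechet_derivative f (at x)) (at x)" using assms frechet_derivative_works by blast
  then interpret L: bounded_linear "frechet_derivative f (at x)" by (rule has_derivative_bounded_linear)
  have "frechet_derivative f (at x) h = gradient f x \<bullet> h" for h
  proof -
    have "frechet_derivative f (at x) h = frechet_derivative f (at x) (\<Sum>i\<in>UNIV. h$i *\<^sub>R axis i 1)"
      using basis_expansion[of h] by (simp add: scalar_mult_eq_scaleR)
    also have "\<dots> = (\<Sum>i\<in>UNIV. h$i * frechet_derivative f (at x) (axis i 1))" by (simp add: L.sum L.scaleR)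
    finally show ?thesis by (simp add: gradient_def inner_vec_def mult.commute)
  qed
  then have "frechet_derivative f (at x) = (\<lambda>h. gradient f x \<bullet> h)" by auto
  with d show ?thesis by simp
qed

lemma gradient_eq:
  fixes f :: "real^'n::finite \<Rightarrow> real"
  assumes "(f has_derivative (\<lambda>h. g \<bullet> h)) (at x)"
  shows "gradient f x = g"
  unfolding gradient_def frechet_derivative_at[OF assms, symmetric] by (simp add: vec_eq_iff inner_axis)

lemma has_derivative_gradient:
  fixes f :: "real^'n::finite \<Rightarrow> real"
  assumes "gradient f differentiable at x"
  shows "(gradient f has_derivative (\<lambda>h. hessian f x *v h)) (at x)"
proof -
  have d: "(gradient f has_derivative frechet_derivative (gradient f) (at x)) (at x)"
    using assms frechet_derivative_works by blast
  then have "linear (frechet_derivative (gradient f) (at x))" by (rule has_derivative_linear)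
  then have "hessian f x *v h = frechet_derivative (gradient f) (at x) h" for h
    by (simp add: hessian_def matrix_works)
  with d show ?thesis by simp
qed

lemma hessian_eq:
  fixes f :: "real^'n::finite \<Rightarrow> real"
  assumes "open U" "x \<in> U" "\<And>y. y \<in> U \<Longrightarrow> (f has_derivative (\<lambda>h. g y \<bullet> h)) (at y)" "(g has_derivative G) (at x)"
  shows "hessian f x = matrix G" "gradient f differentiable at x"
proof -
  have "(gradient f has_derivative G) (at x)"
    by (rule has_derivative_transform_within_open[OF assms(4) assms(1,2)]) (simp add: gradient_eq[OF assms(3)])
  then show "hessian f x = matrix G" "gradient f differentiable at x"
    using frechet_derivative_at by (fastforce simp: hessian_def differentiable_def)+
qed

lemma C2_near_second_difference:
  assumes "C2_near x \<phi>"
  shows "((\<lambda>t. (\<phi> (x + t *\<^sub>R h) + \<phi> (x - t *\<^sub>R h) - 2 * \<phi> x) / t^2) \<longlongrightarrow> h \<bullet> (hessian \<phi> x *v h)) (at_right 0)"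
proof -
  obtain U where U: "open U" "x \<in> U" "\<phi> differentiable_on U" "gradient \<phi> differentiable_on U"
    using assms unfolding C2_near_def C2_on_def by blast
  have "\<phi> differentiable at y" "gradient \<phi> differentiable at y" if "y \<in> U" for y
    using U that by (auto simp: differentiable_on_def at_within_open[OF that U(1)])
  then show ?thesis
    using second_difference_tendsto[OF U(1,2) gradient_inner has_derivative_gradient, of \<phi> h] U(2)
    by (simp add: inner_commute)
qed

text \<open>A substitute for the Hessian that sees only symmetric differences along lines. It is
  available at the apexes and on the accumulation set, and it is enough for comparison with a test
  function.\<close>

definition has_second_difference :: "(real^'n::finite \<Rightarrow> real) \<Rightarrow> real^'n \<Rightarrow> real^'n^'n \<Rightarrow> bool" where
  "has_second_difference u x A \<longleftrightarrow>
    (\<forall>h. ((\<lambda>t. (u (x + t *\<^sub>R h) + u (x - t *\<^sub>R h) - 2 * u x) / t^2) \<longlongrightarrow> h \<bullet> (A *v h)) (at_right 0))"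

text \<open>\<open>v - u\<close> is nonnegative near \<open>x\<close> and vanishes at
  \<open>x\<close>, so its symmetric second differences are nonnegative.\<close>

lemma touching_second_difference:
  assumes ev: "\<forall>\<^sub>F y in nhds x. u y \<le> v y" and eq: "v x = u x"
    and u: "has_second_difference u x A" and v: "has_second_difference v x B"
  shows "h \<bullet> (A *v h) \<le> h \<bullet> (B *v h)"
proof -
  have lim: "((\<lambda>t. x + t *\<^sub>R h) \<longlongrightarrow> x) (at_right 0)" "((\<lambda>t. x - t *\<^sub>R h) \<longlongrightarrow> x) (at_right 0)"
    by (rule tendsto_eq_intros refl | simp)+
  have "\<forall>\<^sub>F t in at_right 0. u (x + t *\<^sub>R h) \<le> v (x + t *\<^sub>R h)"
    using filterlim_iff[THEN iffD1, OF lim(1)] ev by blast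
  moreover have "\<forall>\<^sub>F t in at_right 0. u (x - t *\<^sub>R h) \<le> v (x - t *\<^sub>R h)"
    using filterlim_iff[THEN iffD1, OF lim(2)] ev by blast
  ultimately have le: "\<forall>\<^sub>F t in at_right 0. (u (x + t *\<^sub>R h) + u (x - t *\<^sub>R h) - 2 * u x) / t^2
      \<le> (v (x + t *\<^sub>R h) + v (x - t *\<^sub>R h) - 2 * v x) / t^2"
    by eventually_elim (simp add: eq divide_right_mono)
  then show ?thesis
    using u v unfolding has_second_difference_def by (intro tendsto_le[OF _ _ _ le]) auto
qed

text \<open>Any family of matrices whose differences are far from semidefinite is contained in the zero
  set of a uniformly elliptic operator. For \<open>e\<close> in the unit ball, \<open>trace N + K (e \<bullet> N e)\<close> is the
  linear elliptic operator with coefficient matrix \<open>I + K e e\<^sup>T\<close>.\<close>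

definition elliptic_form :: "real \<Rightarrow> real^'n::finite^'n \<Rightarrow> real^'n \<Rightarrow> real" where
  "elliptic_form K M e = trace M + K * (e \<bullet> (M *v e))"

text \<open>The ball rather than the sphere: \<open>e = 0\<close> gives the plain trace, the right
  choice for differences with nonpositive trace.\<close>

definition extremal_operator :: "real \<Rightarrow> real^'n::finite^'n \<Rightarrow> real" where
  "extremal_operator K M = (INF e\<in>cball 0 1. elliptic_form K M e)"

definition envelope_operator :: "real \<Rightarrow> ('i \<Rightarrow> real^'n::finite^'n) \<Rightarrow> real^'n^'n \<Rightarrow> real" where
  "envelope_operator K A M = (SUP i. extremal_operator K (M - A i))"

lemma elliptic_form_bounded:
  obtains B where "\<And>e. norm e \<le> 1 \<Longrightarrow> \<bar>elliptic_form K M e\<bar> \<le> B"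
proof -
  have "continuous_on (cball 0 1) (elliptic_form K M)"
    unfolding elliptic_form_def
    by (intro continuous_intros matrix_vector_mult_linear_continuous_on)
  then have "bounded (elliptic_form K M ` cball 0 1)"
    by (intro compact_imp_bounded compact_continuous_image) auto
  then obtain B where "\<forall>v\<in>elliptic_form K M ` cball 0 1. norm v \<le> B" unfolding bounded_iff by blast
  then show ?thesis by (intro that[of B]) simp
qed

lemma elliptic_form_bdd_below: "bdd_below (elliptic_form K M ` cball 0 1)"
proof -
  obtain B where "\<And>e. norm e \<le> 1 \<Longrightarrow> \<bar>elliptic_form K M e\<bar> \<le> B" using elliptic_form_bounded by metis
  then show ?thesis by (intro bdd_belowI[of _ "-B"]) (force simp: abs_le_iff)
qed

lemma elliptic_form_add: "elliptic_form K (M + N) e = elliptic_form K M e + elliptic_form K N e"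
  by (simp add: elliptic_form_def trace_add matrix_vector_mult_add_rdistrib inner_right_distrib algebra_simps)

lemma quadratic_form_axis: "axis i 1 \<bullet> (M *v axis j 1) = (M :: real^'n::finite^'n) $ i $ j"
  by (simp add: matrix_vector_mult_basis column_def inner_axis')

text \<open>Nonnegativity on sums and differences of two axes bounds an entry by the mean of two
  diagonal entries; summing over all pairs gives the crude factor \<open>CARD('n)\<close>,
  sufficient for an upper ellipticity constant.\<close>

lemma nonneg_matrix_bounds:
  fixes N :: "real^'n::finite^'n"
  assumes "nonneg_matrix N" "norm e \<le> 1"
  shows "0 \<le> trace N" "e \<bullet> (N *v e) \<le> real CARD('n) * trace N"
proof -
  have pos: "0 \<le> x \<bullet> (N *v x)" for x using assms by (simp add: nonneg_matrix_def)
  have sym: "N $ i $ j = N $ j $ i" for i j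
  proof -
    have "transpose N = N" using assms(1) by (simp add: nonneg_matrix_def symmetric_matrix_def)
    then have "transpose N $ i $ j = N $ i $ j" by simp
    then show ?thesis by (simp add: transpose_def)
  qed
  have d: "0 \<le> N $ i $ i" for i using pos[of "axis i 1"] by (simp add: quadratic_form_axis)
  then show "0 \<le> trace N" by (simp add: trace_def sum_nonneg)
  have od: "2 * \<bar>N $ i $ j\<bar> \<le> N $ i $ i + N $ j $ j" for i j
  proof -
    have "0 \<le> (axis i 1 + axis j 1) \<bullet> (N *v (axis i 1 + axis j 1))"
      "0 \<le> (axis i 1 - axis j 1) \<bullet> (N *v (axis i 1 - axis j 1))" using pos by auto
    then have "0 \<le> N$i$i + N$j$j + 2 * N$i$j" "0 \<le> N$i$i + N$j$j - 2 * N$i$j"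
      using sym[of i j]
      by (simp_all add: matrix_vector_right_distrib matrix_vector_mult_diff_distrib inner_left_distrib inner_right_distrib
          inner_diff_left inner_diff_right quadratic_form_axis)
    then show ?thesis by linarith
  qed
  have e1: "\<bar>e $ i\<bar> \<le> 1" for i using component_le_norm_cart[of e i] assms(2) by linarith
  have "e \<bullet> (N *v e) = (\<Sum>i\<in>UNIV. \<Sum>j\<in>UNIV. e$i * e$j * N$i$j)"
    by (simp add: inner_vec_def matrix_vector_mult_def sum_distrib_left mult_ac)
  also have "\<dots> \<le> (\<Sum>i\<in>UNIV. \<Sum>j\<in>UNIV. (N$i$i + N$j$j) / 2)"
  proof (intro sum_mono)
    fix i j
    have "e$i * e$j * N$i$j \<le> \<bar>e$i\<bar> * \<bar>e$j\<bar> * \<bar>N$i$j\<bar>" by (metis abs_ge_self abs_mult)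
    also have "\<dots> \<le> 1 * \<bar>N$i$j\<bar>" using e1 by (intro mult_right_mono mult_le_one) auto
    also have "\<dots> \<le> (N$i$i + N$j$j) / 2" using od[of i j] by simp
    finally show "e$i * e$j * N$i$j \<le> (N$i$i + N$j$j) / 2" .
  qed
  also have "\<dots> = real CARD('n) * trace N"
    by (simp add: trace_def add_divide_distrib sum.distrib sum_distrib_left sum_divide_distrib[symmetric])
  finally show "e \<bullet> (N *v e) \<le> real CARD('n) * trace N" .
qed

lemma extremal_operator_le: "norm e \<le> 1 \<Longrightarrow> extremal_operator K M \<le> elliptic_form K M e"
  unfolding extremal_operator_def by (rule cINF_lower[OF elliptic_form_bdd_below]) simp

lemma extremal_operator_ge:
  "(\<And>e. norm e \<le> 1 \<Longrightarrow> b \<le> elliptic_form K M e) \<Longrightarrow> b \<le> extremal_operator K M"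
  unfolding extremal_operator_def by (rule cINF_greatest) auto

context
  fixes K :: real and A :: "'i \<Rightarrow> real^'n::finite^'n"
  assumes K: "0 \<le> K"
    and pair: "\<And>i j. \<exists>e. norm e \<le> 1 \<and> elliptic_form K (A i - A j) e \<le> 0"
begin

text \<open>Finiteness of the supremum already rests on \<open>pair\<close>: comparing with a fixed
  \<open>A k\<close> along the direction for \<open>A k - A i\<close> bounds every term by the
  maximum of the form of \<open>M - A k\<close>.\<close>

lemma envelope_bdd_above: "bdd_above (range (\<lambda>i. extremal_operator K (M - A i)))"
proof -
  obtain k :: 'i where True by simp
  obtain B where B: "\<And>e. norm e \<le> 1 \<Longrightarrow> \<bar>elliptic_form K (M - A k) e\<bar> \<le> B" using elliptic_form_bounded by metis
  have "extremal_operator K (M - A i) \<le> B" for i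
  proof -
    obtain e where e: "norm e \<le> 1" "elliptic_form K (A k - A i) e \<le> 0" using pair by blast
    have "extremal_operator K (M - A i) \<le> elliptic_form K ((M - A k) + (A k - A i)) e"
      using extremal_operator_le[OF e(1)] by simp
    then show ?thesis using e(2) B[OF e(1)] unfolding elliptic_form_add by (simp add: abs_le_iff)
  qed
  then show ?thesis by (intro bdd_aboveI[of _ B]) auto
qed

text \<open>All linear operators in the family have the same ellipticity constants, and infima and
  suprema preserve such two-sided bounds on increments.\<close>

lemma envelope_operator_uniformly_elliptic: "uniformly_elliptic (envelope_operator K A)"
  unfolding uniformly_elliptic_def
proof (rule exI[of _ 1], rule exI[of _ "1 + K * real CARD('n)"], intro conjI allI impI)
  fix M N :: "real^'n^'n" assume N: "nonneg_matrix N"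
  have form: "trace N \<le> elliptic_form K N e" "elliptic_form K N e \<le> (1 + K * real CARD('n)) * trace N" if "norm e \<le> 1" for e
  proof -
    have "0 \<le> K * (e \<bullet> (N *v e))" using K N by (simp add: nonneg_matrix_def)
    then show "trace N \<le> elliptic_form K N e" by (simp add: elliptic_form_def)
    have "K * (e \<bullet> (N *v e)) \<le> K * (real CARD('n) * trace N)"
      using nonneg_matrix_bounds[OF N that] K by (intro mult_left_mono) auto
    then show "elliptic_form K N e \<le> (1 + K * real CARD('n)) * trace N"
      by (simp add: elliptic_form_def algebra_simps)
  qed
  have eq: "M + N - A i = (M - A i) + N" for i by simp
  have lo: "extremal_operator K (M - A i) + trace N \<le> extremal_operator K (M + N - A i)" for i
  proof (rule extremal_operator_ge)
    fix e :: "real^'n" assume e: "norm e \<le> 1"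
    show "extremal_operator K (M - A i) + trace N \<le> elliptic_form K (M + N - A i) e"
      unfolding eq elliptic_form_add using form(1)[OF e] extremal_operator_le[OF e, of K "M - A i"] by linarith
  qed
  have hi: "extremal_operator K (M + N - A i) - (1 + K * real CARD('n)) * trace N \<le> extremal_operator K (M - A i)" for i
  proof (rule extremal_operator_ge)
    fix e :: "real^'n" assume e: "norm e \<le> 1"
    have "extremal_operator K (M + N - A i) \<le> elliptic_form K (M - A i) e + elliptic_form K N e"
      using extremal_operator_le[OF e, of K "(M - A i) + N"] unfolding eq elliptic_form_add .
    then show "extremal_operator K (M + N - A i) - (1 + K * real CARD('n)) * trace N \<le> elliptic_form K (M - A i) e"
      using form(2)[OF e] by linarith
  qed
  have "envelope_operator K A M \<le> envelope_operator K A (M + N) - trace N"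
    unfolding envelope_operator_def
  proof (rule cSUP_least)
    fix i
    have "extremal_operator K (M + N - A i) \<le> (SUP i. extremal_operator K (M + N - A i))"
      by (rule cSUP_upper[OF _ envelope_bdd_above]) simp
    then show "extremal_operator K (M - A i) \<le> (SUP i. extremal_operator K (M + N - A i)) - trace N"
      using lo[of i] by linarith
  qed simp
  then show "1 * trace N \<le> envelope_operator K A (M + N) - envelope_operator K A M" by simp
  have "envelope_operator K A (M + N) \<le> envelope_operator K A M + (1 + K * real CARD('n)) * trace N"
    unfolding envelope_operator_def
  proof (rule cSUP_least)
    fix i
    have "extremal_operator K (M - A i) \<le> (SUP i. extremal_operator K (M - A i))"
      by (rule cSUP_upper[OF _ envelope_bdd_above]) simp
    then show "extremal_operator K (M + N - A i) \<le> (SUP i. extremal_operator K (M - A i)) + (1 + K * real CARD('n)) * trace N"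
      using hi[of i] by linarith
  qed simp
  then show "envelope_operator K A (M + N) - envelope_operator K A M \<le> (1 + K * real CARD('n)) * trace N" by simp
qed (use K in auto)

lemma elliptic_form_nonneg:
  assumes "\<And>h. 0 \<le> h \<bullet> (M *v h)"
  shows "0 \<le> elliptic_form K (M :: real^'n^'n) e"
proof -
  have "0 \<le> trace M" unfolding trace_def
    using assms[of "axis _ 1"] by (intro sum_nonneg) (simp add: quadratic_form_axis)
  then show ?thesis using assms[of e] K by (simp add: elliptic_form_def)
qed

lemma envelope_operator_nonneg:
  assumes "\<And>h. h \<bullet> (A i *v h) \<le> h \<bullet> (M *v h)"
  shows "0 \<le> envelope_operator K A M"
proof -
  have "0 \<le> extremal_operator K (M - A i)"
    using assms by (intro extremal_operator_ge elliptic_form_nonneg) (simp add: matrix_vector_mult_diff_rdistrib inner_diff_right)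
  also have "\<dots> \<le> envelope_operator K A M"
    unfolding envelope_operator_def by (rule cSUP_upper[OF _ envelope_bdd_above]) simp
  finally show ?thesis .
qed

text \<open>This is where \<open>pair\<close> puts \<open>A i\<close> into the zero set: for each
  \<open>j\<close> the direction that is nonpositive on \<open>A i - A j\<close> stays so on
  \<open>M - A j\<close>, since the forms are monotone.\<close>

lemma envelope_operator_nonpos:
  assumes "\<And>h. h \<bullet> (M *v h) \<le> h \<bullet> (A i *v h)"
  shows "envelope_operator K A M \<le> 0"
  unfolding envelope_operator_def
proof (rule cSUP_least)
  fix j
  obtain e where e: "norm e \<le> 1" "elliptic_form K (A i - A j) e \<le> 0" using pair by blast
  have "0 \<le> elliptic_form K (A i - M) e"
    using assms by (intro elliptic_form_nonneg) (simp add: matrix_vector_mult_diff_rdistrib inner_diff_right)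
  moreover have "elliptic_form K (A i - A j) e = elliptic_form K (A i - M) e + elliptic_form K (M - A j) e"
    by (simp add: elliptic_form_add[symmetric])
  ultimately have "elliptic_form K (M - A j) e \<le> 0" using e(2) by simp
  then show "extremal_operator K (M - A j) \<le> 0" using extremal_operator_le[OF e(1), of K "M - A j"] by linarith
qed simp

lemma viscosity_solution_envelope:
  assumes u: "continuous_on (ball 0 1) u" and d: "\<And>x. x \<in> ball 0 1 \<Longrightarrow> \<exists>i. has_second_difference u x (A i)"
  shows "viscosity_solution (envelope_operator K A) u"
  unfolding viscosity_solution_def
proof (intro conjI ballI allI impI)
  fix x :: "real^'n" and \<phi> assume x: "x \<in> ball 0 1" and c: "C2_near x \<phi>"
  obtain i where i: "has_second_difference u x (A i)" using d[OF x] by blast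
  have p: "has_second_difference \<phi> x (hessian \<phi> x)"
    unfolding has_second_difference_def using C2_near_second_difference[OF c] by blast
  show "0 \<le> envelope_operator K A (hessian \<phi> x)" if "touches_above \<phi> u x"
    using that touching_second_difference[OF _ _ i p] by (intro envelope_operator_nonneg[of i]) (auto simp: touches_above_def)
  show "envelope_operator K A (hessian \<phi> x) \<le> 0" if "touches_below \<phi> u x"
    using that touching_second_difference[OF _ _ p i] by (intro envelope_operator_nonpos[of _ i]) (auto simp: touches_below_def)
qed (rule u)

end

subsection \<open>Regularity of the profile\<close>

lemma cubic_add: "cubic (z + w) = cubic z + 3 * (jordan z z \<bullet> w) + 3 * (jordan z w \<bullet> w) + cubic w"
proof -
  have "jordan z w \<bullet> z = jordan z z \<bullet> w" "jordan w w \<bullet> z = jordan z w \<bullet> w"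
    using jordan_inner_swap[of z w z] jordan_inner_swap[of w w z] by (simp_all add: jordan_commute[of w z])
  then show ?thesis
    unfolding cubic_def jordan.add_left jordan.add_right jordan_commute[of w z] inner_add_left inner_add_right by simp
qed

lemma cubic_second_difference: "cubic (z + w) + cubic (z - w) - 2 * cubic z = 6 * (jordan z w \<bullet> w)"
  using cubic_add[of z w] cubic_add[of z "- w"] by (simp add: cubic_uminus jordan.minus_right)

lemma cap_uminus: "cap (- y) = - cap y"
  by (simp add: cap_def cubic_uminus)

lemma cap_bound:
  obtains M where "M \<ge> 0" "\<And>y. \<bar>cap y\<bar> \<le> M * (norm y)^2"
proof -
  obtain K where K: "K > 0" "\<And>x y. norm (jordan x y) \<le> norm x * norm y * K" using jordan.pos_bounded by blast
  have cont: "continuous_on {0..1} bump"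
    by (intro continuous_at_imp_continuous_on ballI DERIV_isCont[OF DERIV_bump])
  then have "bounded (bump ` {0..1})" by (intro compact_imp_bounded compact_continuous_image) auto
  then obtain B where B: "\<forall>x\<in>bump ` {0..1}. norm x \<le> B" unfolding bounded_iff by blast
  then have B01: "\<bar>bump t\<bar> \<le> B" if "0 \<le> t" "t \<le> 1" for t using that by auto
  have B0: "B \<ge> 0" using B01[of 0] by simp
  have Bt: "\<bar>bump t\<bar> \<le> B" if "0 \<le> t" for t
    using B01[OF that] bump_ge(1)[of t] B0 by (cases "t \<le> 1") auto
  show ?thesis
  proof (rule that[of "B * K"])
    fix y :: "real^5"
    have "\<bar>cubic y\<bar> \<le> norm (jordan y y) * norm y" unfolding cubic_def by (rule Cauchy_Schwarz_ineq2)
    also have "\<dots> \<le> norm y * norm y * K * norm y" using K(2)[of y y] by (intro mult_right_mono) auto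
    finally have c: "\<bar>cubic y\<bar> \<le> norm y * norm y * K * norm y" .
    show "\<bar>cap y\<bar> \<le> B * K * (norm y)^2"
    proof (cases "y = 0")
      case True then show ?thesis by (simp add: cap_def cubic_def)
    next
      case False
      have "cap y = bump (y \<bullet> y) * cubic y / norm y" by (simp add: cap_def rad0_def norm_eq_sqrt_inner)
      then have "\<bar>cap y\<bar> = \<bar>bump (y \<bullet> y)\<bar> * (\<bar>cubic y\<bar> / norm y)" by (simp add: abs_mult)
      also have "\<dots> \<le> B * (norm y * norm y * K)"
      proof (intro mult_mono Bt)
        show "\<bar>cubic y\<bar> / norm y \<le> norm y * norm y * K" using c False by (simp add: pos_divide_le_eq)
      qed (use B0 in auto)
      finally show ?thesis by (simp add: power2_eq_square mult_ac)
    qed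
  qed (use K B0 in auto)
qed

lemma isCont_cap: "isCont cap y"
proof (cases "y = 0")
  case False
  then show ?thesis by (rule has_derivative_continuous[OF has_derivative_cap])
next
  case True
  obtain M where M: "\<And>y. \<bar>cap y\<bar> \<le> M * (norm y)^2" using cap_bound by metis
  have "((\<lambda>y::real^5. M * (norm y)^2) \<longlongrightarrow> M * (norm (0::real^5))^2) (at 0)" by (intro tendsto_intros)
  then have "((\<lambda>y::real^5. M * (norm y)^2) \<longlongrightarrow> 0) (at 0)" by simp
  then have "(cap \<longlongrightarrow> 0) (at 0)"
    by (rule Lim_null_comparison[rotated]) (use M in auto)
  then show ?thesis using True by (simp add: isCont_def cap_def cubic_def)
qed

lemma continuous_on_cap_hess: "continuous_on (- {0}) (\<lambda>y. cap_hess y h)"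
proof -
  have t: "continuous_on (- {0::real^5}) (\<lambda>y. y \<bullet> y)" "(\<lambda>y::real^5. y \<bullet> y) ` (- {0}) \<subseteq> {0<..}"
    by (auto intro!: continuous_intros)
  have g: "continuous_on {0<..} rad0" "continuous_on {0<..} rad1" "continuous_on {0<..} rad2"
    by (auto intro!: continuous_at_imp_continuous_on DERIV_isCont[OF DERIV_rad0] DERIV_isCont[OF DERIV_rad1] continuous_rad2)
  note r = continuous_on_compose2[OF g(1) t] continuous_on_compose2[OF g(2) t] continuous_on_compose2[OF g(3) t]
  show ?thesis
    unfolding cap_hess_def cubic_def
    by (intro continuous_intros r jordan.continuous_on)
qed

text \<open>The bounds \<open>near\<close> and \<open>rho_le\<close> make the balls locally finite
  away from \<open>E\<close>; \<open>far\<close> keeps every ball small compared with its distance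
  to \<open>E\<close>; \<open>dense\<close> makes each point of \<open>E\<close> a limit of
  apexes.\<close>

locale cap_configuration = cap_family eps ctr rho for eps ctr rho +
  fixes E :: "(real^5) set" and near :: "nat \<Rightarrow> real^5"
  assumes closed_E: "closed E" and near: "near k \<in> E" "dist (ctr k) (near k) \<le> inverse (real (Suc k))"
    and rho_le: "rho k \<le> inverse (real (Suc k))"
    and far: "z \<in> E \<Longrightarrow> 2 * rho k \<le> dist z (ctr k)"
    and dense: "E \<subseteq> closure (range ctr)"
begin

definition cap_at :: "nat \<Rightarrow> real^5 \<Rightarrow> real" where "cap_at k z = eps * rho k ^ 3 * cap (rescale k z)"
definition cap_grad_at :: "nat \<Rightarrow> real^5 \<Rightarrow> real^5" where
  "cap_grad_at k z = (eps * rho k ^ 2) *\<^sub>R cap_grad (rescale k z)"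
definition profile :: "real^5 \<Rightarrow> real" where "profile z = cubic z + (\<Sum>k. cap_at k z)"
definition profile_grad :: "real^5 \<Rightarrow> real^5" where "profile_grad z = 3 *\<^sub>R jordan z z + (\<Sum>k. cap_grad_at k z)"

lemma cap_at_outside:
  assumes "z \<notin> ball (ctr k) (rho k)"
  shows "cap_at k z = 0" "cap_grad_at k z = 0"
  using assms norm_rescale_lt[of k z] by (simp_all add: cap_at_def cap_grad_at_def cap_zero)

lemma locally_finite:
  assumes "z \<notin> E"
  obtains N K where "open N" "z \<in> N" "finite K" "\<And>y k. y \<in> N \<Longrightarrow> k \<notin> K \<Longrightarrow> y \<notin> ball (ctr k) (rho k)"
proof -
  obtain d where d: "d > 0" "\<And>y. y \<in> E \<Longrightarrow> d \<le> dist z y"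
    using closed_E assms separate_point_closed[of E z] by blast
  \<comment> \<open>If ball \<open>k\<close> meets \<open>ball z (d/2)\<close>, then
    \<open>near k\<close>, a point of \<open>E\<close>, is closer to \<open>z\<close> than
    \<open>d/2 + 2/(k+1)\<close>, which forces \<open>d/4 < 1/(k+1)\<close>.\<close>
  define K where "K = {k. d / 4 < inverse (real (Suc k))}"
  have "K \<subseteq> {..nat \<lceil>4 / d\<rceil>}"
  proof
    fix k assume "k \<in> K"
    then have "d / 4 * real (Suc k) < 1" by (simp add: K_def field_simps)
    then have "real (Suc k) < 4 / d" using d(1) by (simp add: field_simps)
    then have "real k \<le> real_of_int \<lceil>4 / d\<rceil>" by linarith
    then show "k \<in> {..nat \<lceil>4 / d\<rceil>}" by (simp add: le_nat_iff)
  qed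
  then have fin: "finite K" by (rule finite_subset) simp
  show ?thesis
  proof (rule that[of "ball z (d/2)" K])
    fix y k assume y: "y \<in> ball z (d/2)" and k: "k \<notin> K"
    show "y \<notin> ball (ctr k) (rho k)"
    proof
      assume "y \<in> ball (ctr k) (rho k)"
      then have "dist y (ctr k) < rho k" by (simp add: dist_commute)
      moreover have "dist z y < d/2" using y by simp
      moreover have "d \<le> dist z (near k)" using d near by blast
      moreover have "dist z (near k) \<le> dist z y + dist y (ctr k) + dist (ctr k) (near k)"
        using dist_triangle[of z "near k" y] dist_triangle[of y "near k" "ctr k"] by linarith
      ultimately have "d < d/2 + 2 * inverse (real (Suc k))" using near(2)[of k] rho_le[of k] by linarith
      then show False using k by (simp add: K_def)
    qed
  qed (use d fin in auto)
qed

lemma has_derivative_rescale: "(rescale k has_derivative (\<lambda>h. h /\<^sub>R rho k)) (at z)"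
  unfolding rescale_def[abs_def] by (auto intro!: derivative_eq_intros)

lemma rescale_eq_0: "rescale k z = 0 \<longleftrightarrow> z = ctr k"
  using rho_pos[of k] by (simp add: rescale_def)

lemma has_derivative_cap_at:
  assumes "z \<noteq> ctr k"
  shows "(cap_at k has_derivative (\<lambda>h. cap_grad_at k z \<bullet> h)) (at z)"
proof -
  have "((\<lambda>z. eps * rho k ^ 3 * cap (rescale k z)) has_derivative
      (\<lambda>h. eps * rho k ^ 3 * (cap_grad (rescale k z) \<bullet> (h /\<^sub>R rho k)))) (at z)"
    using assms rescale_eq_0[of k z]
    by (intro has_derivative_mult_right has_derivative_compose[OF has_derivative_rescale has_derivative_cap]) auto
  moreover have "eps * rho k ^ 3 * (cap_grad (rescale k z) \<bullet> (h /\<^sub>R rho k)) = cap_grad_at k z \<bullet> h" for h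
    using rho_pos[of k] by (simp add: cap_grad_at_def field_simps power2_eq_square power3_eq_cube)
  ultimately show ?thesis by (simp add: cap_at_def[abs_def])
qed

lemma has_derivative_cap_grad_at:
  assumes "z \<noteq> ctr k"
  shows "(cap_grad_at k has_derivative cap_hess_at k z) (at z)"
proof -
  have "((\<lambda>z. (eps * rho k ^ 2) *\<^sub>R cap_grad (rescale k z)) has_derivative
      (\<lambda>h. (eps * rho k ^ 2) *\<^sub>R cap_hess (rescale k z) (h /\<^sub>R rho k))) (at z)"
    using assms rescale_eq_0[of k z]
    by (intro has_derivative_scaleR_right has_derivative_compose[OF has_derivative_rescale has_derivative_cap_grad]) auto
  moreover have "(eps * rho k ^ 2) *\<^sub>R cap_hess (rescale k z) (h /\<^sub>R rho k) = cap_hess_at k z h" for h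
    using rho_pos[of k] by (simp add: cap_hess_at_def linear_scale[OF linear_cap_hess] power2_eq_square)
  ultimately show ?thesis by (simp add: cap_grad_at_def[abs_def])
qed

lemma has_derivative_jordan_diag: "((\<lambda>z. 3 *\<^sub>R jordan z z) has_derivative (\<lambda>h. 6 *\<^sub>R jordan z h)) (at z)"
proof -
  have "((\<lambda>z. 3 *\<^sub>R jordan z z) has_derivative (\<lambda>h. 3 *\<^sub>R (jordan z h + jordan h z))) (at z)"
    by (intro has_derivative_scaleR_right jordan.FDERIV has_derivative_ident)
  moreover have "3 *\<^sub>R (jordan z h + jordan h z) = 6 *\<^sub>R jordan z h" for h
  proof -
    have "3 *\<^sub>R (jordan z h + jordan h z) = (3 + 3) *\<^sub>R jordan z h"
      unfolding jordan_commute[of h z] scaleR_add_right scaleR_add_left ..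
    then show ?thesis by simp
  qed
  ultimately show ?thesis by simp
qed

lemma profile_regular:
  assumes "z \<notin> E" "z \<notin> range ctr"
  obtains N where "open N" "z \<in> N" "N \<inter> (E \<union> range ctr) = {}"
    "\<And>y. y \<in> N \<Longrightarrow> (profile has_derivative (\<lambda>h. profile_grad y \<bullet> h)) (at y)"
    "\<And>y. y \<in> N \<Longrightarrow> (profile_grad has_derivative profile_hess y) (at y)"
    "\<And>h. continuous_on N (\<lambda>y. profile_hess y h)"
proof -
  obtain N0 K where N0: "open N0" "z \<in> N0" "finite K" "\<And>y k. y \<in> N0 \<Longrightarrow> k \<notin> K \<Longrightarrow> y \<notin> ball (ctr k) (rho k)"
    using locally_finite[OF assms(1)] by metis
  \<comment> \<open>Removing finitely many centres suffices: a centre with index outside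
    \<open>K\<close> lies in its own ball, hence outside \<open>N0\<close>.\<close>
  define N where "N = N0 - E - ctr ` K"
  have oN: "open N" unfolding N_def using N0 closed_E by (intro open_Diff) (auto intro: finite_imp_closed)
  have zN: "z \<in> N" using N0 assms by (auto simp: N_def)
  have ctrN: "y \<noteq> ctr k" if "y \<in> N" for y k
    using that N0(4)[of y k] rho_pos[of k] by (cases "k \<in> K") (auto simp: N_def)
  have p: "profile y = cubic y + (\<Sum>k\<in>K. cap_at k y)" "profile_grad y = 3 *\<^sub>R jordan y y + (\<Sum>k\<in>K. cap_grad_at k y)"
    "profile_hess y h = 6 *\<^sub>R jordan y h + (\<Sum>k\<in>K. cap_hess_at k y h)" if "y \<in> N" for y h
    using that N0(4)[of y] unfolding profile_def profile_grad_def profile_hess_def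
    by (auto simp: N_def intro!: suminf_finite[OF N0(3)] cap_at_outside cap_hess_at_outside)
  show ?thesis
  proof (rule that[OF oN zN])
    show "N \<inter> (E \<union> range ctr) = {}" using ctrN by (auto simp: N_def)
  next
    fix y assume y: "y \<in> N"
    have "((\<lambda>y. cubic y + (\<Sum>k\<in>K. cap_at k y)) has_derivative (\<lambda>h. (3 *\<^sub>R jordan y y) \<bullet> h + (\<Sum>k\<in>K. cap_grad_at k y \<bullet> h))) (at y)"
      by (intro has_derivative_add has_derivative_sum has_derivative_cubic has_derivative_cap_at ctrN[OF y])
    then have "((\<lambda>y. cubic y + (\<Sum>k\<in>K. cap_at k y)) has_derivative (\<lambda>h. profile_grad y \<bullet> h)) (at y)"
      by (simp add: p[OF y] inner_add_left inner_sum_left)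
    then show "(profile has_derivative (\<lambda>h. profile_grad y \<bullet> h)) (at y)"
      by (rule has_derivative_transform_within_open[OF _ oN y]) (simp add: p)
    have "((\<lambda>y. 3 *\<^sub>R jordan y y + (\<Sum>k\<in>K. cap_grad_at k y)) has_derivative (\<lambda>h. 6 *\<^sub>R jordan y h + (\<Sum>k\<in>K. cap_hess_at k y h))) (at y)"
      by (intro has_derivative_add has_derivative_sum has_derivative_jordan_diag has_derivative_cap_grad_at ctrN[OF y])
    then have "((\<lambda>y. 3 *\<^sub>R jordan y y + (\<Sum>k\<in>K. cap_grad_at k y)) has_derivative profile_hess y) (at y)"
      by (simp add: p(3)[OF y, symmetric])
    then show "(profile_grad has_derivative profile_hess y) (at y)"
      by (rule has_derivative_transform_within_open[OF _ oN y]) (simp add: p)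
  next
    fix h
    have "continuous_on N (\<lambda>y. 6 *\<^sub>R jordan y h + (\<Sum>k\<in>K. (eps * rho k) *\<^sub>R cap_hess (rescale k y) h))"
    proof (intro continuous_intros jordan.continuous_on)
      fix k
      show "continuous_on N (\<lambda>y. cap_hess (rescale k y) h)"
      proof (rule continuous_on_compose2[OF continuous_on_cap_hess])
        show "continuous_on N (rescale k)" unfolding rescale_def by (intro continuous_intros)
        show "rescale k ` N \<subseteq> - {0}" using ctrN rescale_eq_0 by auto
      qed
    qed
    then have "continuous_on N (\<lambda>y. 6 *\<^sub>R jordan y h + (\<Sum>k\<in>K. cap_hess_at k y h))" by (simp add: cap_hess_at_def)
    moreover have "\<And>y. y \<in> N \<Longrightarrow> 6 *\<^sub>R jordan y h + (\<Sum>k\<in>K. cap_hess_at k y h) = profile_hess y h" using p(3) by simp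
    ultimately show "continuous_on N (\<lambda>y. profile_hess y h)" by (rule continuous_on_eq)
  qed
qed

text \<open>If \<open>y\<close> lies in ball \<open>k\<close>, the factor 2 in \<open>far\<close>
  gives \<open>rho k \<le> dist z y\<close>, and the cap there is of size
  \<open>rho k ^ 3\<close>.\<close>

lemma perturbation_cubic_bound:
  obtains M where "M \<ge> 0" "\<And>z y. z \<in> E \<Longrightarrow> \<bar>\<Sum>k. cap_at k y\<bar> \<le> M * dist z y ^ 3"
proof -
  obtain M where M: "M \<ge> 0" "\<And>y. \<bar>cap y\<bar> \<le> M * (norm y)^2" using cap_bound by metis
  show ?thesis
  proof (rule that[of "eps * M"])
    show "0 \<le> eps * M" using eps_pos M by simp
    fix z y assume z: "z \<in> E"
    obtain k where k: "\<And>j. j \<noteq> k \<Longrightarrow> y \<notin> ball (ctr j) (rho j)" using ball_index by metis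
    have s: "(\<Sum>k. cap_at k y) = cap_at k y" by (rule suminf_single) (use k cap_at_outside in auto)
    show "\<bar>\<Sum>k. cap_at k y\<bar> \<le> eps * M * dist z y ^ 3"
    proof (cases "y \<in> ball (ctr k) (rho k)")
      case True
      then have n: "norm (rescale k y) < 1" by (simp add: norm_rescale_lt)
      have "rho k \<le> dist z y"
        using True far[OF z, of k] dist_triangle[of z "ctr k" y] by (simp add: dist_commute)
      then have r: "rho k ^ 3 \<le> dist z y ^ 3" using rho_pos[of k] by (intro power_mono) auto
      have "\<bar>cap (rescale k y)\<bar> \<le> M * (norm (rescale k y))^2" by (rule M)
      also have "\<dots> \<le> M * 1" using n M(1) by (intro mult_left_mono power_le_one) auto
      finally have "eps * rho k ^ 3 * \<bar>cap (rescale k y)\<bar> \<le> eps * dist z y ^ 3 * M"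
        using eps_pos rho_pos[of k] r M(1) by (intro mult_mono) auto
      moreover have "\<bar>cap_at k y\<bar> = eps * rho k ^ 3 * \<bar>cap (rescale k y)\<bar>"
        using eps_pos rho_pos[of k] by (simp add: cap_at_def abs_mult)
      ultimately show ?thesis unfolding s by (simp add: mult_ac)
    next
      case False
      then show ?thesis unfolding s using cap_at_outside(1)[OF False] eps_pos M(1) by simp
    qed
  qed
qed

lemma isCont_profile: "isCont profile z"
proof (cases "z \<in> E")
  case False
  obtain N K where N: "open N" "z \<in> N" "finite K" "\<And>y k. y \<in> N \<Longrightarrow> k \<notin> K \<Longrightarrow> y \<notin> ball (ctr k) (rho k)"
    using locally_finite[OF False] by metis
  have "continuous_on N (\<lambda>y. cubic y + (\<Sum>k\<in>K. eps * rho k ^ 3 * cap (rescale k y)))"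
    unfolding rescale_def cubic_def
    by (intro continuous_intros jordan.continuous_on continuous_on_compose2[OF continuous_at_imp_continuous_on[of UNIV cap]] ballI isCont_cap) auto
  moreover have "cubic y + (\<Sum>k\<in>K. eps * rho k ^ 3 * cap (rescale k y)) = profile y" if "y \<in> N" for y
    using that N(4)[of y] unfolding profile_def cap_at_def[symmetric]
    by (simp add: suminf_finite[OF N(3), of "\<lambda>k. cap_at k y"] cap_at_outside)
  ultimately have "continuous_on N profile" by (rule continuous_on_eq)
  then show ?thesis using N(1,2) by (simp add: continuous_on_eq_continuous_at)
next
  case True
  obtain M where M: "\<And>y. \<bar>\<Sum>k. cap_at k y\<bar> \<le> M * dist z y ^ 3" using perturbation_cubic_bound True by metis
  have "((\<lambda>y. M * dist z y ^ 3) \<longlongrightarrow> M * dist z z ^ 3) (at z)" by (intro tendsto_intros)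
  then have "((\<lambda>y. M * dist z y ^ 3) \<longlongrightarrow> 0) (at z)" by simp
  then have "((\<lambda>y. \<Sum>k. cap_at k y) \<longlongrightarrow> 0) (at z)"
    by (rule Lim_null_comparison[rotated]) (use M in auto)
  moreover have "(\<Sum>k. cap_at k z) = 0" using M[of z] by simp
  moreover have "isCont cubic z" by (rule has_derivative_continuous[OF has_derivative_cubic])
  ultimately have "((\<lambda>y. cubic y + (\<Sum>k. cap_at k y)) \<longlongrightarrow> cubic z + 0) (at z)"
    unfolding isCont_def by (intro tendsto_add)
  then show ?thesis using \<open>(\<Sum>k. cap_at k z) = 0\<close> by (simp add: isCont_def profile_def[abs_def])
qed

text \<open>On \<open>E\<close> the perturbation is cubically small. At an apex the cap is odd, so
  its symmetric second difference is identically zero for small \<open>t\<close>. Everywhere else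
  the profile is twice differentiable.\<close>

lemma profile_second_difference:
  "((\<lambda>t. (profile (z + t *\<^sub>R h) + profile (z - t *\<^sub>R h) - 2 * profile z) / t^2) \<longlongrightarrow> profile_hess z h \<bullet> h) (at_right 0)"
proof -
  define c where "c y = (\<Sum>k. cap_at k y)" for y
  have quot: "(profile (z + t *\<^sub>R h) + profile (z - t *\<^sub>R h) - 2 * profile z) / t^2
     = 6 * (jordan z h \<bullet> h) + (c (z + t *\<^sub>R h) + c (z - t *\<^sub>R h) - 2 * c z) / t^2" if "t > 0" for t
  proof -
    have "profile (z + t *\<^sub>R h) + profile (z - t *\<^sub>R h) - 2 * profile z
      = t^2 * (6 * (jordan z h \<bullet> h)) + (c (z + t *\<^sub>R h) + c (z - t *\<^sub>R h) - 2 * c z)"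
      using cubic_second_difference[of z "t *\<^sub>R h"]
      by (simp add: profile_def c_def jordan.scaleR_right power2_eq_square)
    then show ?thesis using that by (simp add: add_divide_distrib)
  qed
  have pos: "\<forall>\<^sub>F t::real in at_right 0. t > 0" by (rule eventually_at_right_less)
  \<comment> \<open>In the two singular cases the matrix is that of \<open>cubic\<close>
    alone.\<close>
  have reduce: "?thesis" if lim: "((\<lambda>t. (c (z + t *\<^sub>R h) + c (z - t *\<^sub>R h) - 2 * c z) / t^2) \<longlongrightarrow> 0) (at_right 0)"
    and hess: "profile_hess z h \<bullet> h = 6 * (jordan z h \<bullet> h)"
  proof -
    have "((\<lambda>t. 6 * (jordan z h \<bullet> h) + (c (z + t *\<^sub>R h) + c (z - t *\<^sub>R h) - 2 * c z) / t^2) \<longlongrightarrow> 6 * (jordan z h \<bullet> h) + 0) (at_right 0)"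
      by (intro tendsto_intros lim)
    then have "((\<lambda>t. 6 * (jordan z h \<bullet> h) + (c (z + t *\<^sub>R h) + c (z - t *\<^sub>R h) - 2 * c z) / t^2) \<longlongrightarrow> profile_hess z h \<bullet> h) (at_right 0)"
      by (simp add: hess)
    then show ?thesis
      by (rule Lim_transform_eventually) (use pos in \<open>eventually_elim, simp add: quot\<close>)
  qed
  consider "z \<in> E" | k where "z = ctr k" | "z \<notin> E" "z \<notin> range ctr" by blast
  then show ?thesis
  proof cases
    case 1
    obtain M where M: "M \<ge> 0" "\<And>y. \<bar>c y\<bar> \<le> M * dist z y ^ 3" using perturbation_cubic_bound 1 unfolding c_def by metis
    have out: "z \<notin> ball (ctr k) (rho k)" for k
      using far[OF 1, of k] rho_pos[of k] by (simp add: dist_commute)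
    show ?thesis
    proof (rule reduce)
      show "profile_hess z h \<bullet> h = 6 * (jordan z h \<bullet> h)"
        using cap_hess_at_outside[OF out] by (simp add: profile_hess_def)
      have "((\<lambda>t. 2 * M * norm h ^ 3 * t) \<longlongrightarrow> 2 * M * norm h ^ 3 * 0) (at_right 0)" by (intro tendsto_intros)
      then have l: "((\<lambda>t. 2 * M * norm h ^ 3 * t) \<longlongrightarrow> 0) (at_right 0)" by simp
      show "((\<lambda>t. (c (z + t *\<^sub>R h) + c (z - t *\<^sub>R h) - 2 * c z) / t^2) \<longlongrightarrow> 0) (at_right 0)"
      proof (rule Lim_null_comparison[OF _ l])
        show "\<forall>\<^sub>F t in at_right 0. norm ((c (z + t *\<^sub>R h) + c (z - t *\<^sub>R h) - 2 * c z) / t^2) \<le> 2 * M * norm h ^ 3 * t"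
          using pos
        proof eventually_elim
          case (elim t)
          have "c z = 0" using M(2)[of z] by simp
          moreover have "\<bar>c (z + t *\<^sub>R h)\<bar> \<le> M * (t * norm h) ^ 3" "\<bar>c (z - t *\<^sub>R h)\<bar> \<le> M * (t * norm h) ^ 3"
            using M(2)[of "z + t *\<^sub>R h"] M(2)[of "z - t *\<^sub>R h"] elim by (simp_all add: dist_norm)
          ultimately have "\<bar>c (z + t *\<^sub>R h) + c (z - t *\<^sub>R h) - 2 * c z\<bar> \<le> 2 * (M * (t * norm h) ^ 3)" by linarith
          also have "\<dots> = (2 * M * norm h ^ 3 * t) * t^2" by (simp add: power_mult_distrib power2_eq_square power3_eq_cube)
          finally show ?case using elim by (simp add: pos_divide_le_eq)
        qed
      qed
    qed
  next
    case 2
    have n0: "norm (rescale k z) < 1/2" using 2 rescale_eq_0[of k z] by simp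
    have m0: "model_hessian c' 0 h = 0" for c' using model_hessian_uminus[of c' 0 h] by simp
    have cz: "c y = cap_at k y" if "y \<in> ball (ctr k) (rho k)" for y
      unfolding c_def by (rule suminf_single) (use that in_ball_unique cap_at_outside in blast)
    show ?thesis
    proof (rule reduce)
      show "profile_hess z h \<bullet> h = 6 * (jordan z h \<bullet> h)"
        unfolding profile_hess_inner_half_ball[OF n0] using 2 m0 by simp
      have "\<forall>\<^sub>F t in at_right 0. t < rho k / (norm h + 1)"
        unfolding eventually_at_right_field using rho_pos[of k]
        by (intro exI[of _ "rho k / (norm h + 1)"]) (auto intro!: divide_pos_pos add_nonneg_pos)
      then have "\<forall>\<^sub>F t in at_right 0. 0 = (c (z + t *\<^sub>R h) + c (z - t *\<^sub>R h) - 2 * c z) / t^2"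
        using pos
      proof eventually_elim
        case (elim t)
        have "t * norm h \<le> t * (norm h + 1)" using elim by (intro mult_left_mono) auto
        also have "\<dots> < rho k"
        proof -
          have "0 < norm h + 1" by (simp add: add_nonneg_pos)
          then show ?thesis using elim by (simp add: pos_less_divide_eq)
        qed
        finally have "z + t *\<^sub>R h \<in> ball (ctr k) (rho k)" "z - t *\<^sub>R h \<in> ball (ctr k) (rho k)" "z \<in> ball (ctr k) (rho k)"
          using 2 elim rho_pos[of k] by (auto simp: dist_norm)
        moreover have "cap_at k (z - t *\<^sub>R h) = - cap_at k (z + t *\<^sub>R h)" "cap_at k z = 0"
          using 2 cap_uminus[of "(t *\<^sub>R h) /\<^sub>R rho k"] by (simp_all add: cap_at_def rescale_def cap_def cubic_def)
        ultimately show ?case by (simp add: cz)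
      qed
      then show "((\<lambda>t. (c (z + t *\<^sub>R h) + c (z - t *\<^sub>R h) - 2 * c z) / t^2) \<longlongrightarrow> 0) (at_right 0)"
        by (rule Lim_transform_eventually[OF tendsto_const])
    qed
  next
    case 3
    obtain N where N: "open N" "z \<in> N"
      "\<And>y. y \<in> N \<Longrightarrow> (profile has_derivative (\<lambda>h. profile_grad y \<bullet> h)) (at y)"
      "\<And>y. y \<in> N \<Longrightarrow> (profile_grad has_derivative profile_hess y) (at y)"
      using profile_regular[OF 3] by metis
    show ?thesis by (rule second_difference_tendsto[OF N(1-3) N(4)[OF N(2)]])
  qed
qed

end

subsection \<open>Lifting to higher dimension and the singular set\<close>

definition restrict5 :: "(5 \<Rightarrow> 'n::finite) \<Rightarrow> real^'n \<Rightarrow> real^5" where "restrict5 \<iota> x = (\<chi> j. x $ \<iota> j)"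
text \<open>The adjoint of \<open>restrict5\<close>; for injective \<open>\<iota>\<close> also an
  isometric right inverse.\<close>

definition embed5 :: "(5 \<Rightarrow> 'n::finite) \<Rightarrow> real^5 \<Rightarrow> real^'n" where
  "embed5 \<iota> z = (\<Sum>j\<in>UNIV. z$j *\<^sub>R axis (\<iota> j) 1)"

lemma linear_restrict5: "linear (restrict5 \<iota>)"
  by (intro linearI) (simp_all add: restrict5_def vec_eq_iff)

lemma linear_embed5: "linear (embed5 \<iota>)"
  by (intro linearI) (simp_all add: embed5_def sum.distrib scaleR_add_left scaleR_sum_right)

lemma embed5_inner: "embed5 \<iota> z \<bullet> x = z \<bullet> restrict5 \<iota> x"
proof -
  have "embed5 \<iota> z \<bullet> x = (\<Sum>j\<in>UNIV. z$j * x$\<iota> j)" by (simp add: embed5_def inner_sum_left inner_axis')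
  then show ?thesis by (simp add: restrict5_def inner_vec_def[of z])
qed

lemma restrict5_embed5:
  assumes "inj \<iota>"
  shows "restrict5 \<iota> (embed5 \<iota> z) = z"
proof -
  have "(\<Sum>j\<in>UNIV. z $ j * axis (\<iota> j) 1 $ \<iota> i) = z $ i" for i
  proof -
    have "(\<Sum>j\<in>UNIV. z $ j * axis (\<iota> j) 1 $ \<iota> i) = (\<Sum>j\<in>UNIV. if j = i then z $ j else 0)"
      using assms by (intro sum.cong) (auto simp: axis_def inj_eq)
    then show ?thesis by simp
  qed
  then show ?thesis by (simp add: restrict5_def embed5_def vec_eq_iff)
qed

lemma norm_embed5: "inj \<iota> \<Longrightarrow> norm (embed5 \<iota> z) = norm z"
  by (simp add: norm_eq_sqrt_inner embed5_inner restrict5_embed5)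

text \<open>By the chain rule the Hessian of a function composed with \<open>restrict5\<close>,
  since \<open>embed5\<close> is the adjoint.\<close>

definition lift_matrix :: "(5 \<Rightarrow> 'n::finite) \<Rightarrow> (real^5 \<Rightarrow> real^5) \<Rightarrow> real^'n^'n" where
  "lift_matrix \<iota> L = matrix (\<lambda>h. embed5 \<iota> (L (restrict5 \<iota> h)))"

lemma lift_matrix_mult:
  assumes "linear L"
  shows "lift_matrix \<iota> L *v h = embed5 \<iota> (L (restrict5 \<iota> h))"
proof -
  have "linear (\<lambda>h. embed5 \<iota> (L (restrict5 \<iota> h)))"
    using linear_compose[OF linear_compose[OF linear_restrict5 assms] linear_embed5] by (simp add: o_def)
  then show ?thesis by (simp add: lift_matrix_def matrix_works)
qed

lemma trace_lift_matrix:
  assumes "linear L" "inj \<iota>"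
  shows "trace (lift_matrix \<iota> L) = (\<Sum>j\<in>UNIV. L (axis j 1) \<bullet> axis j 1)"
proof -
  have L0: "L 0 = 0" by (rule linear_0[OF assms(1)])
  have ax: "restrict5 \<iota> (axis (\<iota> j) 1) = axis j 1" for j
    using assms(2) by (auto simp: restrict5_def axis_def vec_eq_iff inj_eq)
  have z: "restrict5 \<iota> (axis i 1) = 0" if "i \<notin> range \<iota>" for i
    using that by (auto simp: restrict5_def axis_def vec_eq_iff)
  have e: "lift_matrix \<iota> L $ i $ i = L (restrict5 \<iota> (axis i 1)) \<bullet> restrict5 \<iota> (axis i 1)" for i
    unfolding quadratic_form_axis[symmetric] lift_matrix_mult[OF assms(1)] inner_commute[of "axis i 1"] embed5_inner ..
  have "trace (lift_matrix \<iota> L) = (\<Sum>i\<in>range \<iota>. L (restrict5 \<iota> (axis i 1)) \<bullet> restrict5 \<iota> (axis i 1))"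
    unfolding trace_def e by (rule sum.mono_neutral_right) (auto simp: z L0)
  also have "\<dots> = (\<Sum>j\<in>UNIV. L (axis j 1) \<bullet> axis j 1)"
    using assms(2) by (subst sum.reindex) (auto simp: ax)
  finally show ?thesis .
qed

text \<open>The trace of the form is \<open>- 8 * cubic w\<close>, and \<open>axis 2 1\<close>
  represents diag(1,1,-2) / sqrt 6, whose cubic invariant is nonzero.\<close>

lemma cone_hessian_nonzero: "\<exists>w h. cone_hessian (sym3 (sgn w)) (sym3 h) \<noteq> 0"
proof -
  define w :: "real^5" where "w = axis 2 1"
  have "sqrt 6 * (sqrt 6 * sqrt 6) = 6 * sqrt (6::real)" by simp
  then have "cubic w \<noteq> 0"
    unfolding cubic_eq_trace trace_def matrix_matrix_mult_def
    by (simp add: sum_3 sym3_nth w_def axis_def field_simps)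
  moreover have "norm w = 1" by (simp add: w_def)
  ultimately have "(\<Sum>j\<in>UNIV. cone_hessian (sym3 w) (sym3 (axis j 1))) \<noteq> 0"
    using sum_axis_cone_hessian[of w] by simp
  then obtain j where "cone_hessian (sym3 w) (sym3 (axis j 1)) \<noteq> 0" by (meson sum.neutral)
  moreover have "sgn w = w" using \<open>norm w = 1\<close> by (simp add: sgn_div_norm)
  ultimately show ?thesis by metis
qed

context cap_family
begin

lemma linear_profile_hess: "linear (profile_hess z)"
proof -
  obtain k where k: "\<And>j. j \<noteq> k \<Longrightarrow> z \<notin> ball (ctr j) (rho j)" using ball_index by metis
  have "profile_hess z h = 6 *\<^sub>R jordan z h + (eps * rho k) *\<^sub>R cap_hess (rescale k z) h" for h
    unfolding profile_hess_def using suminf_cap_hess_at[of k z h, OF k] by (simp add: cap_hess_at_def)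
  then show ?thesis
    by (intro linearI) (simp_all add: jordan.add_right jordan.scaleR_right linear_add[OF linear_cap_hess]
        linear_scale[OF linear_cap_hess] scaleR_add_right mult.commute)
qed

lemma lift_profile_hess_pair:
  fixes \<iota> :: "5 \<Rightarrow> 'n::finite"
  assumes C: "0 \<le> C" "\<And>y z h. \<not> (norm y < 1/2 \<and> norm z < 1/2) \<Longrightarrow>
      \<bar>cap_hess y h \<bullet> h - cap_hess z h \<bullet> h\<bar> \<le> C * norm (y - z) * (norm h)^2"
    and small: "eps * C \<le> 1/4" and inj: "inj \<iota>"
  shows "\<exists>e. norm e \<le> 1 \<and> elliptic_form 16 (lift_matrix \<iota> (profile_hess x) - lift_matrix \<iota> (profile_hess y)) e \<le> 0"
proof -
  obtain z where z: "norm z \<le> 1"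
    "(\<Sum>j\<in>UNIV. profile_hess x (axis j 1) \<bullet> axis j 1 - profile_hess y (axis j 1) \<bullet> axis j 1)
     + 16 * (profile_hess x z \<bullet> z - profile_hess y z \<bullet> z) \<le> 0"
    using profile_hess_pair[OF C small] by blast
  have q: "embed5 \<iota> z \<bullet> (lift_matrix \<iota> (profile_hess x) *v embed5 \<iota> z) = profile_hess x z \<bullet> z" for x
    by (simp add: lift_matrix_mult[OF linear_profile_hess] embed5_inner restrict5_embed5[OF inj] inner_commute)
  have "elliptic_form 16 (lift_matrix \<iota> (profile_hess x) - lift_matrix \<iota> (profile_hess y)) (embed5 \<iota> z) \<le> 0"
    using z(2)
    by (simp add: elliptic_form_def matrix_vector_mult_diff_rdistrib inner_diff_right q trace_sub
        trace_lift_matrix[OF linear_profile_hess inj] sum_subtractf)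
  then show ?thesis using z(1) norm_embed5[OF inj, of z] by (intro exI[of _ "embed5 \<iota> z"]) simp
qed

end

context cap_configuration
begin

definition lifted :: "(5 \<Rightarrow> 'n::finite) \<Rightarrow> real^'n \<Rightarrow> real" where "lifted \<iota> x = profile (restrict5 \<iota> x)"

lemma continuous_lifted: "continuous_on S (lifted \<iota>)"
  unfolding lifted_def
  by (rule continuous_on_compose2[OF continuous_at_imp_continuous_on[of UNIV profile]])
    (auto simp: isCont_profile linear_continuous_on linear_conv_bounded_linear[symmetric] linear_restrict5)

lemma lifted_second_difference:
  "has_second_difference (lifted \<iota>) x (lift_matrix \<iota> (profile_hess (restrict5 \<iota> x)))"
  unfolding has_second_difference_def
proof
  fix h
  have e: "h \<bullet> (lift_matrix \<iota> (profile_hess (restrict5 \<iota> x)) *v h)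
     = profile_hess (restrict5 \<iota> x) (restrict5 \<iota> h) \<bullet> restrict5 \<iota> h"
    unfolding lift_matrix_mult[OF linear_profile_hess] inner_commute[of h] embed5_inner ..
  show "((\<lambda>t. (lifted \<iota> (x + t *\<^sub>R h) + lifted \<iota> (x - t *\<^sub>R h) - 2 * lifted \<iota> x) / t^2) \<longlongrightarrow>
      h \<bullet> (lift_matrix \<iota> (profile_hess (restrict5 \<iota> x)) *v h)) (at_right 0)"
    unfolding e using profile_second_difference[of "restrict5 \<iota> x" "restrict5 \<iota> h"]
    by (simp add: lifted_def linear_add[OF linear_restrict5] linear_diff[OF linear_restrict5] linear_scale[OF linear_restrict5])
qed

lemma lifted_regular:
  fixes \<iota> :: "5 \<Rightarrow> 'n::finite"
  assumes "restrict5 \<iota> x \<notin> E" "restrict5 \<iota> x \<notin> range ctr"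
  obtains U where "x \<in> U" "C2_on U (lifted \<iota>)" "\<And>y. y \<in> U \<Longrightarrow> hessian (lifted \<iota>) y = lift_matrix \<iota> (profile_hess (restrict5 \<iota> y))"
proof -
  obtain N where N: "open N" "restrict5 \<iota> x \<in> N" "N \<inter> (E \<union> range ctr) = {}"
    "\<And>y. y \<in> N \<Longrightarrow> (profile has_derivative (\<lambda>h. profile_grad y \<bullet> h)) (at y)"
    "\<And>y. y \<in> N \<Longrightarrow> (profile_grad has_derivative profile_hess y) (at y)"
    "\<And>h. continuous_on N (\<lambda>y. profile_hess y h)" using profile_regular[OF assms] by metis
  define U where "U = restrict5 \<iota> -` N"
  have bl: "bounded_linear (restrict5 \<iota>)" "bounded_linear (embed5 \<iota>)"
    using linear_restrict5 linear_embed5 by (auto simp: linear_conv_bounded_linear)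
  have cont: "continuous_on S (restrict5 \<iota>)" for S by (rule linear_continuous_on[OF bl(1)])
  have U: "open U" "x \<in> U" unfolding U_def using N(1,2) cont by (auto intro: open_vimage)
  have d1: "(lifted \<iota> has_derivative (\<lambda>h. embed5 \<iota> (profile_grad (restrict5 \<iota> y)) \<bullet> h)) (at y)" if "y \<in> U" for y
    using has_derivative_compose[OF bounded_linear_imp_has_derivative[OF bl(1)] N(4)] that
    by (simp add: U_def lifted_def[abs_def] embed5_inner)
  have d2: "((\<lambda>y. embed5 \<iota> (profile_grad (restrict5 \<iota> y))) has_derivative (\<lambda>h. embed5 \<iota> (profile_hess (restrict5 \<iota> y) (restrict5 \<iota> h)))) (at y)"
    if "y \<in> U" for y
    using bounded_linear.has_derivative[OF bl(2) has_derivative_compose[OF bounded_linear_imp_has_derivative[OF bl(1)] N(5)]] that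
    by (simp add: U_def)
  have h: "hessian (lifted \<iota>) y = lift_matrix \<iota> (profile_hess (restrict5 \<iota> y))" "gradient (lifted \<iota>) differentiable at y"
    if "y \<in> U" for y
    using hessian_eq[OF U(1) that d1 d2[OF that]] by (simp_all add: lift_matrix_def)
  have "continuous_on U (\<lambda>y. lift_matrix \<iota> (profile_hess (restrict5 \<iota> y)))"
    unfolding lift_matrix_def matrix_def
  proof (intro continuous_on_vec_lambda)
    fix i j
    have "continuous_on U (\<lambda>y. profile_hess (restrict5 \<iota> y) (restrict5 \<iota> (axis j 1)))"
      by (rule continuous_on_compose2[OF N(6) cont]) (auto simp: U_def)
    then have "continuous_on U (\<lambda>y. embed5 \<iota> (profile_hess (restrict5 \<iota> y) (restrict5 \<iota> (axis j 1))))"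
      by (rule bounded_linear.continuous_on[OF bl(2)])
    then show "continuous_on U (\<lambda>y. embed5 \<iota> (profile_hess (restrict5 \<iota> y) (restrict5 \<iota> (axis j 1))) $ i)"
      by (intro continuous_intros)
  qed
  then have "continuous_on U (hessian (lifted \<iota>))"
    by (rule continuous_on_eq) (simp add: h)
  moreover have "lifted \<iota> differentiable_on U" "gradient (lifted \<iota>) differentiable_on U"
    unfolding differentiable_on_def
  proof safe
    fix y assume y: "y \<in> U"
    have w: "at y within U = at y" by (rule at_within_open[OF y U(1)])
    show "lifted \<iota> differentiable at y within U" unfolding w differentiable_def using d1[OF y] by blast
    show "gradient (lifted \<iota>) differentiable at y within U" unfolding w by (rule h(2)[OF y])
  qed
  ultimately have "C2_on U (lifted \<iota>)" using U(1) by (simp add: C2_on_def)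
  then show ?thesis using that U(2) h(1) by blast
qed

lemma hessian_lifted:
  assumes "restrict5 \<iota> x \<notin> E" "restrict5 \<iota> x \<notin> range ctr"
  shows "hessian (lifted \<iota>) x = lift_matrix \<iota> (profile_hess (restrict5 \<iota> x))"
  by (rule lifted_regular[OF assms]) blast

text \<open>Along a ray the Hessian near the apex tends to a limit that depends on the ray.
  Continuity would equate the limits along \<open>w\<close> and \<open>-w\<close>, but their cone
  parts are opposite and nonzero.\<close>

lemma not_C2_at_center:
  fixes \<iota> :: "5 \<Rightarrow> 'n::finite"
  assumes inj: "inj \<iota>" and x: "restrict5 \<iota> x = ctr k" "x \<in> U" and C2: "C2_on U (lifted \<iota>)"
  shows False
proof -
  obtain w h where wh: "cone_hessian (sym3 (sgn w)) (sym3 h) \<noteq> 0" using cone_hessian_nonzero by blast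
  have oU: "open U" and cU: "continuous_on U (hessian (lifted \<iota>))" using C2 by (auto simp: C2_on_def)
  have isc: "isCont (hessian (lifted \<iota>)) x" using cU oU x(2) continuous_on_eq_continuous_at by blast
  define B where "B = embed5 \<iota> h \<bullet> (hessian (lifted \<iota>) x *v embed5 \<iota> h)"
  have main: "B = 6 * (jordan (ctr k) h \<bullet> h) + eps * rho k * cone_hessian (sym3 (sgn v)) (sym3 h)" if v: "v \<noteq> 0" for v
  proof -
    have lx: "((\<lambda>t. x + t *\<^sub>R embed5 \<iota> v) \<longlongrightarrow> x) (at_right 0)"
      by (rule tendsto_eq_intros refl | simp)+
    have "((\<lambda>t. hessian (lifted \<iota>) (x + t *\<^sub>R embed5 \<iota> v)) \<longlongrightarrow> hessian (lifted \<iota>) x) (at_right 0)"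
      by (rule isCont_tendsto_compose[OF isc lx])
    then have l1: "((\<lambda>t. embed5 \<iota> h \<bullet> (hessian (lifted \<iota>) (x + t *\<^sub>R embed5 \<iota> v) *v embed5 \<iota> h)) \<longlongrightarrow> B) (at_right 0)"
      unfolding B_def matrix_vector_mult_def inner_vec_def by (auto intro!: tendsto_intros)
    have "((\<lambda>t. 6 * (jordan (ctr k) h \<bullet> h) + 6 * t * (jordan v h \<bullet> h) + eps * rho k * cone_hessian (sym3 (sgn v)) (sym3 h)) \<longlongrightarrow>
        6 * (jordan (ctr k) h \<bullet> h) + 6 * 0 * (jordan v h \<bullet> h) + eps * rho k * cone_hessian (sym3 (sgn v)) (sym3 h)) (at_right 0)"
      by (intro tendsto_intros)
    moreover have "\<forall>\<^sub>F t in at_right 0. 6 * (jordan (ctr k) h \<bullet> h) + 6 * t * (jordan v h \<bullet> h) + eps * rho k * cone_hessian (sym3 (sgn v)) (sym3 h)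
       = embed5 \<iota> h \<bullet> (hessian (lifted \<iota>) (x + t *\<^sub>R embed5 \<iota> v) *v embed5 \<iota> h)"
      unfolding eventually_at_right_field
    proof (intro exI[of _ "rho k / (2 * norm v)"] conjI allI impI)
      show "0 < rho k / (2 * norm v)" using v rho_pos[of k] by simp
      fix t assume t: "0 < t" "t < rho k / (2 * norm v)"
      have z: "restrict5 \<iota> (x + t *\<^sub>R embed5 \<iota> v) = ctr k + t *\<^sub>R v"
        by (simp add: linear_add[OF linear_restrict5] linear_scale[OF linear_restrict5] x restrict5_embed5[OF inj])
      have n: "norm (rescale k (ctr k + t *\<^sub>R v)) < 1/2"
        using t v rho_pos[of k] by (simp add: norm_rescale dist_norm field_simps)
      then have ib: "ctr k + t *\<^sub>R v \<in> ball (ctr k) (rho k)" using norm_rescale_lt[of k "ctr k + t *\<^sub>R v"] by simp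
      have "ctr k + t *\<^sub>R v \<notin> E"
      proof
        assume "ctr k + t *\<^sub>R v \<in> E"
        from far[OF this, of k] ib rho_pos[of k] show False by (simp add: dist_commute)
      qed
      moreover have "ctr k + t *\<^sub>R v \<notin> range ctr"
      proof
        assume "ctr k + t *\<^sub>R v \<in> range ctr"
        then obtain j where j: "ctr k + t *\<^sub>R v = ctr j" by blast
        then have "ctr j \<in> ball (ctr j) (rho j)" "ctr j \<in> ball (ctr k) (rho k)" using ib rho_pos[of j] by auto
        then have "j = k" by (rule in_ball_unique)
        then show False using j t v by simp
      qed
      ultimately have he: "hessian (lifted \<iota>) (x + t *\<^sub>R embed5 \<iota> v) = lift_matrix \<iota> (profile_hess (ctr k + t *\<^sub>R v))"
        using hessian_lifted[of \<iota> "x + t *\<^sub>R embed5 \<iota> v"] unfolding z by blast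
      have sg: "sgn (t *\<^sub>R v) = sgn v" using t by (simp add: sgn_scaleR)
      have "embed5 \<iota> h \<bullet> (hessian (lifted \<iota>) (x + t *\<^sub>R embed5 \<iota> v) *v embed5 \<iota> h) = profile_hess (ctr k + t *\<^sub>R v) h \<bullet> h"
        unfolding he lift_matrix_mult[OF linear_profile_hess] embed5_inner restrict5_embed5[OF inj] by (rule inner_commute)
      then show "6 * (jordan (ctr k) h \<bullet> h) + 6 * t * (jordan v h \<bullet> h) + eps * rho k * cone_hessian (sym3 (sgn v)) (sym3 h)
       = embed5 \<iota> h \<bullet> (hessian (lifted \<iota>) (x + t *\<^sub>R embed5 \<iota> v) *v embed5 \<iota> h)"
        unfolding profile_hess_inner_half_ball[OF n] by (simp add: model_hessian_def sg jordan.scaleR_left)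
    qed
    ultimately have "((\<lambda>t. embed5 \<iota> h \<bullet> (hessian (lifted \<iota>) (x + t *\<^sub>R embed5 \<iota> v) *v embed5 \<iota> h)) \<longlongrightarrow>
        6 * (jordan (ctr k) h \<bullet> h) + 6 * 0 * (jordan v h \<bullet> h) + eps * rho k * cone_hessian (sym3 (sgn v)) (sym3 h)) (at_right 0)"
      by (rule Lim_transform_eventually)
    from tendsto_unique[OF _ l1 this] show ?thesis by simp
  qed
  have "w \<noteq> 0"
  proof
    assume "w = 0"
    have "sym3 0 = 0" by (rule linear_0[OF linear_sym3])
    moreover have "cone_hessian 0 (sym3 h) = 0" using cone_hessian_uminus[of 0 "sym3 h"] by simp
    ultimately show False using wh \<open>w = 0\<close> by simp
  qed
  then have "- w \<noteq> 0" by simp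
  have "eps * rho k * cone_hessian (sym3 (sgn w)) (sym3 h) = eps * rho k * cone_hessian (sym3 (sgn (- w))) (sym3 h)"
    using main[OF \<open>w \<noteq> 0\<close>] main[OF \<open>- w \<noteq> 0\<close>] by linarith
  also have "cone_hessian (sym3 (sgn (- w))) (sym3 h) = - cone_hessian (sym3 (sgn w)) (sym3 h)"
    by (simp add: sgn_minus linear_neg[OF linear_sym3] cone_hessian_uminus)
  finally show False using wh eps_pos rho_pos[of k] by simp
qed

lemma Sing_lifted:
  fixes \<iota> :: "5 \<Rightarrow> 'n::finite"
  assumes inj: "inj \<iota>"
  shows "Sing (lifted \<iota>) = {x \<in> ball 0 1. restrict5 \<iota> x \<in> E \<union> range ctr}"
proof (intro equalityI subsetI)
  fix x assume x: "x \<in> Sing (lifted \<iota>)"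
  then have b: "x \<in> ball 0 1" and n: "\<not> (\<exists>U. x \<in> U \<and> U \<subseteq> ball 0 1 \<and> C2_on U (lifted \<iota>))"
    unfolding Sing_def by auto
  have "restrict5 \<iota> x \<in> E \<union> range ctr"
  proof (rule ccontr)
    assume "\<not> ?thesis"
    then have out: "restrict5 \<iota> x \<notin> E" "restrict5 \<iota> x \<notin> range ctr" by auto
    obtain U where U: "x \<in> U" "C2_on U (lifted \<iota>)" by (rule lifted_regular[OF out])
    have "C2_on (U \<inter> ball 0 1) (lifted \<iota>)"
      unfolding C2_on_def
    proof (intro conjI)
      show "open (U \<inter> ball 0 1)" using U(2) by (simp add: C2_on_def open_Int)
      show "lifted \<iota> differentiable_on U \<inter> ball 0 1" "gradient (lifted \<iota>) differentiable_on U \<inter> ball 0 1"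
        using U(2) differentiable_on_subset[OF _ Int_lower1] unfolding C2_on_def by blast+
      show "continuous_on (U \<inter> ball 0 1) (hessian (lifted \<iota>))"
        using U(2) continuous_on_subset[OF _ Int_lower1] unfolding C2_on_def by blast
    qed
    moreover have "x \<in> U \<inter> ball 0 1" "U \<inter> ball 0 1 \<subseteq> ball 0 1" using U(1) b by auto
    ultimately show False using n by blast
  qed
  then show "x \<in> {x \<in> ball 0 1. restrict5 \<iota> x \<in> E \<union> range ctr}" using b by simp
next
  fix x assume x: "x \<in> {x \<in> ball 0 1. restrict5 \<iota> x \<in> E \<union> range ctr}"
  show "x \<in> Sing (lifted \<iota>)"
    unfolding Sing_def
  proof (intro CollectI conjI notI)
    show "x \<in> ball 0 1" using x by simp
    assume "\<exists>U. x \<in> U \<and> U \<subseteq> ball 0 1 \<and> C2_on U (lifted \<iota>)"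
    then obtain U where U: "x \<in> U" "C2_on U (lifted \<iota>)" by blast
    then have "open U" by (simp add: C2_on_def)
    then obtain d where d: "d > 0" "ball x d \<subseteq> U" using U(1) open_contains_ball by blast
    have "restrict5 \<iota> x \<in> closure (range ctr)" using x dense closure_subset by blast
    then obtain k where k: "dist (ctr k) (restrict5 \<iota> x) < d" using d(1) unfolding closure_approachable by blast
    \<comment> \<open>A correction in the five active coordinates moves \<open>x\<close> over a
      nearby apex; since \<open>embed5\<close> is isometric, \<open>y\<close> stays within
      \<open>d\<close> of \<open>x\<close>.\<close>
    define y where "y = x + embed5 \<iota> (ctr k - restrict5 \<iota> x)"
    have "dist x y < d" using k by (simp add: y_def dist_norm norm_embed5[OF inj] norm_minus_commute)
    then have "y \<in> U" using d(2) by auto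
    moreover have "restrict5 \<iota> y = ctr k"
      by (simp add: y_def linear_add[OF linear_restrict5] restrict5_embed5[OF inj])
    ultimately show False using not_C2_at_center[OF inj _ _ U(2)] by blast
  qed
qed

end

text \<open>The order of quantifiers matters: \<open>eps\<close> depends only on the Lipschitz
  constant of one cap, so the configuration may be chosen afterwards.\<close>

lemma singular_solution_exists:
  "\<exists>eps>0. \<forall>(\<iota> :: 5 \<Rightarrow> 'n::finite) ctr rho E near. inj \<iota> \<longrightarrow> cap_configuration eps ctr rho E near \<longrightarrow>
    (\<exists>(F :: real^'n^'n \<Rightarrow> real) u. uniformly_elliptic F \<and> viscosity_solution F u \<and>
      Sing u = {x \<in> ball 0 1. restrict5 \<iota> x \<in> E \<union> range ctr})"
proof -
  obtain C where C: "0 \<le> C" "\<And>y z h. \<not> (norm y < 1/2 \<and> norm z < 1/2) \<Longrightarrow>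
      \<bar>cap_hess y h \<bullet> h - cap_hess z h \<bullet> h\<bar> \<le> C * norm (y - z) * (norm h)^2"
    using cap_hess_lipschitz by metis
  define eps where "eps = 1 / (4 * (C + 1))"
  have eps: "eps > 0" "eps * C \<le> 1/4" using C(1) by (auto simp: eps_def field_simps)
  show ?thesis
  proof (intro exI[of _ eps] conjI allI impI)
    fix \<iota> :: "5 \<Rightarrow> 'n" and ctr rho E near
    assume inj: "inj \<iota>" and cc: "cap_configuration eps ctr rho E near"
    interpret cap_configuration eps ctr rho E near by fact
    \<comment> \<open>The family is indexed by all of five-space, so the operator does not depend on
      which Hessians occur over the unit ball.\<close>
    define A where "A z = lift_matrix \<iota> (profile_hess z)" for z
    have pair: "\<exists>e. norm e \<le> 1 \<and> elliptic_form 16 (A x - A y) e \<le> 0" for x y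
      unfolding A_def by (rule lift_profile_hess_pair[OF C eps(2) inj])
    have "viscosity_solution (envelope_operator 16 A) (lifted \<iota>)"
      by (rule viscosity_solution_envelope[OF _ pair continuous_lifted])
        (use lifted_second_difference in \<open>auto simp: A_def\<close>)
    moreover have "uniformly_elliptic (envelope_operator 16 A)"
      by (rule envelope_operator_uniformly_elliptic[OF _ pair]) simp
    ultimately show "\<exists>(F :: real^'n^'n \<Rightarrow> real) u. uniformly_elliptic F \<and> viscosity_solution F u \<and>
      Sing u = {x \<in> ball 0 1. restrict5 \<iota> x \<in> E \<union> range ctr}"
      using Sing_lifted[OF inj] by blast
  qed (rule eps(1))
qed

subsection \<open>Prescribing the singular set\<close>

lemma separable_enumeration:
  fixes E :: "'a::euclidean_space set"
  assumes "E \<noteq> {}"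
  obtains d :: "nat \<Rightarrow> 'a" where "range d \<subseteq> E" "E \<subseteq> closure (range d)"
proof -
  obtain T where T: "countable T" "T \<subseteq> E" "E \<subseteq> closure T" using separable[of E] by metis
  then have "T \<noteq> {}" using assms by auto
  then show ?thesis using that[of "from_nat_into T"] T range_from_nat_into[OF \<open>T \<noteq> {}\<close> T(1)] by simp
qed

text \<open>Balls are chosen one after another in the complement of \<open>E\<close> and of all
  earlier doubled balls, each close to a prescribed point of \<open>E\<close>.\<close>

lemma cap_configuration_exists:
  fixes E :: "(real^5) set"
  assumes E: "closed E" "E \<noteq> {}" "interior E = {}" and eps: "eps > 0"
  shows "\<exists>ctr rho near. cap_configuration eps ctr rho E near"
proof -
  obtain d :: "nat \<Rightarrow> real^5" where d: "range d \<subseteq> E" "E \<subseteq> closure (range d)" by (rule separable_enumeration[OF E(2)])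
  \<comment> \<open>Decoding pairs makes each \<open>d i\<close> a target for arbitrarily large
    \<open>k\<close>, hence with arbitrarily small tolerance; this yields density of the
    centres.\<close>
  define near where "near k = d (fst (prod_decode k))" for k
  have nE: "near k \<in> E" for k using d by (auto simp: near_def)
  \<comment> \<open>The state consists of a centre, a radius and a closed set that accumulates all
    doubled balls chosen so far.\<close>
  define P where "P n x \<longleftrightarrow> (case x of (c, r, B) \<Rightarrow> closed B \<and> B \<inter> E = {} \<and> 0 < r \<and> r \<le> inverse (real (Suc n)) \<and>
     dist c (near n) \<le> inverse (real (Suc n)) \<and> cball c (2 * r) \<subseteq> B \<and> (\<forall>z\<in>E. 2 * r \<le> dist z c))"
    for n and x :: "(real^5) \<times> real \<times> (real^5) set"
  define Q where "Q n x y \<longleftrightarrow> (case (x, y) of ((c, r, B), (c', r', B')) \<Rightarrow> B \<subseteq> B' \<and> cball c' (2 * r') \<inter> B = {})"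
    for n :: nat and x y :: "(real^5) \<times> real \<times> (real^5) set"
  have step: "\<exists>c r. P n (c, r, B \<union> cball c (2 * r)) \<and> cball c (2 * r) \<inter> B = {}" if B: "closed B" "B \<inter> E = {}" for n B
  proof -
    define i where "i = inverse (real (Suc n))"
    have i: "i > 0" by (simp add: i_def)
    have "open (- B \<inter> ball (near n) i)" using B by (intro open_Int open_Compl) auto
    moreover have "near n \<in> - B \<inter> ball (near n) i" using B nE i by auto
    \<comment> \<open>The empty interior of \<open>E\<close> enters here: no neighbourhood of the
      target can be filled by \<open>E\<close>.\<close>
    ultimately have "\<not> - B \<inter> ball (near n) i \<subseteq> E" using interior_maximal[of "- B \<inter> ball (near n) i" E] E(3) by blast
    then obtain c where c: "c \<notin> B" "c \<in> ball (near n) i" "c \<notin> E" by blast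
    have "open (- (B \<union> E))" using B E by (intro open_Compl closed_Un)
    then obtain e where e: "e > 0" "cball c e \<subseteq> - (B \<union> E)" using c open_contains_cball by (metis ComplI UnE)
    define r where "r = min (e/2) i"
    have r: "0 < r" "r \<le> i" "2 * r \<le> e" using e i by (auto simp: r_def)
    then have sub: "cball c (2 * r) \<subseteq> - (B \<union> E)" using e(2) subset_cball[of "2 * r" e c] by blast
    moreover have "2 * r \<le> dist z c" if "z \<in> E" for z
      using sub that by (force simp: dist_commute)
    ultimately have "P n (c, r, B \<union> cball c (2 * r))"
      using B r c(2) unfolding P_def prod.case i_def[symmetric] by (auto simp: dist_commute)
    then show ?thesis using sub by blast
  qed
  have "\<exists>x. \<forall>n. P n (x n) \<and> Q n (x n) (x (Suc n))"
  proof (rule dependent_nat_choice)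
    show "\<exists>x. P 0 x" using step[of "{}" 0] by auto
    fix x n assume Px: "P n x"
    obtain c r B where x: "x = (c, r, B)" by (cases x)
    have "closed B" "B \<inter> E = {}" using Px by (simp_all add: x P_def)
    then obtain c' r' where "P (Suc n) (c', r', B \<union> cball c' (2 * r'))" "cball c' (2 * r') \<inter> B = {}"
      using step[of B "Suc n"] by blast
    then show "\<exists>y. P (Suc n) y \<and> Q n x y"
      by (intro exI[of _ "(c', r', B \<union> cball c' (2 * r'))"]) (simp add: Q_def x)
  qed
  then obtain x where x: "\<And>n. P n (x n)" "\<And>n. Q n (x n) (x (Suc n))" by blast
  define ctr rho B where "ctr n = fst (x n)" "rho n = fst (snd (x n))" "B n = snd (snd (x n))" for n
  have xn: "x n = (ctr n, rho n, B n)" for n by (simp add: ctr_rho_B_def)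
  have p: "0 < rho n" "rho n \<le> inverse (real (Suc n))" "dist (ctr n) (near n) \<le> inverse (real (Suc n))"
    "cball (ctr n) (2 * rho n) \<subseteq> B n" "\<And>z. z \<in> E \<Longrightarrow> 2 * rho n \<le> dist z (ctr n)" for n
    using x(1)[of n] by (auto simp: xn P_def)
  have q: "B n \<subseteq> B (Suc n)" "cball (ctr (Suc n)) (2 * rho (Suc n)) \<inter> B n = {}" for n
    using x(2)[of n] by (auto simp: xn Q_def)
  have mono: "B m \<subseteq> B n" if "m \<le> n" for m n using q(1) that by (rule lift_Suc_mono_le)
  have lt: "rho j + rho k \<le> dist (ctr j) (ctr k)" if jk: "j < k" for j k
  proof -
    obtain m where m: "k = Suc m" "j \<le> m" using jk by (cases k) auto
    have dis: "cball (ctr k) (2 * rho k) \<inter> cball (ctr j) (2 * rho j) = {}"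
      using q(2)[of m] p(4)[of j] mono[OF m(2)] unfolding m(1) by blast
    have "ctr j \<in> cball (ctr j) (2 * rho j)" "ctr k \<in> cball (ctr k) (2 * rho k)"
      using p(1)[of j] p(1)[of k] by auto
    \<comment> \<open>Each centre lies outside the doubled ball of the other, so the distance
      exceeds twice the larger radius.\<close>
    then have "ctr j \<notin> cball (ctr k) (2 * rho k)" "ctr k \<notin> cball (ctr j) (2 * rho j)" using dis by blast+
    then show ?thesis by (simp add: dist_commute)
  qed
  have dis: "rho j + rho k \<le> dist (ctr j) (ctr k)" if "j \<noteq> k" for j k
    using lt[of j k] lt[of k j] that by (cases "j < k") (auto simp: dist_commute)
  have "E \<subseteq> closure (range ctr)"
  proof
    fix z assume z: "z \<in> E"
    show "z \<in> closure (range ctr)" unfolding closure_approachable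
    proof (intro allI impI)
      fix e :: real assume e: "e > 0"
      have "z \<in> closure (range d)" using d(2) z by blast
      then obtain i where i: "dist (d i) z < e/2" using e unfolding closure_approachable by (metis half_gt_zero rangeE)
      obtain m :: nat where m: "inverse (real (Suc m)) < e/2" using reals_Archimedean[of "e/2"] e by auto
      define k where "k = prod_encode (i, m)"
      have "m \<le> k" unfolding k_def by (rule le_prod_encode_2)
      then have "inverse (real (Suc k)) \<le> inverse (real (Suc m))" by simp
      moreover have nk: "near k = d i" by (simp add: near_def k_def)
      have "dist (ctr k) (d i) \<le> inverse (real (Suc k))" using p(3)[of k] unfolding nk .
      ultimately have "dist (ctr k) (d i) < e/2" using m by linarith
      then have "dist (ctr k) z < e" using i dist_triangle[of "ctr k" z "d i"] by linarith
      then show "\<exists>y\<in>range ctr. dist y z < e" by blast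
    qed
  qed
  then have "cap_configuration eps ctr rho E near"
    using eps p dis nE E(1) by unfold_locales auto
  then show ?thesis by blast
qed

lemma coordinate_preimage_closed_empty_interior:
  fixes K :: "real set" and j :: "'n::finite"
  assumes "closed K" "interior K = {}"
  shows "closed {z :: real^'n. z $ j \<in> K}" "interior {z :: real^'n. z $ j \<in> K} = {}"
proof -
  have "closed ((\<lambda>z :: real^'n. z $ j) -` K)"
    by (rule closed_vimage[OF assms(1)]) (intro continuous_intros)
  then show "closed {z :: real^'n. z $ j \<in> K}" by (simp add: vimage_def)
  show "interior {z :: real^'n. z $ j \<in> K} = {}"
  proof (rule ccontr)
    assume "\<not> ?thesis"
    then obtain z where "z \<in> interior {z :: real^'n. z $ j \<in> K}" by blast
    then obtain e where e: "e > 0" "ball z e \<subseteq> {z. z $ j \<in> K}" unfolding mem_interior by blast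
    have "ball (z $ j) e \<subseteq> K"
    proof
      fix r assume r: "r \<in> ball (z $ j) e"
      have "axis j (r - z $ j) = (r - z $ j) *\<^sub>R (axis j 1 :: real^'n)" by (simp add: axis_def vec_eq_iff)
      then have "norm (axis j (r - z $ j) :: real^'n) = \<bar>r - z $ j\<bar>" by simp
      then have "z + axis j (r - z $ j) \<in> ball z e" using r by (simp add: dist_norm abs_minus_commute)
      then have "(z + axis j (r - z $ j)) $ j \<in> K" using e(2) by blast
      then show "r \<in> K" by (simp add: axis_def)
    qed
    then have "z $ j \<in> interior K" using e(1) unfolding mem_interior by blast
    then show False using assms(2) by simp
  qed
qed

lemma singular_set_exists:
  fixes \<iota> :: "5 \<Rightarrow> 'n::finite"
  assumes "inj \<iota>" "closed E" "E \<noteq> {}" "interior E = {}"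
  obtains F :: "real^'n^'n \<Rightarrow> real" and u ctr where "uniformly_elliptic F" "viscosity_solution F u"
    "Sing u = {x \<in> ball 0 1. restrict5 \<iota> x \<in> E \<union> range (ctr :: nat \<Rightarrow> real^5)}"
proof -
  obtain eps0 where e: "eps0 > 0" "\<forall>(\<iota> :: 5 \<Rightarrow> 'n) ctr rho E near. inj \<iota> \<longrightarrow> cap_configuration eps0 ctr rho E near \<longrightarrow>
    (\<exists>(F :: real^'n^'n \<Rightarrow> real) u. uniformly_elliptic F \<and> viscosity_solution F u \<and>
      Sing u = {x \<in> ball 0 1. restrict5 \<iota> x \<in> E \<union> range ctr})"
    using singular_solution_exists by blast
  obtain ctr rho near where "cap_configuration eps0 ctr rho E near"
    using cap_configuration_exists[OF assms(2-4) e(1)] by blast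
  then obtain F :: "real^'n^'n \<Rightarrow> real" and u where "uniformly_elliptic F" "viscosity_solution F u"
      "Sing u = {x \<in> ball 0 1. restrict5 \<iota> x \<in> E \<union> range ctr}"
    using e(2) assms(1) by blast
  then show ?thesis by (rule that)
qed

subsection \<open>Hausdorff measure estimates\<close>

lemma hausdorff_dim_eqI:
  assumes "0 \<le> s" "\<And>r. s < r \<Longrightarrow> hausdorff_measure r A = 0"
    and "\<And>r. 0 \<le> r \<Longrightarrow> r < s \<Longrightarrow> hausdorff_measure r A \<noteq> 0"
  shows "hausdorff_dim A = ereal s"
  unfolding hausdorff_dim_def
proof (rule antisym)
  show "Inf {ereal s |s. 0 \<le> s \<and> hausdorff_measure s A = 0} \<le> ereal s"
  proof (rule ereal_le_epsilon2)
    fix e :: real assume "0 < e"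
    then have "ereal (s + e) \<in> {ereal s |s. 0 \<le> s \<and> hausdorff_measure s A = 0}" using assms(1,2) by auto
    then show "Inf {ereal s |s. 0 \<le> s \<and> hausdorff_measure s A = 0} \<le> ereal s + ereal e" 
      by (auto intro: Inf_lower)
  qed
  show "ereal s \<le> Inf {ereal s |s. 0 \<le> s \<and> hausdorff_measure s A = 0}"
    using assms(3) by (intro Inf_greatest) (force simp: not_less[symmetric])
qed

lemma hausdorff_premeasure_le:
  assumes "A \<subseteq> (\<Union>i. U i)" "\<And>i. bounded (U i)" "\<And>i. diameter (U i) \<le> \<delta>"
  shows "hausdorff_premeasure s \<delta> A \<le> (\<Sum>i. diam_pow s (U i))"
  unfolding hausdorff_premeasure_def using assms by (intro Inf_lower) auto

lemma hausdorff_measure_eq_0_iff: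
  "hausdorff_measure s A = 0 \<longleftrightarrow> (\<forall>\<delta>>0. hausdorff_premeasure s \<delta> A = 0)"
  using SUP_bot_conv(1)[of "\<lambda>\<delta>. hausdorff_premeasure s \<delta> A" "{0<..}"]
  by (auto simp: hausdorff_measure_def bot_ennreal)

lemma hausdorff_premeasure_zeroE:
  assumes "hausdorff_premeasure s \<delta> A = 0" "e > 0"
  obtains U where "A \<subseteq> (\<Union>i. U i)" "\<And>i. bounded (U i)" "\<And>i. diameter (U i) \<le> \<delta>" "(\<Sum>i. diam_pow s (U i)) < e"
proof -
  have "hausdorff_premeasure s \<delta> A < e" using assms by simp
  then show ?thesis unfolding hausdorff_premeasure_def Inf_less_iff using that by blast
qed

lemma hausdorff_measure_countable_Union_0:
  fixes A :: "nat \<Rightarrow> 'a::metric_space set"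
  assumes "\<And>k. hausdorff_measure s (A k) = 0"
  shows "hausdorff_measure s (\<Union>k. A k) = 0"
  unfolding hausdorff_measure_eq_0_iff
proof (intro allI impI)
  fix \<delta> :: real assume d: "\<delta> > 0"
  have le: "hausdorff_premeasure s \<delta> (\<Union>k. A k) \<le> 0 + ennreal e" if e: "e > 0" for e :: real
  proof -
    have pos: "0 < ennreal (e * (1/2) ^ Suc k)" for k using e by simp
    have "\<exists>U. A k \<subseteq> (\<Union>i. U i) \<and> (\<forall>i. bounded (U i)) \<and> (\<forall>i. diameter (U i) \<le> \<delta>)
        \<and> (\<Sum>i. diam_pow s (U i)) < ennreal (e * (1/2) ^ Suc k)" for k
      using hausdorff_premeasure_zeroE[OF _ pos[of k]] assms[of k] d unfolding hausdorff_measure_eq_0_iff by metis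
    then obtain U where U: "\<And>k. A k \<subseteq> (\<Union>i. U k i)" "\<And>k i. bounded (U k i)" "\<And>k i. diameter (U k i) \<le> \<delta>"
      "\<And>k. (\<Sum>i. diam_pow s (U k i)) < ennreal (e * (1/2) ^ Suc k)" by metis
    define V where "V n = (case prod_decode n of (k, i) \<Rightarrow> U k i)" for n
    have "(\<Union>k. A k) \<subseteq> (\<Union>n. V n)"
    proof
      fix x assume "x \<in> (\<Union>k. A k)"
      then obtain k i where "x \<in> U k i" using U(1) by blast
      then have "x \<in> V (prod_encode (k, i))" by (simp add: V_def)
      then show "x \<in> (\<Union>n. V n)" by blast
    qed
    then have "hausdorff_premeasure s \<delta> (\<Union>k. A k) \<le> (\<Sum>n. diam_pow s (V n))"
      by (rule hausdorff_premeasure_le) (auto simp: V_def U split: prod.split)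
    also have "\<dots> = (\<Sum>n. (\<lambda>(k, i). diam_pow s (U k i)) (prod_decode n))"
      by (rule suminf_cong) (simp add: V_def split: prod.split)
    also have "\<dots> = (\<Sum>k. \<Sum>i. diam_pow s (U k i))" by (rule suminf_ennreal_2dimen) simp
    also have "\<dots> \<le> (\<Sum>k. ennreal (e * (1/2) ^ Suc k))"
      using U(4) by (intro suminf_le) (auto intro: less_imp_le)
    also have "\<dots> = ennreal e"
    proof -
      have "(\<lambda>k. e * (1/2) ^ Suc k) sums (e * 1)" by (intro sums_mult power_half_series)
      then show ?thesis using e by (subst suminf_ennreal2) (auto simp: sums_iff)
    qed
    finally show ?thesis by simp
  qed
  have "hausdorff_premeasure s \<delta> (\<Union>k. A k) \<le> 0" by (rule ennreal_le_epsilon) (rule le)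
  then show "hausdorff_premeasure s \<delta> (\<Union>k. A k) = 0" by simp
qed

lemma hausdorff_measure_mono_0:
  assumes "hausdorff_measure s B = 0" "A \<subseteq> B"
  shows "hausdorff_measure s A = 0"
  unfolding hausdorff_measure_eq_0_iff
proof (intro allI impI)
  fix \<delta> :: real assume d: "\<delta> > 0"
  have "hausdorff_premeasure s \<delta> A \<le> hausdorff_premeasure s \<delta> B"
    unfolding hausdorff_premeasure_def using assms(2) by (intro Inf_superset_mono) blast
  then show "hausdorff_premeasure s \<delta> A = 0" using assms(1) d by (simp add: hausdorff_measure_eq_0_iff)
qed

lemma hausdorff_measure_0_finite_covers:
  assumes s: "0 < s" and cov: "\<And>e. 0 < e \<Longrightarrow> \<exists>\<F> d. finite \<F> \<and> A \<subseteq> \<Union>\<F> \<and> 0 < d \<and> d \<le> e \<and>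
     (\<forall>U\<in>\<F>. bounded U \<and> diameter U \<le> d) \<and> real (card \<F>) * d powr s \<le> e"
  shows "hausdorff_measure s A = 0"
  unfolding hausdorff_measure_eq_0_iff
proof (intro allI impI)
  fix \<delta> :: real assume d: "\<delta> > 0"
  have le: "hausdorff_premeasure s \<delta> A \<le> 0 + ennreal e" if e: "e > 0" for e :: real
  proof -
    obtain \<F> r where F: "finite \<F>" "A \<subseteq> \<Union>\<F>" "0 < r" "r \<le> min e \<delta>"
      "\<And>U. U \<in> \<F> \<Longrightarrow> bounded U" "\<And>U. U \<in> \<F> \<Longrightarrow> diameter U \<le> r" "real (card \<F>) * r powr s \<le> min e \<delta>"
      using cov[of "min e \<delta>"] e d by auto
    obtain f where f: "bij_betw f {..<card \<F>} \<F>" using ex_bij_betw_nat_finite[OF F(1)] by (auto simp: atLeast0LessThan)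
    \<comment> \<open>Padding with empty sets costs nothing, by the convention for
      \<open>diam_pow\<close>.\<close>
    define V where "V i = (if i < card \<F> then f i else {})" for i
    have fin: "f i \<in> \<F>" if "i < card \<F>" for i using f that by (auto simp: bij_betw_def)
    have "A \<subseteq> (\<Union>i. V i)"
    proof
      fix x assume "x \<in> A"
      then obtain U where "U \<in> \<F>" "x \<in> U" using F(2) by blast
      moreover then obtain i where "i < card \<F>" "U = f i" using f by (auto simp: bij_betw_def)
      ultimately show "x \<in> (\<Union>i. V i)" by (auto simp: V_def intro!: exI[of _ i])
    qed
    then have "hausdorff_premeasure s \<delta> A \<le> (\<Sum>i. diam_pow s (V i))"
    proof (rule hausdorff_premeasure_le)
      fix i
      show "bounded (V i)" using F(5) fin by (simp add: V_def)
      show "diameter (V i) \<le> \<delta>" using F(4) F(6)[OF fin, of i] d by (auto simp: V_def)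
    qed
    also have "\<dots> = (\<Sum>i<card \<F>. diam_pow s (V i))"
      by (rule suminf_finite) (auto simp: V_def diam_pow_def)
    also have "\<dots> \<le> (\<Sum>i<card \<F>. ennreal (r powr s))"
    proof (rule sum_mono)
      fix i assume "i \<in> {..<card \<F>}"
      then have "V i \<in> \<F>" using fin by (simp add: V_def)
      then have "diameter (V i) powr s \<le> r powr s"
        using F(5,6) s by (intro powr_mono2) (auto simp: diameter_ge_0)
      then show "diam_pow s (V i) \<le> ennreal (r powr s)" using s by (auto simp: diam_pow_def intro: ennreal_leI)
    qed
    also have "\<dots> = ennreal (real (card \<F>) * r powr s)" by (simp add: ennreal_mult ennreal_of_nat_eq_real_of_nat)
    also have "\<dots> \<le> ennreal e" using F(7) by (intro ennreal_leI) simp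
    finally show ?thesis by simp
  qed
  have "hausdorff_premeasure s \<delta> A \<le> 0" by (rule ennreal_le_epsilon) (rule le)
  then show "hausdorff_premeasure s \<delta> A = 0" by simp
qed

lemma hausdorff_measure_0_product:
  fixes A :: "'n::finite \<Rightarrow> real set"
  assumes s: "0 < s" and cov: "\<And>e. 0 < e \<Longrightarrow> \<exists>F d. 0 < d \<and> d \<le> e \<and> (\<forall>i. finite (F i) \<and> (\<forall>x\<in>A i. \<exists>f\<in>F i. \<bar>x - f\<bar> \<le> d)) \<and>
     real (\<Prod>i\<in>UNIV. card (F i)) * d powr s \<le> e"
  shows "hausdorff_measure s {x :: real^'n. \<forall>i. x $ i \<in> A i} = 0"
proof (rule hausdorff_measure_0_finite_covers[OF s])
  fix e :: real assume e: "e > 0"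
  \<comment> \<open>A cube with sides \<open>2 * d\<close> has diameter at most
    \<open>M * d\<close>, by comparison with the l1 norm; \<open>e'\<close> then absorbs
    \<open>M\<close> and \<open>M powr s\<close>.\<close>
  define M where "M = 2 * real CARD('n)"
  have "real CARD('n) \<ge> 1" by (simp add: Suc_leI)
  then have M: "M \<ge> 1" unfolding M_def by linarith
  have Mp: "M powr s > 0" using M by simp
  define e' where "e' = min (e / M) (e / M powr s)"
  have e': "e' > 0" "M * e' \<le> e" "M powr s * e' \<le> e"
    using e M Mp by (auto simp: e'_def min_def field_simps)
  obtain F d where F: "0 < d" "d \<le> e'" "\<And>i. finite (F i)" "\<And>i x. x \<in> A i \<Longrightarrow> \<exists>f\<in>F i. \<bar>x - f\<bar> \<le> d"
    "real (\<Prod>i\<in>UNIV. card (F i)) * d powr s \<le> e'"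
    using cov[OF e'(1)] by blast
  define \<F> where "\<F> = (\<lambda>\<phi>. cbox (\<chi> i. \<phi> i - d) (\<chi> i. \<phi> i + d) :: (real^'n) set) ` Pi\<^sub>E UNIV F"
  have fin: "finite \<F>" unfolding \<F>_def using F(3) by (intro finite_imageI finite_PiE) auto
  have "card \<F> \<le> card (Pi\<^sub>E UNIV F)" unfolding \<F>_def using F(3) by (intro card_image_le finite_PiE) auto
  then have card: "card \<F> \<le> (\<Prod>i\<in>UNIV. card (F i))" by (simp add: card_PiE)
  have sub: "{x :: real^'n. \<forall>i. x $ i \<in> A i} \<subseteq> \<Union>\<F>"
  proof
    fix x :: "real^'n" assume "x \<in> {x. \<forall>i. x $ i \<in> A i}"
    then have "\<forall>i. \<exists>f\<in>F i. \<bar>x $ i - f\<bar> \<le> d" using F(4) by blast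
    then obtain \<phi> where p: "\<And>i. \<phi> i \<in> F i" "\<And>i. \<bar>x $ i - \<phi> i\<bar> \<le> d" by metis
    then have "x \<in> cbox (\<chi> i. \<phi> i - d) (\<chi> i. \<phi> i + d)" by (auto simp: mem_box_cart abs_le_iff algebra_simps)
    moreover have "\<phi> \<in> Pi\<^sub>E UNIV F" using p by auto
    ultimately show "x \<in> \<Union>\<F>" unfolding \<F>_def by blast
  qed
  have diam: "bounded U \<and> diameter U \<le> M * d" if UF: "U \<in> \<F>" for U
  proof
    obtain \<phi> :: "'n \<Rightarrow> real" where U: "U = cbox (\<chi> i. \<phi> i - d) (\<chi> i. \<phi> i + d)" using UF unfolding \<F>_def by blast
    then show "bounded U" by (simp add: bounded_cbox)
    show "diameter U \<le> M * d"
    proof (rule diameter_le)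
      show "U \<noteq> {} \<or> 0 \<le> M * d" using F(1) M by simp
      fix x y assume "x \<in> U" "y \<in> U"
      then have c: "\<bar>(x - y) $ i\<bar> \<le> 2 * d" for i
        unfolding U mem_box_cart by (auto simp: abs_le_iff) (smt (verit))+
      have "norm (x - y) \<le> (\<Sum>i\<in>UNIV. \<bar>(x - y) $ i\<bar>)" by (rule norm_le_l1_cart)
      also have "\<dots> \<le> (\<Sum>i\<in>(UNIV::'n set). 2 * d)" by (intro sum_mono c)
      finally show "norm (x - y) \<le> M * d" by (simp add: M_def)
    qed
  qed
  have "real (card \<F>) * (M * d) powr s \<le> real (\<Prod>i\<in>UNIV. card (F i)) * (M * d) powr s"
    using card by (intro mult_right_mono) (auto simp only: of_nat_le_iff powr_ge_zero)
  also have "\<dots> = M powr s * (real (\<Prod>i\<in>UNIV. card (F i)) * d powr s)"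
    using M F(1) by (simp add: powr_mult)
  also have "\<dots> \<le> M powr s * e'" using F(5) by (intro mult_left_mono) auto
  also have "\<dots> \<le> e" by (rule e'(3))
  finally have "real (card \<F>) * (M * d) powr s \<le> e" .
  moreover have "M * d \<le> e" using F(2) e'(2) M mult_left_mono[OF F(2), of M] by linarith
  moreover have "0 < M * d" using M F(1) by simp
  ultimately show "\<exists>\<F> d. finite \<F> \<and> {x :: real^'n. \<forall>i. x $ i \<in> A i} \<subseteq> \<Union>\<F> \<and> 0 < d \<and> d \<le> e \<and>
     (\<forall>U\<in>\<F>. bounded U \<and> diameter U \<le> d) \<and> real (card \<F>) * d powr s \<le> e"
    using fin sub diam by blast
qed

text \<open>Lower bounds on Hausdorff measure by comparing with Lebesgue measure through an anisotropic
  inverse Hoelder parametrization; \<open>a i = 0\<close> only asks for boundedness of the coordinate \<open>i\<close>.\<close>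

lemma hausdorff_measure_nonzero:
  fixes T :: "(real^'n::finite) set" and g :: "real^'n \<Rightarrow> 'b::metric_space"
  assumes T: "T \<in> sets lebesgue" "emeasure lebesgue T > 0" "g ` T \<subseteq> A"
    and C: "C > 0" and a: "\<And>i. 0 \<le> a i"
    and hol: "\<And>y y' d i. y \<in> T \<Longrightarrow> y' \<in> T \<Longrightarrow> 0 < d \<Longrightarrow> dist (g y) (g y') \<le> d \<Longrightarrow> \<bar>y $ i - y' $ i\<bar> \<le> C * d powr a i"
    and s: "0 < (\<Sum>i\<in>UNIV. a i)" "0 \<le> r" "r \<le> (\<Sum>i\<in>UNIV. a i)"
  shows "hausdorff_measure r A \<noteq> 0"
proof
  define N where "N = (2 * C) ^ CARD('n)"
  have N: "N > 0" using C by (simp add: N_def)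
  assume "hausdorff_measure r A = 0"
  \<comment> \<open>Scale 1 keeps all diameters at most 1, so replacing the exponent
    \<open>\<Sum>i. a i\<close> by the smaller \<open>r\<close> only enlarges the powers.\<close>
  then have "hausdorff_premeasure r 1 A = 0" by (simp add: hausdorff_measure_eq_0_iff)
  moreover have "0 < emeasure lebesgue T / ennreal N" using T(2) by (simp add: ennreal_zero_less_divide)
  ultimately obtain U where U: "A \<subseteq> (\<Union>i. U i)" "\<And>i. bounded (U i)" "\<And>i. diameter (U i) \<le> 1"
    "(\<Sum>i. diam_pow r (U i)) < emeasure lebesgue T / ennreal N" using hausdorff_premeasure_zeroE by blast
  have ex: "\<exists>B. {y \<in> T. g y \<in> U k} \<subseteq> B \<and> B \<in> sets lebesgue \<and> emeasure lebesgue B \<le> ennreal N * diam_pow r (U k)" for k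
  proof (cases "{y \<in> T. g y \<in> U k} = {}")
    case True
    then show ?thesis by (intro exI[of _ "{}"]) auto
  next
    case False
    then obtain y0 where y0: "y0 \<in> T" "g y0 \<in> U k" by blast
    define D where "D = diameter (U k)"
    have D: "0 \<le> D" "D \<le> 1" using U(2,3) by (auto simp: D_def diameter_ge_0)
    have dist: "dist (g y) (g y0) \<le> D" if "g y \<in> U k" for y
      unfolding D_def using diameter_bounded_bound[OF U(2) that y0(2)] .
    show ?thesis
    proof (cases "D = 0")
      case True
      \<comment> \<open>A set of diameter 0 may have \<open>diam_pow\<close> equal to 0, so its
        preimage must be null: a coordinate with positive exponent is constant on it, which confines
        it to a hyperplane.\<close>
      obtain i where i: "a i > 0" using s(1) a by (meson linorder_not_less sum_nonpos)
      have "{y \<in> T. g y \<in> U k} \<subseteq> {y. axis i 1 \<bullet> y = y0 $ i}"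
      proof safe
        fix y assume y: "y \<in> T" "g y \<in> U k"
        have le: "\<bar>y $ i - y0 $ i\<bar> \<le> 0 + e" if e: "e > 0" for e
        proof -
          define d where "d = (e / C) powr (1 / a i)"
          have "d > 0" using e C by (simp add: d_def)
          have "\<bar>y $ i - y0 $ i\<bar> \<le> C * d powr a i"
            using dist[OF y(2)] True \<open>d > 0\<close> by (intro hol[OF y(1) y0(1)]) auto
          also have "C * d powr a i = e" using i e C by (simp add: d_def powr_powr)
          finally show ?thesis by simp
        qed
        have "\<bar>y $ i - y0 $ i\<bar> \<le> 0" by (rule field_le_epsilon) (rule le)
        then show "axis i 1 \<bullet> y = y0 $ i" by (simp add: inner_axis')
      qed
      moreover have "negligible {y :: real^'n. axis i 1 \<bullet> y = y0 $ i}"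
        by (rule negligible_hyperplane) simp
      ultimately show ?thesis
        by (intro exI[of _ "{y. axis i 1 \<bullet> y = y0 $ i}"]) (auto simp: negligible_iff_null_sets null_sets_def)
    next
      case False
      then have D0: "D > 0" using D by simp
      define w where "w i = C * D powr a i" for i
      have w: "w i \<ge> 0" for i using C by (simp add: w_def)
      \<comment> \<open>The Hoelder bounds confine the preimage to a box of volume
        \<open>N * D powr (\<Sum>i. a i)\<close>.\<close>
      define B where "B = cbox (\<chi> i. y0 $ i - w i) (\<chi> i. y0 $ i + w i)"
      have "{y \<in> T. g y \<in> U k} \<subseteq> B"
      proof safe
        fix y assume y: "y \<in> T" "g y \<in> U k"
        have "\<bar>y $ i - y0 $ i\<bar> \<le> w i" for i
          unfolding w_def using dist[OF y(2)] D0 by (intro hol[OF y(1) y0(1)]) auto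
        then show "y \<in> B" unfolding B_def mem_box_cart by (auto simp: abs_le_iff algebra_simps)
      qed
      moreover have "emeasure lebesgue B \<le> ennreal N * diam_pow r (U k)"
      proof -
        have "emeasure lebesgue B = emeasure lborel B" unfolding B_def by (simp add: emeasure_completion)
        also have "\<dots> = ennreal (\<Prod>i\<in>UNIV. 2 * w i)"
        proof -
          have "y0 \<in> B" using w by (simp add: B_def mem_box_cart)
          then have ne: "B \<noteq> {}" by blast
          have "emeasure lborel B = ennreal (measure lborel B)"
            unfolding B_def by (rule emeasure_eq_ennreal_measure) (simp add: emeasure_lborel_cbox_eq)
          also have "measure lborel B = (\<Prod>i\<in>UNIV. 2 * w i)"
            using content_cbox_cart[OF ne[unfolded B_def]] unfolding B_def by simp
          finally show ?thesis .
        qed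
        also have "(\<Prod>i\<in>UNIV. 2 * w i) = N * D powr (\<Sum>i\<in>UNIV. a i)"
        proof -
          have "(\<Prod>i\<in>UNIV. 2 * w i) = (\<Prod>i\<in>UNIV. (2 * C) * D powr a i)" by (simp only: w_def mult.assoc)
          also have "\<dots> = (2 * C) ^ CARD('n) * (\<Prod>i\<in>UNIV. D powr a i)" by (simp add: prod.distrib power_mult_distrib)
          also have "(\<Prod>i\<in>UNIV. D powr a i) = D powr (\<Sum>i\<in>UNIV. a i)" using D0 by (simp add: powr_sum)
          finally show ?thesis unfolding N_def .
        qed
        also have "ennreal (N * D powr (\<Sum>i\<in>UNIV. a i)) \<le> ennreal (N * D powr r)"
          using D0 D(2) s(3) N by (intro ennreal_leI mult_left_mono powr_mono') auto
        also have "\<dots> = ennreal N * ennreal (D powr r)" using N by (simp add: ennreal_mult)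
        also have "ennreal (D powr r) = diam_pow r (U k)"
          using y0(2) D0 by (auto simp: diam_pow_def D_def)
        finally show ?thesis .
      qed
      ultimately show ?thesis unfolding B_def by (intro exI[of _ B]) (auto simp: B_def)
    qed
  qed
  define B where "B k = (SOME B. {y \<in> T. g y \<in> U k} \<subseteq> B \<and> B \<in> sets lebesgue \<and> emeasure lebesgue B \<le> ennreal N * diam_pow r (U k))" for k
  have "{y \<in> T. g y \<in> U k} \<subseteq> B k \<and> B k \<in> sets lebesgue \<and> emeasure lebesgue (B k) \<le> ennreal N * diam_pow r (U k)" for k
    unfolding B_def by (rule someI_ex[OF ex])
  then have B: "\<And>k. {y \<in> T. g y \<in> U k} \<subseteq> B k" "\<And>k. B k \<in> sets lebesgue"
    "\<And>k. emeasure lebesgue (B k) \<le> ennreal N * diam_pow r (U k)" by blast+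
  have "T \<subseteq> (\<Union>k. B k)"
  proof
    fix y assume y: "y \<in> T"
    then obtain k where "g y \<in> U k" using T(3) U(1) by blast
    then show "y \<in> (\<Union>k. B k)" using B(1) y by blast
  qed
  then have "emeasure lebesgue T \<le> emeasure lebesgue (\<Union>k. B k)" using B(2) by (intro emeasure_mono) auto
  also have "\<dots> \<le> (\<Sum>k. emeasure lebesgue (B k))" using B(2) by (intro emeasure_subadditive_countably) auto
  also have "\<dots> \<le> (\<Sum>k. ennreal N * diam_pow r (U k))" using B(3) by (intro suminf_le) auto
  also have "\<dots> = ennreal N * (\<Sum>k. diam_pow r (U k))" by simp
  finally have "emeasure lebesgue T / ennreal N \<le> (\<Sum>k. diam_pow r (U k))"
    using N by (intro divide_le_posI_ennreal) auto
  then show False using U(4) by simp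
qed

subsection \<open>Cantor sets on the line\<close>

text \<open>One radius for all intervals, as in box counting: products of such covers are covers by
  cubes of one size.\<close>

definition small_covers :: "real \<Rightarrow> real set \<Rightarrow> bool" where
  "small_covers \<sigma> K \<longleftrightarrow> (\<forall>e>0. \<exists>F d. finite F \<and> 0 < d \<and> d \<le> e \<and> (\<forall>x\<in>K. \<exists>f\<in>F. \<bar>x - f\<bar> \<le> d) \<and> real (card F) * d powr \<sigma> \<le> e)"

lemma small_powr:
  fixes e \<sigma> :: real
  assumes "e > 0" "\<sigma> > 0"
  obtains d0 where "d0 > 0" "d0 \<le> e" "\<And>d. 0 < d \<Longrightarrow> d \<le> d0 \<Longrightarrow> d powr \<sigma> \<le> e"
proof (rule that[of "min e (e powr (1/\<sigma>))"])
  show "0 < min e (e powr (1/\<sigma>))" using assms by simp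
  fix d assume d: "0 < d" "d \<le> min e (e powr (1/\<sigma>))"
  have "d powr \<sigma> \<le> (e powr (1/\<sigma>)) powr \<sigma>" using d assms by (intro powr_mono2) auto
  also have "\<dots> = e" using assms by (simp add: powr_powr)
  finally show "d powr \<sigma> \<le> e" .
qed auto

lemma small_covers_singleton: "\<sigma> > 0 \<Longrightarrow> small_covers \<sigma> {c}"
  unfolding small_covers_def
proof (intro allI impI)
  fix e :: real assume "\<sigma> > 0" "e > 0"
  then obtain d0 where d: "d0 > 0" "d0 \<le> e" "\<And>d. 0 < d \<Longrightarrow> d \<le> d0 \<Longrightarrow> d powr \<sigma> \<le> e" using small_powr by metis
  then show "\<exists>F d. finite F \<and> 0 < d \<and> d \<le> e \<and> (\<forall>x\<in>{c}. \<exists>f\<in>F. \<bar>x - f\<bar> \<le> d) \<and> real (card F) * d powr \<sigma> \<le> e"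
    by (intro exI[of _ "{c}"] exI[of _ d0]) auto
qed

text \<open>An interval of length \<open>r\<close> inside \<open>K\<close> would have to be covered
  by total length at most \<open>r / 2\<close>.\<close>

lemma small_covers_empty_interior:
  assumes "small_covers 1 K"
  shows "interior K = {}"
proof (rule ccontr)
  assume "interior K \<noteq> {}"
  then obtain x r where r: "r > 0" "ball x r \<subseteq> K" by (meson all_not_in_conv mem_interior)
  have sub: "{x - r/2 .. x + r/2} \<subseteq> K" using r by (auto simp: subset_eq dist_real_def abs_le_iff intro!: r(2)[THEN subsetD])
  obtain F d where F: "finite F" "0 < d" "\<And>x. x \<in> K \<Longrightarrow> \<exists>f\<in>F. \<bar>x - f\<bar> \<le> d" "real (card F) * d powr 1 \<le> r/4"
    using assms r(1) unfolding small_covers_def by (metis divide_pos_pos zero_less_numeral)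
  have "{x - r/2 .. x + r/2} \<subseteq> (\<Union>f\<in>F. {f - d .. f + d})"
  proof
    fix y assume "y \<in> {x - r/2 .. x + r/2}"
    then obtain f where "f \<in> F" "\<bar>y - f\<bar> \<le> d" using F(3) sub by blast
    then show "y \<in> (\<Union>f\<in>F. {f - d .. f + d})" by (intro UN_I[of f]) (auto simp: abs_le_iff)
  qed
  then have "emeasure lborel {x - r/2 .. x + r/2} \<le> emeasure lborel (\<Union>f\<in>F. {f - d .. f + d})"
    using F(1) by (intro emeasure_mono) auto
  also have "\<dots> \<le> (\<Sum>f\<in>F. emeasure lborel {f - d .. f + d})" using F(1) by (intro emeasure_subadditive_finite) auto
  also have "\<dots> = (\<Sum>f\<in>F. ennreal (2 * d))" using F(2) by (intro sum.cong) (auto simp: emeasure_lborel_Icc)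
  also have "\<dots> = ennreal (real (card F) * (2 * d))" using F(2) by (simp add: ennreal_mult ennreal_of_nat_eq_real_of_nat)
  finally have "ennreal r \<le> ennreal (real (card F) * (2 * d))" using r(1) by (simp add: emeasure_lborel_Icc)
  then have "r \<le> real (card F) * (2 * d)" using F(2) by (simp add: ennreal_le_iff)
  then show False using F(2,4) r(1) by simp
qed

lemma interval_grid:
  assumes "0 < d" "d \<le> (1::real)"
  obtains F where "finite F" "\<And>x. x \<in> {-1..1} \<Longrightarrow> \<exists>f\<in>F. \<bar>x - f\<bar> \<le> d" "real (card F) \<le> 5 / d"
proof
  define M where "M = \<lceil>1 / d\<rceil>"
  define F where "F = (\<lambda>j. real_of_int j * d) ` {- M .. M}"
  show "finite F" by (simp add: F_def)
  have M: "real_of_int M \<le> 1/d + 1" "1/d \<le> real_of_int M" unfolding M_def by linarith+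
  have "0 < 1 / d" using assms by simp
  then have "0 < real_of_int M" using M(2) by linarith
  then have M0: "M \<ge> 0" by simp
  have "card F \<le> card {- M .. M}" unfolding F_def by (rule card_image_le) simp
  also have "\<dots> = nat (2 * M + 1)" by simp
  finally have "real (card F) \<le> 2 * real_of_int M + 1" using M0 by linarith
  also have "\<dots> \<le> 2 * (1/d) + 3" using M by simp
  also have "\<dots> \<le> 5 / d" using assms by (simp add: field_simps)
  finally show "real (card F) \<le> 5 / d" .
  fix x :: real assume x: "x \<in> {-1..1}"
  define j where "j = \<lfloor>x / d\<rfloor>"
  have j: "real_of_int j \<le> x / d" "x / d < real_of_int j + 1" unfolding j_def by linarith+
  have b: "- (1/d) \<le> x / d" "x / d \<le> 1/d" using x assms by (auto simp: field_simps)
  have "j \<le> M" using j(1) b(2) M(2) by linarith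
  moreover have "- M \<le> j" using j(2) b(1) M(2) by linarith
  ultimately have "real_of_int j * d \<in> F" by (auto simp: F_def)
  moreover have "\<bar>x - real_of_int j * d\<bar> \<le> d" using j assms by (auto simp: field_simps abs_le_iff)
  ultimately show "\<exists>f\<in>F. \<bar>x - f\<bar> \<le> d" by blast
qed

lemma small_covers_interval:
  assumes "\<sigma> > 1"
  shows "small_covers \<sigma> {-1..1}"
  unfolding small_covers_def
proof (intro allI impI)
  fix e :: real assume e: "e > 0"
  obtain d0 where d0: "d0 > 0" "d0 \<le> e/5" "\<And>d. 0 < d \<Longrightarrow> d \<le> d0 \<Longrightarrow> d powr (\<sigma> - 1) \<le> e/5"
    using small_powr[of "e/5" "\<sigma> - 1"] e assms by (metis diff_gt_0_iff_gt divide_pos_pos zero_less_numeral)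
  define d where "d = min 1 d0"
  have d: "0 < d" "d \<le> 1" "d \<le> d0" using d0 by (auto simp: d_def)
  obtain F where F: "finite F" "\<And>x. x \<in> {-1..1} \<Longrightarrow> \<exists>f\<in>F. \<bar>x - f\<bar> \<le> d" "real (card F) \<le> 5 / d"
    using interval_grid[OF d(1,2)] by metis
  have "real (card F) * d powr \<sigma> \<le> 5 / d * d powr \<sigma>" using F(3) by (intro mult_right_mono) auto
  also have "\<dots> = 5 * d powr (\<sigma> - 1)" using d(1) by (simp add: powr_diff)
  also have "\<dots> \<le> e" using d0(3)[OF d(1,3)] by simp
  finally have "real (card F) * d powr \<sigma> \<le> e" .
  moreover have "d \<le> e" using d(3) d0(2) e by linarith
  ultimately show "\<exists>F d. finite F \<and> 0 < d \<and> d \<le> e \<and> (\<forall>x\<in>{-1..1}. \<exists>f\<in>F. \<bar>x - f\<bar> \<le> d) \<and> real (card F) * d powr \<sigma> \<le> e"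
    using F d(1) by blast
qed

definition binary_digit :: "real \<Rightarrow> nat \<Rightarrow> bool" where "binary_digit y j \<longleftrightarrow> odd \<lfloor>2 ^ Suc j * y\<rfloor>"

lemma floor_double: "\<lfloor>2 * x\<rfloor> = 2 * \<lfloor>x\<rfloor> + (if odd \<lfloor>2 * x\<rfloor> then 1 else 0)" for x :: real
proof -
  have "\<lfloor>2 * x\<rfloor> = 2 * \<lfloor>x\<rfloor> \<or> \<lfloor>2 * x\<rfloor> = 2 * \<lfloor>x\<rfloor> + 1" by linarith
  then show ?thesis by auto
qed

lemma equal_bits_close:
  assumes y: "y \<in> {0..<1}" "y' \<in> {0..<1}" and eq: "\<And>j. j < k \<Longrightarrow> binary_digit y j = binary_digit y' j"
  shows "\<bar>y - y'\<bar> < (1/2) ^ k"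
proof -
  have "m \<le> k \<Longrightarrow> \<lfloor>2 ^ m * y\<rfloor> = \<lfloor>2 ^ m * y'\<rfloor>" for m
  proof (induction m)
    case 0
    have "\<lfloor>y\<rfloor> = 0" "\<lfloor>y'\<rfloor> = 0" using y by (simp_all add: floor_eq_iff)
    then show ?case by simp
  next
    case (Suc m)
    then have "binary_digit y m = binary_digit y' m" using eq by simp
    then show ?case
      using Suc floor_double[of "2 ^ m * y"] floor_double[of "2 ^ m * y'"] by (simp add: binary_digit_def mult.assoc)
  qed
  then have "\<lfloor>2 ^ k * y\<rfloor> = \<lfloor>2 ^ k * y'\<rfloor>" by blast
  then have "\<bar>2 ^ k * y - 2 ^ k * y'\<bar> < 1"
    using floor_correct[of "2 ^ k * y"] floor_correct[of "2 ^ k * y'"] by (simp only:) linarith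
  then have "2 ^ k * \<bar>y - y'\<bar> < 1" by (simp add: abs_mult right_diff_distrib[symmetric])
  then show ?thesis by (simp add: power_divide field_simps)
qed

text \<open>Binary digits are reread as digits with ratio \<open>l\<close>, where
  \<open>l powr \<tau> = 1/2\<close>. Numbers first differing at digit \<open>k\<close> are at most
  \<open>(1/2)^k = (l^k) powr \<tau>\<close> apart, and their images at least a multiple of
  \<open>l^k\<close>. For \<open>\<tau> = 0\<close> a point is taken.\<close>

lemma cantor_set_exists:
  assumes tau: "0 \<le> \<tau>" "\<tau> < 1" and delta: "\<delta> > 0"
  obtains K h C where "closed K" "K \<noteq> {}" "C > 0" "\<And>y. y \<in> {0..<1} \<Longrightarrow> h y \<in> K" "\<And>y. \<bar>h y\<bar> \<le> \<delta>"
    "\<And>y y' d. y \<in> {0..<1} \<Longrightarrow> y' \<in> {0..<1} \<Longrightarrow> 0 < d \<Longrightarrow> \<bar>h y - h y'\<bar> \<le> d \<Longrightarrow> \<bar>y - y'\<bar> \<le> C * d powr \<tau>"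
    "\<And>\<sigma>. \<tau> < \<sigma> \<Longrightarrow> small_covers \<sigma> K"
proof (cases "\<tau> = 0")
  case True
  show ?thesis
    by (rule that[of "{0}" 1 "\<lambda>_. 0"]) (use True delta small_covers_singleton in auto)
next
  case False
  define l where "l = 2 powr (- 1 / \<tau>)"
  have tp: "\<tau> > 0" using False tau by simp
  have l: "0 < l" "l < 1/2"
  proof -
    show "0 < l" by (simp add: l_def)
    have "- 1 / \<tau> < - 1" using tp tau by (simp add: field_simps)
    then have "l < 2 powr (- 1)" unfolding l_def by (intro powr_less_mono) auto
    then show "l < 1/2" by (simp add: powr_minus_divide)
  qed
  have "- 1 / \<tau> * \<tau> = -1" using tp by simp
  then have lt: "l powr \<tau> = 1/2" unfolding l_def powr_powr by (simp add: powr_minus_divide)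
  \<comment> \<open>Normalizes the full sum \<open>D / (1 - l)\<close> to
    \<open>\<delta>\<close>.\<close>
  define D where "D = \<delta> * (1 - l)"
  have D: "D > 0" using delta l by (simp add: D_def)
  define tm where "tm y j = (if binary_digit y j then l ^ j else 0)" for y j
  define h where "h y = D * (\<Sum>j. tm y j)" for y
  define hk where "hk k y = D * (\<Sum>j<k. tm y j)" for k y
  have sl: "summable (\<lambda>j. l ^ j)" using l by (intro summable_geometric) auto
  have tm: "0 \<le> tm y j" "tm y j \<le> l ^ j" for y j using l by (auto simp: tm_def)
  have sm: "summable (tm y)" for y
    by (rule summable_comparison_test'[OF sl, of 0]) (use tm in auto)
  have tail: "hk k y \<le> h y" "h y \<le> hk k y + \<delta> * l ^ k" for k y
  proof -
    have sp: "(\<Sum>j. tm y j) = (\<Sum>j. tm y (j + k)) + (\<Sum>j<k. tm y j)" by (rule suminf_split_initial_segment[OF sm])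
    have sk: "summable (\<lambda>j. tm y (j + k))" using sm summable_iff_shift by blast
    have "0 \<le> (\<Sum>j. tm y (j + k))" by (rule suminf_nonneg[OF sk]) (rule tm)
    then show "hk k y \<le> h y" using D by (simp add: h_def hk_def sp)
    have "(\<Sum>j. tm y (j + k)) \<le> (\<Sum>j. l ^ (j + k))"
      by (rule suminf_le[OF _ sk]) (use tm sl summable_iff_shift in auto)
    also have "\<dots> = (\<Sum>j. l ^ j) * l ^ k" by (simp add: power_add suminf_mult2[OF sl, symmetric])
    also have "(\<Sum>j. l ^ j) = 1 / (1 - l)" using l by (intro suminf_geometric) auto
    finally have "D * (\<Sum>j. tm y (j + k)) \<le> D * (1 / (1 - l) * l ^ k)" using D by (intro mult_left_mono) auto
    also have "\<dots> = \<delta> * l ^ k" using l by (simp add: D_def)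
    finally show "h y \<le> hk k y + \<delta> * l ^ k" by (simp add: h_def hk_def sp algebra_simps)
  qed
  \<comment> \<open>Digit sequences ending in all ones do not occur in \<open>binary_digit\<close>,
    so the range has to be closed up.\<close>
  define K where "K = closure (range h)"
  \<comment> \<open>Digit \<open>k\<close> moves the image by \<open>D * l^k\<close>, later digits
    by at most \<open>\<delta> * l^(k+1)\<close>. What remains is \<open>\<kappa> * l^k\<close>,
    positive since \<open>l < 1/2\<close>, that is \<open>\<tau> < 1\<close>.\<close>
  define \<kappa> where "\<kappa> = \<delta> * (1 - 2 * l)"
  have kp: "\<kappa> > 0" using delta l by (simp add: \<kappa>_def)
  have sep: "\<kappa> * l ^ k \<le> h y - h y'" if k: "binary_digit y k" "\<not> binary_digit y' k" "\<And>j. j < k \<Longrightarrow> binary_digit y j = binary_digit y' j" for y y' k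
  proof -
    have "(\<Sum>j<k. tm y j) = (\<Sum>j<k. tm y' j)" using k(3) by (intro sum.cong) (auto simp: tm_def)
    then have "hk (Suc k) y = hk (Suc k) y' + D * l ^ k" using k(1,2) by (simp add: hk_def tm_def algebra_simps)
    then have "D * l ^ k - \<delta> * l ^ Suc k \<le> h y - h y'" using tail(1)[of "Suc k" y] tail(2)[of y' "Suc k"] by simp
    then show ?thesis by (simp add: D_def \<kappa>_def algebra_simps)
  qed
  have hol: "\<bar>y - y'\<bar> \<le> \<kappa> powr (- \<tau>) * d powr \<tau>"
    if y: "y \<in> {0..<1}" "y' \<in> {0..<1}" and d: "0 < d" "\<bar>h y - h y'\<bar> \<le> d" for y y' d
  proof (cases "\<exists>k. binary_digit y k \<noteq> binary_digit y' k")
    case False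
    have "\<bar>y - y'\<bar> \<le> 0"
    proof (rule ccontr)
      assume "\<not> ?thesis"
      then obtain k where "(1/2) ^ k < \<bar>y - y'\<bar>" using real_arch_pow_inv[of "\<bar>y - y'\<bar>" "1/2"] by auto
      then show False using equal_bits_close[OF y, of k] False by auto
    qed
    then show ?thesis by (smt (verit) mult_nonneg_nonneg powr_ge_zero)
  next
    case True
    define k where "k = (LEAST k. binary_digit y k \<noteq> binary_digit y' k)"
    have k: "binary_digit y k \<noteq> binary_digit y' k" unfolding k_def using True by (rule LeastI_ex)
    have below: "binary_digit y j = binary_digit y' j" if "j < k" for j using that not_less_Least unfolding k_def by blast
    have "\<kappa> * l ^ k \<le> \<bar>h y - h y'\<bar>"
    proof (cases "binary_digit y k")
      case True
      then have "\<kappa> * l ^ k \<le> h y - h y'" using k below by (intro sep) auto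
      then show ?thesis by linarith
    next
      case False
      then have "\<kappa> * l ^ k \<le> h y' - h y" using k below by (intro sep) auto
      then show ?thesis by linarith
    qed
    then have "l ^ k \<le> d / \<kappa>" using d kp by (simp add: field_simps)
    then have "(l ^ k) powr \<tau> \<le> (d / \<kappa>) powr \<tau>" using l tp by (intro powr_mono2) auto
    moreover have "(l ^ k) powr \<tau> = (1/2) ^ k"
    proof -
      have "(l ^ k) powr \<tau> = (l powr \<tau>) ^ k" using l by (simp add: powr_realpow[symmetric] powr_powr mult.commute)
      then show ?thesis by (simp add: lt)
    qed
    moreover have "(d / \<kappa>) powr \<tau> = \<kappa> powr (- \<tau>) * d powr \<tau>" using d kp by (simp add: powr_divide powr_minus_divide)
    moreover have "\<bar>y - y'\<bar> < (1/2) ^ k" by (rule equal_bits_close[OF y below])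
    ultimately show ?thesis by linarith
  qed
  have cov: "small_covers \<sigma> K" if sg: "\<tau> < \<sigma>" for \<sigma>
    unfolding small_covers_def
  proof (intro allI impI)
    fix e :: real assume e: "e > 0"
    \<comment> \<open>At level \<open>k\<close> there are \<open>2^k\<close> pieces of size
      \<open>\<delta> * l^k\<close>, so the covering sum is a multiple of \<open>q^k\<close>, and
      \<open>q < 1\<close> exactly when \<open>\<sigma>\<close> exceeds
      \<open>\<tau>\<close>.\<close>
    define q where "q = 2 * l powr \<sigma>"
    have "l powr \<sigma> < l powr \<tau>" using l sg by (intro powr_less_mono') auto
    then have q: "0 \<le> q" "q < 1" using lt by (auto simp: q_def)
    have "(\<lambda>k. q ^ k) \<longlonglongrightarrow> 0" "(\<lambda>k. l ^ k) \<longlonglongrightarrow> 0"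
      using q l by (auto intro!: LIMSEQ_power_zero)
    then have lim: "(\<lambda>k. \<delta> powr \<sigma> * q ^ k) \<longlonglongrightarrow> 0" "(\<lambda>k. \<delta> * l ^ k) \<longlonglongrightarrow> 0"
      by (auto intro!: tendsto_mult_right_zero)
    have "\<forall>\<^sub>F k in sequentially. \<delta> powr \<sigma> * q ^ k < e \<and> \<delta> * l ^ k < e"
      by (intro eventually_conj order_tendstoD(2)[OF lim(1) e] order_tendstoD(2)[OF lim(2) e])
    then obtain k where k: "\<delta> powr \<sigma> * q ^ k < e" "\<delta> * l ^ k < e"
      unfolding eventually_sequentially by blast
    define F where "F = (\<lambda>S. D * (\<Sum>j\<in>S. l ^ j)) ` Pow {..<k}"
    have fin: "finite F" by (simp add: F_def)
    have "card F \<le> card (Pow {..<k})" unfolding F_def by (rule card_image_le) simp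
    then have card: "card F \<le> 2 ^ k" by (simp add: card_Pow)
    have "range h \<subseteq> (\<Union>f\<in>F. {f - \<delta> * l ^ k .. f + \<delta> * l ^ k})"
    proof safe
      fix y
      have "hk k y = D * (\<Sum>j\<in>{j\<in>{..<k}. binary_digit y j}. l ^ j)"
        unfolding hk_def tm_def by (subst sum.inter_filter) auto
      then have "hk k y \<in> F" unfolding F_def by (intro image_eqI[of _ _ "{j\<in>{..<k}. binary_digit y j}"]) auto
      moreover have "h y \<in> {hk k y - \<delta> * l ^ k .. hk k y + \<delta> * l ^ k}"
      proof -
        have "0 \<le> \<delta> * l ^ k" using delta l by simp
        then show ?thesis using tail(1)[of k y] tail(2)[of y k] by simp
      qed
      ultimately show "h y \<in> (\<Union>f\<in>F. {f - \<delta> * l ^ k .. f + \<delta> * l ^ k})" by blast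
    qed
    moreover have "closed (\<Union>f\<in>F. {f - \<delta> * l ^ k .. f + \<delta> * l ^ k})" using fin by (intro closed_UN) auto
    ultimately have KF: "K \<subseteq> (\<Union>f\<in>F. {f - \<delta> * l ^ k .. f + \<delta> * l ^ k})" unfolding K_def by (rule closure_minimal)
    have "real (card F) * (\<delta> * l ^ k) powr \<sigma> \<le> 2 ^ k * (\<delta> * l ^ k) powr \<sigma>"
    proof (intro mult_right_mono)
      have "real (card F) \<le> real (2 ^ k)" using card by (rule of_nat_mono)
      then show "real (card F) \<le> 2 ^ k" by simp
    qed simp
    also have "\<dots> = \<delta> powr \<sigma> * q ^ k"
    proof -
      have "(l ^ k) powr \<sigma> = (l powr \<sigma>) ^ k" using l by (simp add: powr_realpow[symmetric] powr_powr mult.commute)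
      then show ?thesis using delta l by (simp add: powr_mult q_def power_mult_distrib)
    qed
    finally have "real (card F) * (\<delta> * l ^ k) powr \<sigma> \<le> e" using k by simp
    moreover have "\<forall>x\<in>K. \<exists>f\<in>F. \<bar>x - f\<bar> \<le> \<delta> * l ^ k"
    proof
      fix x assume "x \<in> K"
      then obtain f where "f \<in> F" "x \<in> {f - \<delta> * l ^ k .. f + \<delta> * l ^ k}" using KF by blast
      then show "\<exists>f\<in>F. \<bar>x - f\<bar> \<le> \<delta> * l ^ k" by (intro bexI[of _ f]) (auto simp: abs_le_iff)
    qed
    ultimately show "\<exists>F d. finite F \<and> 0 < d \<and> d \<le> e \<and> (\<forall>x\<in>K. \<exists>f\<in>F. \<bar>x - f\<bar> \<le> d) \<and> real (card F) * d powr \<sigma> \<le> e"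
      using fin k(2) delta l by (intro exI[of _ F] exI[of _ "\<delta> * l ^ k"]) auto
  qed
  show ?thesis
  proof (rule that[of K "\<kappa> powr (- \<tau>)" h])
    show "closed K" "K \<noteq> {}" "h y \<in> K" for y using closure_subset[of "range h"] by (auto simp: K_def)
    show "\<bar>h y\<bar> \<le> \<delta>" for y using tail(1)[of 0 y] tail(2)[of y 0] by (simp add: hk_def)
    show "0 < \<kappa> powr (- \<tau>)" using kp by simp
  qed (use hol cov in auto)
qed

subsection \<open>Dimension of the singular set\<close>

lemma prod_over_range:
  fixes f :: "'n::finite \<Rightarrow> 'b::comm_monoid_mult" and \<iota> :: "5 \<Rightarrow> 'n"
  shows "(\<Prod>i\<in>UNIV. f i) = (\<Prod>i\<in>range \<iota>. f i) * (\<Prod>i\<in>- range \<iota>. f i)"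
  using prod.union_disjoint[of "range \<iota>" "- range \<iota>" f] by simp

text \<open>All coordinates are covered at one scale \<open>d\<close>, with \<open>N\<close> points
  in each of five and \<open>5 / d\<close> in each of the \<open>m\<close> others; the count times
  the power of \<open>d\<close> is \<open>5^m * (N * d powr \<sigma>)^5\<close>.\<close>

lemma hausdorff_measure_0_cylinder:
  fixes \<iota> :: "5 \<Rightarrow> 'n::finite" and K :: "'n \<Rightarrow> real set"
  assumes inj: "inj \<iota>" and sg: "0 < \<sigma>"
    and cov: "\<And>e. 0 < e \<Longrightarrow> \<exists>d N. 0 < d \<and> d \<le> e \<and> 0 \<le> N \<and> N * d powr \<sigma> \<le> e \<and>
      (\<forall>i\<in>range \<iota>. \<exists>F. finite F \<and> (\<forall>x\<in>K i. \<exists>f\<in>F. \<bar>x - f\<bar> \<le> d) \<and> real (card F) \<le> N)"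
  shows "hausdorff_measure (real CARD('n) - 5 + 5 * \<sigma>) {x :: real^'n. \<forall>i. x $ i \<in> (if i \<in> range \<iota> then K i else {-1..1})} = 0"
proof -
  have c5: "card (range \<iota>) = 5" using inj by (simp add: card_image)
  then have n5: "5 \<le> CARD('n)" by (metis card_mono finite_class.finite_UNIV subset_UNIV)
  have cc: "card (- range \<iota>) = CARD('n) - 5" by (simp add: Compl_eq_Diff_UNIV card_Diff_subset c5)
  define m where "m = CARD('n) - 5"
  have rm: "real CARD('n) - 5 + 5 * \<sigma> = real m + 5 * \<sigma>" using n5 by (simp add: m_def of_nat_diff)
  show ?thesis unfolding rm
  proof (rule hausdorff_measure_0_product)
    show "0 < real m + 5 * \<sigma>" using sg by (simp add: add_nonneg_pos)
    fix e :: real assume e: "0 < e"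
    \<comment> \<open>The bound by 1 lets the fifth power be replaced by \<open>e'\<close> itself;
      the other one absorbs the grid constant \<open>5^m\<close>.\<close>
    define e' where "e' = min (min e 1) (e / 5 ^ m)"
    have e': "0 < e'" "e' \<le> e" "e' \<le> 1" "5 ^ m * e' \<le> e" using e by (auto simp: e'_def min_def field_simps)
    obtain d N where d: "0 < d" "d \<le> e'" "0 \<le> N" "N * d powr \<sigma> \<le> e'"
      and F: "\<And>i. i \<in> range \<iota> \<Longrightarrow> \<exists>F. finite F \<and> (\<forall>x\<in>K i. \<exists>f\<in>F. \<bar>x - f\<bar> \<le> d) \<and> real (card F) \<le> N"
      using cov[OF e'(1)] by blast
    obtain G where G: "finite G" "\<And>x. x \<in> {-1..1} \<Longrightarrow> \<exists>f\<in>G. \<bar>x - f\<bar> \<le> d" "real (card G) \<le> 5 / d"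
      using interval_grid[of d] d(1,2) e'(3) by (metis order.trans)
    have "\<forall>i\<in>range \<iota>. \<exists>F. finite F \<and> (\<forall>x\<in>K i. \<exists>f\<in>F. \<bar>x - f\<bar> \<le> d) \<and> real (card F) \<le> N" using F by blast
    then obtain F0 where F0: "\<forall>i\<in>range \<iota>. finite (F0 i) \<and> (\<forall>x\<in>K i. \<exists>f\<in>F0 i. \<bar>x - f\<bar> \<le> d) \<and> real (card (F0 i)) \<le> N"
      by (rule bchoice[THEN exE])
    define F1 where "F1 i = (if i \<in> range \<iota> then F0 i else G)" for i
    have pd: "d powr (real m + 5 * \<sigma>) = d ^ m * (d powr \<sigma>) ^ 5"
    proof -
      have "d powr (5 * \<sigma>) = (d powr \<sigma>) ^ 5"
        using d(1) powr_realpow[of "d powr \<sigma>" 5] by (simp add: powr_powr mult.commute)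
      then show ?thesis using d(1) by (simp add: powr_add powr_realpow)
    qed
    have "real (\<Prod>i\<in>UNIV. card (F1 i)) = (\<Prod>i\<in>range \<iota>. real (card (F1 i))) * (\<Prod>i\<in>- range \<iota>. real (card (F1 i)))"
      unfolding of_nat_prod by (rule prod_over_range)
    also have "\<dots> \<le> (\<Prod>i\<in>range \<iota>. N) * (\<Prod>i\<in>- range \<iota>. 5 / d)"
      using F0 G(3) d(3) by (intro mult_mono prod_mono prod_nonneg) (auto simp: F1_def)
    also have "\<dots> = N ^ 5 * (5 / d) ^ m" unfolding prod_constant c5 cc m_def ..
    finally have "real (\<Prod>i\<in>UNIV. card (F1 i)) * d powr (real m + 5 * \<sigma>) \<le> N ^ 5 * (5 / d) ^ m * d powr (real m + 5 * \<sigma>)"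
      by (intro mult_right_mono) auto
    also have "\<dots> = 5 ^ m * (N * d powr \<sigma>) ^ 5"
      unfolding pd using d(1) by (simp add: power_divide power_mult_distrib)
    also have "\<dots> \<le> 5 ^ m * e'"
    proof (rule mult_left_mono)
      have "0 \<le> N * d powr \<sigma>" using d by simp
      then have "(N * d powr \<sigma>) ^ 5 \<le> e' ^ 5" using d(4) by (intro power_mono) auto
      also have "e' ^ 5 \<le> e' ^ 1" using e' by (intro power_decreasing) auto
      finally show "(N * d powr \<sigma>) ^ 5 \<le> e'" by simp
    qed simp
    also have "\<dots> \<le> e" by (rule e'(4))
    finally have card: "real (\<Prod>i\<in>UNIV. card (F1 i)) * d powr (real m + 5 * \<sigma>) \<le> e" .
    have "finite (F1 i) \<and> (\<forall>x\<in>(if i \<in> range \<iota> then K i else {-1..1}). \<exists>f\<in>F1 i. \<bar>x - f\<bar> \<le> d)" for i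
    proof (cases "i \<in> range \<iota>")
      case True
      then have "F1 i = F0 i" "(if i \<in> range \<iota> then K i else {-1..1}) = K i" by (simp_all add: F1_def)
      then show ?thesis using bspec[OF F0 True] by metis
    next
      case False
      then have "F1 i = G" "(if i \<in> range \<iota> then K i else {-1..1}) = {-1..1}" by (simp_all add: F1_def)
      then show ?thesis using G(1,2) by (simp only:) blast
    qed
    then show "\<exists>F d. 0 < d \<and> d \<le> e \<and> (\<forall>i. finite (F i) \<and> (\<forall>x\<in>(if i \<in> range \<iota> then K i else {-1..1}). \<exists>f\<in>F i. \<bar>x - f\<bar> \<le> d)) \<and>
       real (\<Prod>i\<in>UNIV. card (F i)) * d powr (real m + 5 * \<sigma>) \<le> e"
      using card d(1,2) e'(2) by (intro exI[of _ F1] exI[of _ d]) auto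
  qed
qed

lemma ball_coordinate: "x \<in> ball 0 1 \<Longrightarrow> x $ i \<in> {-1..1}" for x :: "real^'n"
  using component_le_norm_cart[of x i] by (simp add: abs_le_iff)

text \<open>The points above one centre form a cylinder with one-point bases, null in every
  dimension above \<open>n - 5\<close>. With the cylinder over \<open>K\<close> this is a countable
  union of null sets.\<close>

lemma hausdorff_measure_0_singular:
  fixes \<iota> :: "5 \<Rightarrow> 'n::finite" and ctr :: "nat \<Rightarrow> real^5"
  assumes inj: "inj \<iota>" and K: "small_covers \<sigma> K" and sg: "0 < \<sigma>"
    and S: "S \<subseteq> {x \<in> ball 0 1. (\<forall>j. restrict5 \<iota> x $ j \<in> K) \<or> restrict5 \<iota> x \<in> range ctr}"
  shows "hausdorff_measure (real CARD('n) - 5 + 5 * \<sigma>) S = 0"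
proof -
  define X where "X = {x :: real^'n. \<forall>i. x $ i \<in> (if i \<in> range \<iota> then K else {-1..1})}"
  define Y where "Y k = {x :: real^'n. \<forall>i. x $ i \<in> (if i \<in> range \<iota> then {ctr k $ inv \<iota> i} else {-1..1})}" for k
  define Z where "Z k = (case k of 0 \<Rightarrow> X | Suc m \<Rightarrow> Y m)" for k
  have X0: "hausdorff_measure (real CARD('n) - 5 + 5 * \<sigma>) X = 0"
    unfolding X_def
  proof (rule hausdorff_measure_0_cylinder[OF inj sg])
    fix e :: real assume "0 < e"
    then obtain F d where "finite F" "0 < d" "d \<le> e" "\<forall>x\<in>K. \<exists>f\<in>F. \<bar>x - f\<bar> \<le> d" "real (card F) * d powr \<sigma> \<le> e"
      using K unfolding small_covers_def by blast
    then show "\<exists>d N. 0 < d \<and> d \<le> e \<and> 0 \<le> N \<and> N * d powr \<sigma> \<le> e \<and>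
      (\<forall>i\<in>range \<iota>. \<exists>F. finite F \<and> (\<forall>x\<in>K. \<exists>f\<in>F. \<bar>x - f\<bar> \<le> d) \<and> real (card F) \<le> N)"
      by (intro exI[of _ d] exI[of _ "real (card F)"]) auto
  qed
  have Y0: "hausdorff_measure (real CARD('n) - 5 + 5 * \<sigma>) (Y k) = 0" for k
    unfolding Y_def
  proof (rule hausdorff_measure_0_cylinder[OF inj sg])
    fix e :: real assume "0 < e"
    then obtain d where d: "d > 0" "d \<le> e" "\<And>r. 0 < r \<Longrightarrow> r \<le> d \<Longrightarrow> r powr \<sigma> \<le> e" using small_powr[OF _ sg] by metis
    have "\<exists>F. finite F \<and> (\<forall>x\<in>{c}. \<exists>f\<in>F. \<bar>x - f\<bar> \<le> d) \<and> real (card F) \<le> 1" for c :: real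
      using d(1) by (intro exI[of _ "{c}"]) auto
    then show "\<exists>d N. 0 < d \<and> d \<le> e \<and> 0 \<le> N \<and> N * d powr \<sigma> \<le> e \<and>
      (\<forall>i\<in>range \<iota>. \<exists>F. finite F \<and> (\<forall>x\<in>{ctr k $ inv \<iota> i}. \<exists>f\<in>F. \<bar>x - f\<bar> \<le> d) \<and> real (card F) \<le> N)"
      using d(1,2) d(3)[OF d(1) order_refl] by (intro exI[of _ d] exI[of _ 1]) auto
  qed
  have "hausdorff_measure (real CARD('n) - 5 + 5 * \<sigma>) (\<Union>k. Z k) = 0"
    by (rule hausdorff_measure_countable_Union_0) (use X0 Y0 in \<open>auto simp: Z_def split: nat.split\<close>)
  moreover have "S \<subseteq> (\<Union>k. Z k)"
  proof
    fix x assume "x \<in> S"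
    then have b: "x \<in> ball 0 1" and c: "(\<forall>j. restrict5 \<iota> x $ j \<in> K) \<or> restrict5 \<iota> x \<in> range ctr" using S by auto
    from c show "x \<in> (\<Union>k. Z k)"
    proof
      assume k: "\<forall>j. restrict5 \<iota> x $ j \<in> K"
      have "x $ i \<in> (if i \<in> range \<iota> then K else {-1..1})" for i
        using k ball_coordinate[OF b, of i] by (auto simp: restrict5_def)
      then have "x \<in> Z 0" by (simp add: Z_def X_def)
      then show ?thesis by blast
    next
      assume "restrict5 \<iota> x \<in> range ctr"
      then obtain k where k: "restrict5 \<iota> x = ctr k" by blast
      have "x $ i \<in> (if i \<in> range \<iota> then {ctr k $ inv \<iota> i} else {-1..1})" for i
        using ball_coordinate[OF b, of i] inv_f_f[OF inj] by (auto simp: k[symmetric] restrict5_def)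
      then have "x \<in> Z (Suc k)" by (simp add: Z_def Y_def)
      then show ?thesis by blast
    qed
  qed
  ultimately show ?thesis by (rule hausdorff_measure_mono_0)
qed

lemma inj_5_exists:
  assumes "CARD('n::finite) \<ge> 5"
  obtains \<iota> :: "5 \<Rightarrow> 'n::finite" where "inj \<iota>"
proof -
  have "card (UNIV :: 5 set) \<le> card (UNIV :: 'n set)" using assms by simp
  then show ?thesis using that card_le_inj[of "UNIV :: 5 set" "UNIV :: 'n set"] by auto
qed

text \<open>Each of the five active coordinates contributes \<open>\<tau>\<close> and every other
  coordinate 1, so \<open>s = n - 5 + 5 \<tau>\<close>, and \<open>s < n\<close> is the condition
  \<open>\<tau> < 1\<close> of the Cantor construction.\<close>

lemma singular_solution_fractional_dimension:
  fixes s :: real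
  assumes n: "CARD('n::finite) \<ge> 5" and s: "real CARD('n) - 5 \<le> s" "s < real CARD('n)"
  shows "\<exists>(F :: real^'n^'n \<Rightarrow> real) u. uniformly_elliptic F \<and> viscosity_solution F u \<and> hausdorff_dim (Sing u) = ereal s"
proof -
  obtain \<iota> :: "5 \<Rightarrow> 'n" where inj: "inj \<iota>" by (rule inj_5_exists[OF n])
  have c5: "card (range \<iota>) = 5" using inj by (simp add: card_image)
  define \<tau> where "\<tau> = (s - (real CARD('n) - 5)) / 5"
  have tau: "0 \<le> \<tau>" "\<tau> < 1" using s by (auto simp: \<tau>_def)
  have st: "s = real CARD('n) - 5 + 5 * \<tau>" by (simp add: \<tau>_def field_simps)
  \<comment> \<open>Coordinates bounded by \<open>\<delta>\<close> have l1 norm at most 1/2, which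
    keeps the parametrized set inside the unit ball.\<close>
  define \<delta> where "\<delta> = 1 / (2 * real CARD('n))"
  have delta: "\<delta> > 0" using n by (simp add: \<delta>_def)
  obtain K h C where K: "closed K" "K \<noteq> {}" "C > 0" "\<And>y. y \<in> {0..<1} \<Longrightarrow> h y \<in> K" "\<And>y. \<bar>h y\<bar> \<le> \<delta>"
    and hol: "\<And>y y' d. y \<in> {0..<1} \<Longrightarrow> y' \<in> {0..<1} \<Longrightarrow> 0 < d \<Longrightarrow> \<bar>h y - h y'\<bar> \<le> d \<Longrightarrow> \<bar>y - y'\<bar> \<le> C * d powr \<tau>"
    and cov: "\<And>\<sigma>. \<tau> < \<sigma> \<Longrightarrow> small_covers \<sigma> K"
    using cantor_set_exists[OF tau delta] by metis
  have iK: "interior K = {}" using cov[of 1] tau by (intro small_covers_empty_interior) auto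
  define E :: "(real^5) set" where "E = {z. \<forall>j. z $ j \<in> K}"
  have "E = (\<Inter>j. {z. z $ j \<in> K})" by (auto simp: E_def)
  then have E1: "closed E" using coordinate_preimage_closed_empty_interior(1)[OF K(1) iK] by auto
  have "interior E \<subseteq> interior {z. z $ 1 \<in> K}" by (rule interior_mono) (auto simp: E_def)
  then have E2: "interior E = {}" using coordinate_preimage_closed_empty_interior(2)[OF K(1) iK, of 1] by blast
  obtain k0 where "k0 \<in> K" using K(2) by blast
  then have "(\<chi> j. k0) \<in> E" by (simp add: E_def)
  then have E3: "E \<noteq> {}" by blast
  obtain F :: "real^'n^'n \<Rightarrow> real" and u and ctr :: "nat \<Rightarrow> real^5" where Fu: "uniformly_elliptic F" "viscosity_solution F u"
    "Sing u = {x \<in> ball 0 1. restrict5 \<iota> x \<in> E \<union> range ctr}"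
    by (rule singular_set_exists[OF inj E1 E3 E2])
  have "hausdorff_dim (Sing u) = ereal s"
  proof (rule hausdorff_dim_eqI)
    show "0 \<le> s" using n s by simp
    fix r assume r: "s < r"
    define \<sigma> where "\<sigma> = (r - (real CARD('n) - 5)) / 5"
    have sg: "\<tau> < \<sigma>" "0 < \<sigma>" using r tau by (auto simp: \<sigma>_def \<tau>_def divide_strict_right_mono)
    have "hausdorff_measure (real CARD('n) - 5 + 5 * \<sigma>) (Sing u) = 0"
      by (rule hausdorff_measure_0_singular[OF inj cov[OF sg(1)] sg(2), of _ ctr]) (auto simp: Fu(3) E_def)
    moreover have "real CARD('n) - 5 + 5 * \<sigma> = r" by (simp add: \<sigma>_def field_simps)
    ultimately show "hausdorff_measure r (Sing u) = 0" by (simp only:)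
  next
    fix r assume r: "0 \<le> r" "r < s"
    \<comment> \<open>These exponents add up to \<open>s\<close>: Hoelder exponent
      \<open>\<tau>\<close> where \<open>h\<close> is used, Lipschitz where \<open>g\<close> is the
      identity.\<close>
    define a where "a i = (if i \<in> range \<iota> then \<tau> else 1)" for i
    define g :: "real^'n \<Rightarrow> real^'n" where "g y = (\<chi> i. if i \<in> range \<iota> then h (y $ i) else y $ i)" for y
    define T :: "(real^'n) set" where "T = box 0 (\<chi> i. if i \<in> range \<iota> then 1 else \<delta>)"
    have Ti: "0 < y $ i" "i \<in> range \<iota> \<Longrightarrow> y $ i < 1" "i \<notin> range \<iota> \<Longrightarrow> y $ i < \<delta>" if "y \<in> T" for y i
      using that by (auto simp: T_def mem_box_cart split: if_splits)
    have suma: "(\<Sum>i\<in>UNIV. a i) = s"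
    proof -
      have "(\<Sum>i\<in>UNIV. a i) = (\<Sum>i\<in>range \<iota>. a i) + (\<Sum>i\<in>- range \<iota>. a i)"
        using sum.union_disjoint[of "range \<iota>" "- range \<iota>" a] by simp
      also have "\<dots> = 5 * \<tau> + (real CARD('n) - 5)"
        using n by (simp add: a_def c5 Compl_eq_Diff_UNIV card_Diff_subset of_nat_diff)
      finally show ?thesis by (simp add: st)
    qed
    show "hausdorff_measure r (Sing u) \<noteq> 0"
    proof (rule hausdorff_measure_nonzero[of T g "Sing u" "max C 1" a])
      show "T \<in> sets lebesgue" by (simp add: T_def)
      have "(\<chi> i. (if i \<in> range \<iota> then 1 else \<delta>) / 2) \<in> T" using delta by (simp add: T_def mem_box_cart)
      then have "\<not> negligible T" by (intro open_not_negligible) (auto simp: T_def)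
      then show "emeasure lebesgue T > 0"
        by (auto simp: T_def negligible_iff_null_sets null_sets_def zero_less_iff_neq_zero)
      show "g ` T \<subseteq> Sing u"
      proof safe
        fix y assume y: "y \<in> T"
        have "norm (g y) \<le> (\<Sum>i\<in>UNIV. \<bar>g y $ i\<bar>)" by (rule norm_le_l1_cart)
        also have "\<dots> \<le> (\<Sum>i\<in>(UNIV :: 'n set). \<delta>)"
        proof (rule sum_mono)
          fix i
          show "\<bar>g y $ i\<bar> \<le> \<delta>"
          proof (cases "i \<in> range \<iota>")
            case True
            then have "g y $ i = h (y $ i)" by (simp add: g_def)
            then show ?thesis using K(5) by simp
          next
            case False
            then have "g y $ i = y $ i" by (simp add: g_def)
            then show ?thesis using Ti(1)[OF y, of i] Ti(3)[OF y False] by simp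
          qed
        qed
        also have "\<dots> < 1" using n by (simp add: \<delta>_def)
        finally have "g y \<in> ball 0 1" by simp
        moreover have "restrict5 \<iota> (g y) \<in> E"
          using Ti(1,2)[OF y] by (simp add: E_def restrict5_def g_def K(4) less_imp_le)
        ultimately show "g y \<in> Sing u" by (simp add: Fu(3))
      qed
      show "0 < max C 1" by simp
      show "0 \<le> a i" for i using tau by (simp add: a_def)
      show "0 < (\<Sum>i\<in>UNIV. a i)" "r \<le> (\<Sum>i\<in>UNIV. a i)" using r unfolding suma by auto
      show "0 \<le> r" by (rule r)
      fix y y' d i assume y: "y \<in> T" "y' \<in> T" and d: "0 < d" "dist (g y) (g y') \<le> d"
      have gi: "\<bar>g y $ i - g y' $ i\<bar> \<le> d"
        using component_le_norm_cart[of "g y - g y'" i] d(2) by (simp add: dist_norm)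
      show "\<bar>y $ i - y' $ i\<bar> \<le> max C 1 * d powr a i"
      proof (cases "i \<in> range \<iota>")
        case True
        have "\<bar>y $ i - y' $ i\<bar> \<le> C * d powr \<tau>"
          using Ti[OF y(1), of i] Ti[OF y(2), of i] True gi d(1) by (intro hol) (auto simp: g_def)
        also have "\<dots> \<le> max C 1 * d powr \<tau>" by (intro mult_right_mono) auto
        finally show ?thesis using True by (simp add: a_def)
      next
        case False
        have "\<bar>y $ i - y' $ i\<bar> \<le> 1 * d" using gi False by (simp add: g_def)
        also have "\<dots> \<le> max C 1 * d" using d(1) by (intro mult_right_mono) auto
        finally show ?thesis using False d(1) by (simp add: a_def)
      qed
    qed
  qed
  with Fu(1,2) show ?thesis by blast
qed

text \<open>The hyperplanes at rational heights form a null set; inner regularity of Lebesgue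
  measure finds a closed set of positive measure in what is left of the ball.\<close>

lemma irrational_slice_compact:
  fixes i :: "'n::finite"
  obtains T :: "(real^'n) set" where "compact T" "T \<subseteq> ball 0 1" "\<And>x. x \<in> T \<Longrightarrow> x $ i \<notin> \<rat>" "emeasure lebesgue T > 0"
proof -
  define H where "H q = {x :: real^'n. axis i 1 \<bullet> x = q}" for q
  define Q where "Q = (\<Union>q\<in>\<rat>. H q)"
  have nq: "negligible Q" unfolding Q_def
  proof (rule negligible_countable_Union)
    show "countable (H ` \<rat>)" by (intro countable_image countable_rat)
    show "negligible s" if "s \<in> H ` \<rat>" for s using that by (auto simp: H_def intro!: negligible_hyperplane)
  qed
  define S where "S = ball (0 :: real^'n) 1 - Q"
  have Q: "Q \<in> null_sets lebesgue" using nq by (simp add: negligible_iff_null_sets)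
  have S: "S \<in> sets lebesgue" unfolding S_def using Q by (intro sets.Diff) auto
  have eS: "emeasure lebesgue S = emeasure lebesgue (ball (0 :: real^'n) 1)"
    unfolding S_def using Q by (intro emeasure_Diff_null_set) auto
  have "\<not> negligible (ball (0 :: real^'n) 1)" by (rule open_not_negligible) auto
  then have pos: "emeasure lebesgue S > 0" unfolding eS
    by (auto simp: negligible_iff_null_sets null_sets_def zero_less_iff_neq_zero)
  have fin: "emeasure lebesgue S < \<infinity>" unfolding eS using lmeasurable_ball[of "0 :: real^'n" 1] by (simp add: fmeasurable_def)
  define M where "M = measure lebesgue S"
  have M2: "emeasure lebesgue S = ennreal M"
    unfolding M_def by (rule emeasure_eq_ennreal_measure) (use fin in auto)
  have M1: "M > 0"
  proof (rule ccontr)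
    assume "\<not> M > 0"
    then have "ennreal M = 0" by (intro ennreal_neg) simp
    then show False using pos M2 by simp
  qed
  note M = M1 M2
  obtain T where T: "closed T" "T \<subseteq> S" "S - T \<in> lmeasurable" "emeasure lebesgue (S - T) < ennreal M"
    using sets_lebesgue_inner_closed[OF S M(1)] by metis
  have Ts: "T \<in> sets lebesgue" using T(1) by simp
  have "emeasure lebesgue T > 0"
  proof (rule ccontr)
    assume "\<not> ?thesis"
    then have z: "emeasure lebesgue T = 0" by simp
    have "emeasure lebesgue S = emeasure lebesgue (T \<union> (S - T))" using T(2) by (simp add: Un_absorb1)
    also have "\<dots> \<le> emeasure lebesgue T + emeasure lebesgue (S - T)" using Ts S by (intro emeasure_subadditive) auto
    also have "\<dots> < ennreal M" using z T(4) by simp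
    finally show False using M(2) by simp
  qed
  moreover have Tb: "T \<subseteq> ball 0 1" using T(2) by (auto simp: S_def)
  have "compact T" using T(1) bounded_subset[OF bounded_ball Tb] by (simp add: compact_eq_bounded_closed)
  moreover have "x $ i \<notin> \<rat>" if "x \<in> T" for x
    using that T(2) by (auto simp: S_def Q_def H_def inner_axis')
  ultimately show ?thesis using that[of T] Tb by blast
qed

text \<open>One example serves both claims: it has positive measure and settles the endpoint
  \<open>s = n\<close>, which lies outside the range \<open>\<tau> < 1\<close> of the Cantor
  sets.\<close>

lemma singular_solution_positive_measure:
  assumes n: "CARD('n::finite) \<ge> 5"
  shows "\<exists>(F :: real^'n^'n \<Rightarrow> real) u. uniformly_elliptic F \<and> viscosity_solution F u \<and>
    hausdorff_dim (Sing u) = ereal (real CARD('n)) \<and> emeasure lebesgue (Sing u) > 0"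
proof -
  obtain \<iota> :: "5 \<Rightarrow> 'n" where inj: "inj \<iota>" by (rule inj_5_exists[OF n])
  obtain T :: "(real^'n) set" where T: "compact T" "T \<subseteq> ball 0 1" "\<And>x. x \<in> T \<Longrightarrow> x $ \<iota> 1 \<notin> \<rat>" "emeasure lebesgue T > 0"
    using irrational_slice_compact[of "\<iota> 1"] by metis
  define K where "K = (\<lambda>x. x $ \<iota> 1) ` T"
  have "compact K" unfolding K_def by (intro compact_continuous_image continuous_intros T(1))
  then have K: "closed K" by (rule compact_imp_closed)
  have iK: "interior K = {}"
  proof (rule ccontr)
    assume "interior K \<noteq> {}"
    then obtain x r where r: "r > 0" "ball x r \<subseteq> K" by (meson all_not_in_conv mem_interior)
    obtain q where q: "q \<in> \<rat>" "x < q" "q < x + r" using Rats_dense_in_real[of x "x + r"] r(1) by auto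
    then have "q \<in> K" using r(2) by (auto simp: dist_real_def)
    then show False using q(1) T(3) by (auto simp: K_def)
  qed
  define E :: "(real^5) set" where "E = {z. z $ 1 \<in> K}"
  note E = coordinate_preimage_closed_empty_interior[OF K iK, of "1::5", folded E_def]
  have "T \<noteq> {}" using T(4) by auto
  then obtain x0 where "x0 \<in> T" by blast
  then have "restrict5 \<iota> x0 \<in> E" by (auto simp: E_def K_def restrict5_def)
  then have E3: "E \<noteq> {}" by blast
  obtain F :: "real^'n^'n \<Rightarrow> real" and u and ctr :: "nat \<Rightarrow> real^5" where Fu: "uniformly_elliptic F" "viscosity_solution F u"
    "Sing u = {x \<in> ball 0 1. restrict5 \<iota> x \<in> E \<union> range ctr}"
    by (rule singular_set_exists[OF inj E(1) E3 E(2)])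
  have sub: "T \<subseteq> Sing u" using T(2) by (auto simp: Fu(3) E_def K_def restrict5_def)
  have Ts: "T \<in> sets lebesgue" using T(1) by (simp add: compact_imp_closed)
  \<comment> \<open>\<open>emeasure\<close> is 0 outside the sigma-algebra, so the inclusion of
    \<open>T\<close> bounds the measure only once \<open>Sing u\<close> is known to be
    measurable.\<close>
  have meas: "Sing u \<in> sets lebesgue"
  proof -
    have cont: "continuous_on UNIV (restrict5 \<iota>)"
      using linear_restrict5[of \<iota>] unfolding linear_conv_bounded_linear by (rule linear_continuous_on)
    have "restrict5 \<iota> \<in> borel \<rightarrow>\<^sub>M borel" by (rule borel_measurable_continuous_onI[OF cont])
    moreover have "E \<union> range ctr \<in> sets borel"
    proof (rule sets.Un)
      show "E \<in> sets borel" by (rule borel_closed[OF E(1)])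
      have "(\<Union>k. {ctr k}) \<in> sets borel" by (intro sets.countable_UN image_subsetI borel_closed closed_singleton)
      then show "range ctr \<in> sets borel" by (simp add: UNION_singleton_eq_range)
    qed
    ultimately have "restrict5 \<iota> -` (E \<union> range ctr) \<inter> space borel \<in> sets borel" by (rule measurable_sets)
    then have "ball 0 1 \<inter> restrict5 \<iota> -` (E \<union> range ctr) \<in> sets borel" by simp
    moreover have "Sing u = ball 0 1 \<inter> restrict5 \<iota> -` (E \<union> range ctr)" by (auto simp: Fu(3))
    ultimately have "Sing u \<in> sets lborel" by simp
    then show ?thesis by (rule sets_completionI_sets)
  qed
  have "emeasure lebesgue T \<le> emeasure lebesgue (Sing u)" by (rule emeasure_mono[OF sub meas])
  then have pos: "emeasure lebesgue (Sing u) > 0" using T(4) by (rule order.strict_trans2[rotated])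
  have "hausdorff_dim (Sing u) = ereal (real CARD('n))"
  proof (rule hausdorff_dim_eqI)
    show "0 \<le> real CARD('n)" by simp
    fix r assume r: "real CARD('n) < r"
    define \<sigma> where "\<sigma> = (r - (real CARD('n) - 5)) / 5"
    have sg: "1 < \<sigma>" "0 < \<sigma>" using r by (auto simp: \<sigma>_def)
    \<comment> \<open>The whole interval \<open>{-1..1}\<close> takes the place of the Cantor set,
      at the price of \<open>\<sigma> > 1\<close>.\<close>
    have "hausdorff_measure (real CARD('n) - 5 + 5 * \<sigma>) (Sing u) = 0"
      by (rule hausdorff_measure_0_singular[OF inj small_covers_interval[OF sg(1)] sg(2), of _ ctr])
        (use ball_coordinate in \<open>auto simp: Fu(3) restrict5_def\<close>)
    moreover have "real CARD('n) - 5 + 5 * \<sigma> = r" by (simp add: \<sigma>_def field_simps)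
    ultimately show "hausdorff_measure r (Sing u) = 0" by (simp only:)
  next
    fix r assume r: "0 \<le> r" "r < real CARD('n)"
    show "hausdorff_measure r (Sing u) \<noteq> 0"
    proof (rule hausdorff_measure_nonzero[of T "\<lambda>x. x" "Sing u" 1 "\<lambda>_. 1"])
      fix y y' :: "real^'n" and d i assume "0 < d" "dist y y' \<le> d"
      then show "\<bar>y $ i - y' $ i\<bar> \<le> 1 * d powr 1"
        using component_le_norm_cart[of "y - y'" i] by (simp add: dist_norm)
    qed (use Ts T(4) sub r in auto)
  qed
  with Fu(1,2) pos show ?thesis by blast
qed

theorem mainTheorem3:
  assumes "CARD('n::finite) \<ge> 5"
  shows "(\<forall>s::real. real CARD('n) - 5 \<le> s \<and> s \<le> real CARD('n) \<longrightarrow>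
            (\<exists>(F :: real^'n^'n \<Rightarrow> real) (u :: real^'n \<Rightarrow> real).
               uniformly_elliptic F \<and> viscosity_solution F u \<and>
               hausdorff_dim (Sing u) = ereal s)) \<and>
         (\<exists>(F :: real^'n^'n \<Rightarrow> real) (u :: real^'n \<Rightarrow> real).
            uniformly_elliptic F \<and> viscosity_solution F u \<and>
            emeasure lebesgue (Sing u) > 0)"
proof (intro conjI allI impI)
  fix s :: real assume s: "real CARD('n) - 5 \<le> s \<and> s \<le> real CARD('n)"
  show "\<exists>(F :: real^'n^'n \<Rightarrow> real) u. uniformly_elliptic F \<and> viscosity_solution F u \<and> hausdorff_dim (Sing u) = ereal s"
  proof (cases "s < real CARD('n)")
    case True
    then show ?thesis using singular_solution_fractional_dimension[OF assms] s by blast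
  next
    case False
    then have "s = real CARD('n)" using s by linarith
    then show ?thesis using singular_solution_positive_measure[OF assms] by blast
  qed
next
  show "\<exists>(F :: real^'n^'n \<Rightarrow> real) u. uniformly_elliptic F \<and> viscosity_solution F u \<and> emeasure lebesgue (Sing u) > 0"
    using singular_solution_positive_measure[OF assms] by blast
qed

end
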